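(* Let $r>0$ be a real number. For every real $\epsilon>0$, there exists a finite set $\mathcal{S}$ of prime numbers such that $$r-\epsilon<\mathcal{N}_{\mathbb{Q}^{t_{\mathcal{S}}}}\le 2r.$$
   Context: $\overline{\mathbb{Q}}$ is a fixed algebraic closure of $\mathbb{Q}$. For $\alpha\in\overline{\mathbb{Q}}$ of degree $d$ over $\mathbb{Q}$, $h(\alpha)=\frac1d\log\left(|a|\prod_{i=1}^d\max(1,|\alpha_i|)\right)$ is the absolute logarithmic Weil height, where $a$ is the leading coefficient of the minimal polynomial of $\alpha$ over $\mathbb{Z}$ and $\alpha_1,\dots,\alpha_d$ are the conjugates of $\alpha$ over $\mathbb{Q}$. The Northcott number of a set $X\subseteq\overline{\mathbb{Q}}$ is $$\mathcal{N}_X=\inf\{t\in[0,+\infty)\mid \#\{\alpha\in X\mid h(\alpha)<t\}=\infty\}$$ (equal to $+\infty$ if there is no such $t$). For a finite set $\mathcal{S}$ of primes, $\mathbb{Q}^{t_{\mathcal{S}}}$ is the maximal subfield of $\overline{\mathbb{Q}}$ in which all primes in $\mathcal{S}$ split totally. *)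

theory Defs
  imports
    "HOL-Analysis.Analysis"
    "HOL-Algebra.Ideal_Product"
    "HOL-Algebra.Finite_Extensions"
    "HOL-Algebra.Algebraic_Closure_Type"
begin

hide_const (open) Divisibility.prime Divisibility.irreducible
  Polynomials.degree Polynomials.lead_coeff

text \<open>
  The fixed algebraic closure of the rationals is taken inside the complex numbers: it is the set of
  all \<open>x :: complex\<close> with \<open>algebraic x\<close>. The conjugates of an algebraic number are
  then the complex roots of its minimal polynomial.
\<close>

subsection \<open>Weil height and Northcott number\<close>

text \<open>
  Irreducibility in \<open>int poly\<close> is irreducibility in the ring \<open>\<int>[X]\<close>, so it includes
  primitivity; the sign condition makes the polynomial unique.
\<close>

definition min_poly_int :: "complex \<Rightarrow> int poly" where
  "min_poly_int \<alpha> =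
     (THE f. irreducible f \<and> lead_coeff f > 0 \<and> poly (map_poly of_int f) \<alpha> = 0)"

definition conjugates :: "complex \<Rightarrow> complex set" where
  "conjugates \<alpha> = {\<beta>. poly (map_poly of_int (min_poly_int \<alpha>)) \<beta> = 0}"

definition weil_height :: "complex \<Rightarrow> real" where
  "weil_height \<alpha> =
     1 / real (degree (min_poly_int \<alpha>)) *
     ln (real_of_int \<bar>lead_coeff (min_poly_int \<alpha>)\<bar> * (\<Prod>\<beta>\<in>conjugates \<alpha>. max 1 (cmod \<beta>)))"

definition northcott_number :: "complex set \<Rightarrow> ereal" where
  "northcott_number A = Inf {ereal t | t. t \<ge> 0 \<and> infinite {\<alpha> \<in> A. weil_height \<alpha> < t}}"

subsection \<open>Totally split primes\<close>

abbreviation complex_ring :: "complex ring" (\<open>\<C>\<close>) where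
  "\<C> \<equiv> ring_of_type_algebra"

definition number_field :: "complex set \<Rightarrow> bool" where
  "number_field K \<longleftrightarrow> subfield K \<C> \<and> ring.finite_dimension \<C> \<rat> K"

definition ring_of_integers :: "complex set \<Rightarrow> complex ring" (\<open>\<O>\<close>) where
  "\<O> K = \<C>\<lparr>carrier := {x \<in> K. algebraic_int x}\<rparr>"

text \<open>
  A prime splits totally in a number field \<open>K\<close> of degree \<open>n\<close> if the ideal it generates in
  the ring of integers is a product of \<open>n\<close> distinct prime ideals. The product of the list of ideals
  is taken in the monoid of ideals, whose unit is the whole ring.
\<close>

definition splits_totally_nf :: "nat \<Rightarrow> complex set \<Rightarrow> bool" where
  "splits_totally_nf p K \<longleftrightarrow>
     (\<exists>Ps. distinct Ps \<and> length Ps = ring.dim \<C> \<rat> K \<and>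
           (\<forall>P\<in>set Ps. primeideal P (\<O> K)) \<and>
           PIdl\<^bsub>\<O> K\<^esub> (of_nat p) = foldr (ideal_prod (\<O> K)) Ps (carrier (\<O> K)))"

text \<open>
  In an algebraic extension of the rationals, possibly of infinite degree, a prime splits totally if
  it does so in every number field contained in the extension.
\<close>

definition splits_totally :: "nat \<Rightarrow> complex set \<Rightarrow> bool" where
  "splits_totally p L \<longleftrightarrow> (\<forall>K. number_field K \<longrightarrow> K \<subseteq> L \<longrightarrow> splits_totally_nf p K)"

text \<open>The maximum is with respect to inclusion.\<close>

definition max_totally_split_field :: "nat set \<Rightarrow> complex set" where
  "max_totally_split_field S =
     (GREATEST L. subfield L \<C> \<and> L \<subseteq> {x. algebraic x} \<and> (\<forall>p\<in>S. splits_totally p L))"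

end

theory Submission
  imports Defs "HOL-Number_Theory.Residues" "HOL-Real_Asymp.Real_Asymp"
begin

text \<open>Being totally \<open>S\<close>-adic is a local condition: for every valuation ring \<open>V\<close> of the complex
  numbers above some \<open>p \<in> S\<close>, the number lies in the \<open>V\<close>-adic closure of the rationals.

  Lower bound: a nonzero integral polynomial \<open>F\<close> of degree \<open>N\<close>, found by the pigeonhole principle, with
  small coefficients and with values at all \<open>p\<close>-adic arguments highly divisible by every \<open>p \<in> S\<close>
  (because \<open>x\<^sup>p - x\<close> is divisible by \<open>p\<close>), vanishes at finitely many numbers only. At any other
  one its norm is nonzero, and comparing size with divisibility bounds the height below by about half
  the sum of \<open>ln p / (p + 1)\<close>, where \<open>p + 1\<close> counts the points of the projective line over the
  residue field.

  Upper bound: an Eisenstein polynomial of degree \<open>n\<close> congruent to \<open>X (X - 1) \<dots> (X - n + 1)\<close>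
  modulo a power of \<open>p\<close> slightly larger than the one in \<open>(n - 1)!\<close>, for each \<open>p \<in> S\<close>, has totally
  \<open>S\<close>-adic roots; by Landau's inequality their height is at most about the sum of
  \<open>ln p / (p - 1)\<close>.

  The two sums have ratio close to 1 if the primes in \<open>S\<close> are large, and as the sum of
  \<open>ln p / (p - 1)\<close> over all primes diverges, it can be brought just below \<open>2r\<close>.\<close>

hide_const (open) up_ring.monom up_ring.coeff module.smult Coset.order

section \<open>Subrings of the complex numbers and Chevalley's extension theorem\<close>

section \<open>Valuation rings of the complex numbers\<close>

text \<open>Chevalley's theorem supplies valuation rings of all complex numbers, and being p-adic
  means being approximated by rationals there. This also produces the maximal field: from the
  definition by ideals it is not visible that totally split fields generate a totally split one, but
  the local condition is stable under field operations. The price is a translation between the local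
  condition and factorisations of ideals, in which the embeddings turn one valuation into all of
  them. The loss from 2r to r is that of the pigeonhole principle. With m about N / (p + 1),
  divisibility of F by p^m gains m ln p per conjugate. Imposing it costs (p + 1)(1 + ... + m)
  factors of p, about half of N m, spread over N + 1 coefficients, so that ln H is half of the gain.
  In the upper bound irreducibility and the local shape compete for the same coefficients; a further
  prime q outside S carries Eisenstein's condition, and its cost 2 ln q is divided by the
  degree.\<close>

locale complex_subring =
  fixes V :: "complex set"
  assumes one_mem [simp]: "1 \<in> V"
    and diff_mem: "x \<in> V \<Longrightarrow> y \<in> V \<Longrightarrow> x - y \<in> V"
    and mult_mem: "x \<in> V \<Longrightarrow> y \<in> V \<Longrightarrow> x * y \<in> V"
begin

lemma zero_mem [simp]: "0 \<in> V"
  using diff_mem[of 1 1] by simp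

lemma minus_mem: "x \<in> V \<Longrightarrow> - x \<in> V"
  using diff_mem[of 0 x] by simp

lemma add_mem: "x \<in> V \<Longrightarrow> y \<in> V \<Longrightarrow> x + y \<in> V"
  using diff_mem[of x "- y"] minus_mem[of y] by simp

lemma sum_mem: "(\<And>i. i \<in> I \<Longrightarrow> f i \<in> V) \<Longrightarrow> sum f I \<in> V"
  by (induction I rule: infinite_finite_induct) (auto intro: add_mem)

lemma prod_mem: "(\<And>i. i \<in> I \<Longrightarrow> f i \<in> V) \<Longrightarrow> prod f I \<in> V"
  by (induction I rule: infinite_finite_induct) (auto intro: mult_mem)

lemma power_mem: "x \<in> V \<Longrightarrow> x ^ n \<in> V"
  by (induction n) (auto intro: mult_mem)

lemma of_nat_mem [simp]: "of_nat n \<in> V"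
  by (induction n) (auto intro: add_mem)

lemma of_int_mem [simp]: "of_int n \<in> V"
  by (cases n) (auto intro: minus_mem diff_mem simp del: of_nat_Suc)

lemma poly_mem: "(\<And>i. coeff q i \<in> V) \<Longrightarrow> x \<in> V \<Longrightarrow> poly q x \<in> V"
  unfolding poly_altdef by (intro sum_mem mult_mem power_mem)

definition adjoin :: "complex \<Rightarrow> complex set" where
  "adjoin x = {poly q x | q. \<forall>i. coeff q i \<in> V}"

lemma adjoin_subring: "complex_subring (adjoin x)"
proof
  show "1 \<in> adjoin x"
    unfolding adjoin_def by (rule CollectI, rule exI[of _ 1]) (simp add: coeff_1)
next
  fix a b assume "a \<in> adjoin x" "b \<in> adjoin x"
  then obtain q r where q: "a = poly q x" "\<forall>i. coeff q i \<in> V"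
    and r: "b = poly r x" "\<forall>i. coeff r i \<in> V"
    unfolding adjoin_def by auto
  show "a - b \<in> adjoin x"
    unfolding adjoin_def by (rule CollectI, rule exI[of _ "q - r"]) (use q r in \<open>auto intro: diff_mem\<close>)
  show "a * b \<in> adjoin x"
    unfolding adjoin_def by (rule CollectI, rule exI[of _ "q * r"])
      (use q r in \<open>auto simp: coeff_mult intro!: sum_mem mult_mem\<close>)
qed

lemma adjoin_superset: "V \<subseteq> adjoin x"
proof
  fix a assume "a \<in> V"
  then show "a \<in> adjoin x"
    unfolding adjoin_def by (intro CollectI exI[of _ "[:a:]"]) (auto simp: coeff_pCons split: nat.splits)
qed

lemma adjoin_self: "x \<in> adjoin x"
  unfolding adjoin_def by (intro CollectI exI[of _ "[:0, 1:]"]) (auto simp: coeff_pCons split: nat.splits)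

end

text \<open>Valuations enter only through their rings: that p^k divides x is the statement that x /
  p^k lies in V. As V lives in all complex numbers, one V gives compatible valuations on every
  number field at once.\<close>

locale valuation_ring = complex_subring +
  assumes total: "x \<in> V \<or> inverse x \<in> V"

text \<open>What Zorn's lemma delivers: t is a nonunit of V, and every larger subring inverts it.
  Fixing the one element t replaces the prime ideal in the usual form of Chevalley's
  theorem.\<close>

locale chevalley = complex_subring +
  fixes t :: complex
  assumes t_mem: "t \<in> V" and t_inv: "inverse t \<notin> V"
    and maximal: "complex_subring W \<Longrightarrow> V \<subseteq> W \<Longrightarrow> inverse t \<notin> W \<Longrightarrow> W = V"
begin

lemma t_nz: "t \<noteq> 0"
  using t_inv by auto

lemma inverse_t_mem_adjoin: "x \<notin> V \<Longrightarrow> inverse t \<in> adjoin x"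
  using maximal[OF adjoin_subring adjoin_superset] adjoin_self[of x] by auto

text \<open>Otherwise 1/t would be a polynomial in 1/y for y = 1 - t v, so y^n / t would lie in V
  for some n; as y^n is 1 modulo t V, so would 1/t. Thus t lies in the Jacobson radical of
  V.\<close>

lemma one_minus_unit:
  assumes "v \<in> V"
  shows "inverse (1 - t * v) \<in> V"
proof (rule ccontr)
  define y where "y = 1 - t * v"
  assume "inverse (1 - t * v) \<notin> V"
  then obtain q where q: "inverse t = poly q (inverse y)" "\<And>i. coeff q i \<in> V"
    using inverse_t_mem_adjoin unfolding adjoin_def y_def by blast
  have ynz: "y \<noteq> 0"
    using t_inv assms t_nz inverse_unique[of t v] unfolding y_def by auto
  have yV: "y \<in> V"
    unfolding y_def using assms t_mem by (auto intro: diff_mem mult_mem)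
  define n where "n = degree q"
  have "y ^ n * poly q (inverse y) = (\<Sum>i\<le>n. coeff q i * y ^ (n - i))"
    unfolding poly_altdef n_def sum_distrib_left
    by (intro sum.cong refl) (auto simp: ynz field_simps power_diff)
  also have "\<dots> \<in> V"
    by (intro sum_mem mult_mem power_mem q yV)
  finally have b: "y ^ n * inverse t \<in> V"
    using q by simp
  have "\<exists>c\<in>V. 1 - y ^ k = t * c" for k
  proof (induction k)
    case (Suc k)
    then obtain c where c: "c \<in> V" "1 - y ^ k = t * c" by auto
    have yk: "y ^ k = 1 - t * c" using c(2) by (simp add: algebra_simps)
    have "1 - y ^ Suc k = t * (v + y * c)"
      unfolding power_Suc yk by (simp add: y_def algebra_simps)
    then show ?case
      using c assms yV by (auto intro: add_mem mult_mem)
  qed (auto intro: bexI[of _ 0])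
  then obtain c where c: "c \<in> V" "1 - y ^ n = t * c" by blast
  have "inverse t = y ^ n * inverse t + c"
    using c(2) t_nz by (simp add: field_simps)
  with b c(1) t_inv add_mem show False by metis
qed

text \<open>Collecting the constant terms of the second relation gives the unit 1 - t r(0); dividing
  by it writes x^m as t times a polynomial in x of degree below m. This replaces the top term of the
  first relation.\<close>

lemma lower_degree:
  assumes x: "x \<noteq> 0"
    and q: "1 = t * poly q x" "\<And>i. coeff q i \<in> V" "degree q \<le> n"
    and r: "1 = t * poly r (inverse x)" "\<And>i. coeff r i \<in> V" "degree r \<le> m"
    and mn: "m \<le> n"
  shows "\<exists>q'. 1 = t * poly q' x \<and> (\<forall>i. coeff q' i \<in> V) \<and> degree q' \<le> n - 1"
proof -
  define w where "w = inverse (1 - t * coeff r 0)"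
  have wV: "w \<in> V" unfolding w_def by (rule one_minus_unit[OF r(2)])
  have wnz: "1 - t * coeff r 0 \<noteq> 0"
    using t_inv r(2)[of 0] t_nz inverse_unique[of t "coeff r 0"] by auto
  have "m > 0"
  proof (rule Nat.gr0I)
    assume "m = 0"
    then obtain c where "r = [:c:]" using r(3) by (auto elim: degree_eq_zeroE)
    with r(1) wnz show False by simp
  qed
  define g where "g = (\<Sum>i<m. monom (w * coeff r (m - i)) i)"
  have coeff_g: "coeff g i = (if i < m then w * coeff r (m - i) else 0)" for i
    unfolding g_def by (auto simp: coeff_sum)
  have gV: "coeff g i \<in> V" for i
    unfolding coeff_g using wV r(2) by (auto intro: mult_mem)
  have deg_g: "degree g \<le> m - 1"
    by (rule degree_le) (use \<open>m > 0\<close> in \<open>auto simp: coeff_g\<close>)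
  have "poly r (inverse x) = (\<Sum>i\<le>m. coeff r i * inverse x ^ i)"
    unfolding poly_altdef using r(3) by (intro sum.mono_neutral_left) (auto simp: coeff_eq_0)
  also have "\<dots> = coeff r 0 + (\<Sum>i=1..m. coeff r i * inverse x ^ i)"
    by (simp add: atMost_atLeast0 sum.atLeast_Suc_atMost)
  finally have "1 - t * coeff r 0 = t * (\<Sum>i=1..m. coeff r i * inverse x ^ i)"
    using r(1) by (simp add: algebra_simps)
  then have "x ^ m * (1 - t * coeff r 0) = t * (x ^ m * (\<Sum>i=1..m. coeff r i * inverse x ^ i))"
    by (simp add: mult_ac)
  also have "x ^ m * (\<Sum>i=1..m. coeff r i * inverse x ^ i) = (\<Sum>i=1..m. coeff r i * x ^ (m - i))"
    unfolding sum_distrib_left using x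
    by (intro sum.cong refl) (auto simp: field_simps power_diff)
  also have "\<dots> = (\<Sum>i<m. coeff r (m - i) * x ^ i)"
    by (rule sum.reindex_bij_witness[of _ "\<lambda>i. m - i" "\<lambda>i. m - i"]) auto
  finally have "x ^ m = t * w * (\<Sum>i<m. coeff r (m - i) * x ^ i)"
    using wnz unfolding w_def by (simp add: field_simps)
  also have "\<dots> = t * poly g x"
    by (simp add: g_def poly_sum poly_monom sum_distrib_left mult_ac)
  finally have xm: "x ^ m = t * poly g x" .
  define q' where "q' = q - monom (coeff q n) n + monom (t * coeff q n) (n - m) * g"
  have "poly q' x = poly q x - coeff q n * x ^ (n - m) * x ^ m + t * coeff q n * x ^ (n - m) * poly g x"
    using mn by (simp add: q'_def poly_monom mult.assoc flip: power_add)
  also have "\<dots> = poly q x"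
    by (subst xm) (simp add: algebra_simps)
  finally have 1: "1 = t * poly q' x" using q(1) by simp
  have 2: "coeff q' i \<in> V" for i
    unfolding q'_def using q(2) gV t_mem
    by (auto simp: coeff_monom_mult intro!: add_mem diff_mem mult_mem)
  have "coeff q' i = 0" if "i > n - 1" for i
  proof -
    have "i \<ge> n" using that by simp
    have "coeff (q - monom (coeff q n) n) i = 0"
    proof (cases "i = n")
      case False
      then have "degree q < i" using \<open>i \<ge> n\<close> q(3) by simp
      then show ?thesis using False by (simp add: coeff_eq_0)
    qed auto
    moreover have "coeff (monom (t * coeff q n) (n - m) * g) i = 0"
      using \<open>i \<ge> n\<close> \<open>m > 0\<close> mn by (auto simp: coeff_monom_mult coeff_g)
    ultimately show ?thesis by (simp add: q'_def)
  qed
  then have "degree q' \<le> n - 1" by (intro degree_le) auto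
  with 1 2 show ?thesis by blast
qed

lemma valuation_ring: "valuation_ring V"
proof
  fix x :: complex
  show "x \<in> V \<or> inverse x \<in> V"
  proof (rule ccontr)
    assume neg: "\<not> (x \<in> V \<or> inverse x \<in> V)"
    then have x: "x \<noteq> 0" by auto
    define Q where "Q = (\<lambda>y n. \<exists>q. 1 = t * poly q y \<and> (\<forall>i. coeff q i \<in> V) \<and> degree q \<le> n)"
    have QD: "\<exists>n. Q y n" if "y \<notin> V" for y
    proof -
      obtain q where "inverse t = poly q y" "\<forall>i. coeff q i \<in> V"
        using inverse_t_mem_adjoin \<open>y \<notin> V\<close> unfolding adjoin_def by blast
      then have "Q y (degree q)"
        unfolding Q_def using t_nz by (intro exI[of _ q]) (metis order_refl right_inverse)
      then show ?thesis ..
    qed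
    have Q0: "\<not> Q y 0" for y
    proof
      assume "Q y 0"
      then obtain q where q: "1 = t * poly q y" "\<forall>i. coeff q i \<in> V" "degree q \<le> 0"
        unfolding Q_def by auto
      then obtain c where c: "q = [:c:]" by (auto elim: degree_eq_zeroE)
      then have "c \<in> V" using q(2) by (metis coeff_pCons_0)
      moreover have "inverse t = c" using q(1) c by (simp add: inverse_unique)
      ultimately show False using t_inv by simp
    qed
    have low: "Q y (n - 1)" if "Q y n" "Q (inverse y) m" "m \<le> n" "y \<noteq> 0" for y n m
      using lower_degree[OF that(4)] that unfolding Q_def by blast
    \<comment> \<open>Both relations are taken of least degree; whichever of the two degrees is not
      the smaller one can still be lowered, a contradiction.\<close>
    define n where "n = (LEAST n. Q x n)"
    define m where "m = (LEAST n. Q (inverse x) n)"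
    have n: "Q x n" unfolding n_def using QD[of x] neg by (auto intro: LeastI_ex)
    have m: "Q (inverse x) m" unfolding m_def using QD[of "inverse x"] neg by (auto intro: LeastI_ex)
    have "n > 0" "m > 0" using n m Q0 by (metis Nat.gr0I)+
    show False
    proof (cases "m \<le> n")
      case True
      then have "Q x (n - 1)" using low n m x by blast
      then have "n \<le> n - 1" unfolding n_def by (rule Least_le)
      with \<open>n > 0\<close> show False by simp
    next
      case False
      then have "Q (inverse x) (m - 1)" using low[of "inverse x" m n] n m x by auto
      then have "m \<le> m - 1" unfolding m_def by (rule Least_le)
      with \<open>m > 0\<close> show False by simp
    qed
  qed
qed

end

text \<open>Used with A = Z[1/x] to test integrality, with A = Z to obtain valuations above p, and
  to extend a valuation that was pulled back along an embedding.\<close>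

theorem chevalley_extension:
  assumes A: "complex_subring A" and t: "t \<in> A" "inverse t \<notin> A"
  obtains V where "valuation_ring V" "A \<subseteq> V" "inverse t \<notin> V"
    "\<And>W. complex_subring W \<Longrightarrow> V \<subseteq> W \<Longrightarrow> inverse t \<notin> W \<Longrightarrow> W = V"
proof -
  define \<A> where "\<A> = {B. complex_subring B \<and> A \<subseteq> B \<and> inverse t \<notin> B}"
  have "\<exists>M\<in>\<A>. \<forall>Y\<in>\<A>. M \<subseteq> Y \<longrightarrow> Y = M"
  proof (rule subset_Zorn_nonempty)
    show "\<A> \<noteq> {}" unfolding \<A>_def using A t by auto
  next
    fix \<F> assume C: "\<F> \<noteq> {}" "subset.chain \<A> \<F>"
    then have sub: "B \<in> \<A>" if "B \<in> \<F>" for B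
      using that unfolding subset.chain_def by auto
    have two: "\<exists>B\<in>\<F>. x \<in> B \<and> y \<in> B" if "x \<in> \<Union>\<F>" "y \<in> \<Union>\<F>" for x y
      using that C(2) unfolding subset.chain_def by blast
    obtain B where "B \<in> \<F>" using C(1) by auto
    have "complex_subring (\<Union>\<F>)"
    proof
      show "1 \<in> \<Union>\<F>"
        using \<open>B \<in> \<F>\<close> sub[of B] unfolding \<A>_def by (auto dest: complex_subring.one_mem)
    next
      fix x y assume "x \<in> \<Union>\<F>" "y \<in> \<Union>\<F>"
      then obtain D where D: "D \<in> \<F>" "x \<in> D" "y \<in> D" using two by blast
      then have "complex_subring D" using sub[of D] unfolding \<A>_def by auto
      then show "x - y \<in> \<Union>\<F>" "x * y \<in> \<Union>\<F>"
        using D by (auto intro: complex_subring.diff_mem complex_subring.mult_mem)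
    qed
    then show "\<Union>\<F> \<in> \<A>"
      using sub \<open>B \<in> \<F>\<close> unfolding \<A>_def by blast
  qed
  then obtain M where M: "complex_subring M" "A \<subseteq> M" "inverse t \<notin> M"
    and max: "\<And>Y. complex_subring Y \<Longrightarrow> A \<subseteq> Y \<Longrightarrow> inverse t \<notin> Y \<Longrightarrow> M \<subseteq> Y \<Longrightarrow> Y = M"
    unfolding \<A>_def by auto
  have "chevalley M t"
    using M t max by (intro chevalley.intro chevalley_axioms.intro) auto
  then show ?thesis
    using that[of M] M chevalley.valuation_ring chevalley.maximal by blast
qed

section \<open>Units and integral closure in terms of valuation rings\<close>

section \<open>Algebraic integers\<close>

lemma complex_subring_Ints: "complex_subring \<int>"
  by unfold_locales auto

lemma poly_shift_0 [simp]: "poly_shift 0 p = p"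
  by (rule poly_eqI) (simp add: coeff_poly_shift)

text \<open>One step of Horner's scheme; the values of the shifted polynomials at x are its
  intermediate results.\<close>

lemma poly_poly_shift_Suc:
  "poly (poly_shift n p) x = coeff p n + x * poly (poly_shift (Suc n) p) x"
proof -
  have "poly_shift n p = pCons (coeff p n) (poly_shift (Suc n) p)"
    by (rule poly_eqI) (auto simp: coeff_poly_shift coeff_pCons split: nat.splits)
  then show ?thesis by simp
qed

context valuation_ring
begin

lemma mem_inverse: "x \<notin> V \<Longrightarrow> inverse x \<in> V"
  using total by blast

text \<open>Dividing the monic equation by x^(n - 1) writes x as a polynomial in 1/x, which lies in
  V if x does not.\<close>

lemma algebraic_int_mem:
  assumes "algebraic_int x"
  shows "x \<in> V"
proof (rule ccontr)
  assume x: "x \<notin> V"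
  then have ix: "inverse x \<in> V" and xnz: "x \<noteq> 0" using mem_inverse by auto
  obtain p where p: "poly p x = 0" "\<forall>i. coeff p i \<in> \<int>" "lead_coeff p = 1"
    using assms by (auto simp: algebraic_int.simps)
  define n where "n = degree p"
  have "n \<noteq> 0"
  proof
    assume "n = 0"
    then obtain c where c: "p = [:c:]" unfolding n_def by (auto elim: degree_eq_zeroE)
    with p show False by auto
  qed
  then obtain m where m: "n = Suc m" using not0_implies_Suc by blast
  have "0 = (\<Sum>i\<le>n. coeff p i * x ^ i)"
    using p(1) by (simp add: poly_altdef n_def)
  also have "\<dots> = x ^ n + (\<Sum>i\<le>m. coeff p i * x ^ i)"
    using p(3) unfolding n_def[symmetric] m by simp
  finally have "x ^ n = - (\<Sum>i\<le>m. coeff p i * x ^ i)"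
    by (simp add: eq_neg_iff_add_eq_0)
  then have "x = inverse x ^ m * - (\<Sum>i\<le>m. coeff p i * x ^ i)"
    using xnz m by (simp add: field_simps)
  also have "\<dots> = - (\<Sum>i\<le>m. coeff p i * inverse x ^ (m - i))"
    using xnz by (simp add: sum_distrib_left field_simps power_diff)
  also have "\<dots> \<in> V"
  proof (intro minus_mem sum_mem mult_mem power_mem ix)
    fix i show "coeff p i \<in> V" using p(2) by (metis Ints_cases of_int_mem)
  qed
  finally show False using x by simp
qed

definition vunit :: "complex \<Rightarrow> bool" where
  "vunit x \<longleftrightarrow> x \<in> V \<and> x \<noteq> 0 \<and> inverse x \<in> V"

text \<open>One of a/b and b/a lies in V, so b or a divides the unit a + b; this says that V is
  local.\<close>

lemma vunit_add:
  assumes "a \<in> V" "b \<in> V" "vunit (a + b)"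
  shows "vunit a \<or> vunit b"
proof -
  have u: "a + b \<noteq> 0" "inverse (a + b) \<in> V" using assms(3) unfolding vunit_def by auto
  have *: "vunit b" if "a * inverse b \<in> V" "b \<noteq> 0" "b \<in> V" "a + b \<noteq> 0" "inverse (a + b) \<in> V" for a b
  proof -
    have "inverse b = inverse (a + b) * (a * inverse b + 1)"
      using that(2,4) by (simp add: field_simps)
    also have "\<dots> \<in> V" by (rule mult_mem[OF that(5) add_mem[OF that(1) one_mem]])
    finally show ?thesis using that unfolding vunit_def by auto
  qed
  show ?thesis
  proof (cases "a = 0 \<or> b = 0")
    case True then show ?thesis using assms(3) by auto
  next
    case False
    then consider "a * inverse b \<in> V" | "b * inverse a \<in> V"
      using total[of "a * inverse b"] by (auto simp: mult.commute)
    then show ?thesis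
    proof cases
      case 1
      then show ?thesis using *[of a b] assms u False by auto
    next
      case 2
      then show ?thesis using *[of b a] assms u False by (auto simp: add.commute)
    qed
  qed
qed

lemma vunit_mult: "vunit a \<Longrightarrow> vunit b \<Longrightarrow> vunit (a * b)"
  unfolding vunit_def by (auto intro: mult_mem)

lemma vunit_multD:
  assumes "a \<in> V" "b \<in> V" "vunit (a * b)"
  shows "vunit a"
proof -
  have nz: "a \<noteq> 0" "b \<noteq> 0" using assms(3) unfolding vunit_def by auto
  have "inverse a = b * inverse (a * b)" using nz by (simp add: field_simps)
  also have "\<dots> \<in> V" using assms unfolding vunit_def by (intro mult_mem) auto
  finally show ?thesis using nz assms unfolding vunit_def by auto
qed

lemma vunit_1 [simp]: "vunit 1"
  by (simp add: vunit_def)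

lemma vunit_sum:
  assumes "finite I" "\<And>i. i \<in> I \<Longrightarrow> f i \<in> V" "vunit (sum f I)"
  shows "\<exists>i\<in>I. vunit (f i)"
  using assms
proof (induction I rule: finite_induct)
  case empty then show ?case by (simp add: vunit_def)
next
  case (insert i I)
  then show ?case
    using vunit_add[of "f i" "sum f I"] by (auto intro: sum_mem)
qed

text \<open>The partial Horner values of an integral relation are integral: this is checked in every
  valuation ring, from the top if the root lies in it and from the bottom otherwise.\<close>

lemma horner_mem:
  assumes "poly f z = 0" "\<And>i. coeff f i \<in> V"
  shows "poly (poly_shift j f) z \<in> V \<and> z * poly (poly_shift (Suc j) f) z \<in> V"
proof (cases "z \<in> V")
  case True
  then show ?thesis using assms by (auto intro!: mult_mem poly_mem simp: coeff_poly_shift)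
next
  case False
  then have iz: "inverse z \<in> V" "z \<noteq> 0" using mem_inverse by auto
  have *: "poly (poly_shift j f) z \<in> V" for j
  proof (induction j)
    case (Suc j)
    have "poly (poly_shift (Suc j) f) z = (poly (poly_shift j f) z - coeff f j) * inverse z"
      using poly_poly_shift_Suc[of j f z] iz(2) by (simp add: field_simps)
    also have "\<dots> \<in> V" using Suc iz assms by (auto intro!: mult_mem diff_mem)
    finally show ?case .
  qed (use assms in auto)
  have "z * poly (poly_shift (Suc j) f) z = poly (poly_shift j f) z - coeff f j"
    using poly_poly_shift_Suc[of j f z] by simp
  also have "\<dots> \<in> V" using * assms by (auto intro: diff_mem)
  finally show ?thesis using * by auto
qed

end

text \<open>If x is not integral, then x is not in Z[1/x], as x = q(1/x) clears to a monic equation.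
  So 1/x is a nonunit of Z[1/x], and Chevalley's theorem keeps it one in some V. Since each V is a
  ring, differences and products of algebraic integers are integral at once.\<close>

theorem algebraic_int_iff_valuation_rings:
  "algebraic_int x \<longleftrightarrow> (\<forall>V. valuation_ring V \<longrightarrow> x \<in> V)"
proof
  assume *: "\<forall>V. valuation_ring V \<longrightarrow> x \<in> V"
  show "algebraic_int x"
  proof (rule ccontr)
    assume nx: "\<not> algebraic_int x"
    then have xnz: "x \<noteq> 0" by auto
    interpret complex_subring \<int> by (rule complex_subring_Ints)
    have nad: "inverse (inverse x) \<notin> adjoin (inverse x)"
    proof
      assume "inverse (inverse x) \<in> adjoin (inverse x)"
      then obtain q where q: "x = poly q (inverse x)" "\<forall>i. coeff q i \<in> \<int>"
        unfolding adjoin_def by auto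
      define p where "p = 1 - pCons 0 q"
      have "algebraic_int (inverse (inverse x))"
      proof (rule algebraic_int_inverse[of p])
        show "poly p (inverse x) = 0"
          unfolding p_def using q(1)[symmetric] xnz by simp
        show "\<forall>i. coeff p i \<in> \<int>"
          unfolding p_def using q(2) by (auto simp: coeff_pCons split: nat.splits)
      qed (simp add: p_def)
      then show False using nx by simp
    qed
    obtain V where "valuation_ring V" "inverse (inverse x) \<notin> V"
      by (rule chevalley_extension[OF adjoin_subring adjoin_self nad])
    with * show False by simp
  qed
qed (auto intro: valuation_ring.algebraic_int_mem)

lemma algebraic_int_diff: "algebraic_int x \<Longrightarrow> algebraic_int y \<Longrightarrow> algebraic_int (x - y :: complex)"
  and algebraic_int_mult: "algebraic_int x \<Longrightarrow> algebraic_int y \<Longrightarrow> algebraic_int (x * y :: complex)"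
  unfolding algebraic_int_iff_valuation_rings valuation_ring_def
  by (meson complex_subring.diff_mem complex_subring.mult_mem)+

lemma algebraic_int_horner:
  assumes "poly (map_poly of_int f) z = (0::complex)"
  shows "algebraic_int (poly (poly_shift j (map_poly of_int f)) z)"
    and "algebraic_int (z * poly (poly_shift (Suc j) (map_poly of_int f)) z)"
proof -
  have "coeff (map_poly of_int f) i \<in> V" if "valuation_ring V" for i V
    using that by (simp add: coeff_map_poly complex_subring.of_int_mem valuation_ring_def)
  then show "algebraic_int (poly (poly_shift j (map_poly of_int f)) z)"
    "algebraic_int (z * poly (poly_shift (Suc j) (map_poly of_int f)) z)"
    unfolding algebraic_int_iff_valuation_rings using valuation_ring.horner_mem[OF _ assms] by blast+
qed

lemma algebraic_iff_algebraic_int: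
  "algebraic (x :: complex) \<longleftrightarrow> (\<exists>N::int. N > 0 \<and> algebraic_int (of_int N * x))"
proof
  assume "algebraic x"
  then obtain f where f: "poly (map_poly of_int f) x = 0" "f \<noteq> 0" by (auto elim: algebraicE')
  define d where "d = degree f"
  let ?f = "map_poly of_int f :: complex poly"
  \<comment> \<open>The top Horner value is the leading coefficient, so the leading coefficient
    times x is integral.\<close>
  have "poly_shift d ?f = [:of_int (lead_coeff f):]"
    by (rule poly_eqI) (auto simp: coeff_poly_shift coeff_map_poly d_def coeff_eq_0 coeff_pCons split: nat.splits)
  then have "x * of_int (lead_coeff f) = x * poly (poly_shift d ?f) x" by simp
  moreover have "algebraic_int (x * poly (poly_shift d ?f) x)"
  proof (cases d)
    case 0
    then obtain c where "f = [:c:]" unfolding d_def by (auto elim: degree_eq_zeroE)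
    with f have False by (simp add: map_poly_pCons)
    then show ?thesis ..
  qed (use algebraic_int_horner(2)[OF f(1)] in auto)
  ultimately have 1: "algebraic_int (of_int (lead_coeff f) * x)"
    by (metis mult.commute)
  have "algebraic_int (of_int \<bar>lead_coeff f\<bar> * x)"
    using 1 by (cases "lead_coeff f \<ge> 0") auto
  then show "\<exists>N::int. N > 0 \<and> algebraic_int (of_int N * x)"
    using f(2) by (intro exI[of _ "\<bar>lead_coeff f\<bar>"]) auto
next
  assume "\<exists>N::int. N > 0 \<and> algebraic_int (of_int N * x)"
  then obtain N :: int where N: "N > 0" "algebraic_int (of_int N * x)" by auto
  then obtain p where p: "lead_coeff p = 1" "\<forall>i. coeff p i \<in> \<int>" "poly p (of_int N * x) = 0"
    by (auto simp: algebraic_int.simps)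
  show "algebraic x"
  proof (rule algebraicI)
    show "poly (pcompose p [:0, of_int N:]) x = 0"
      using p by (simp add: poly_pcompose mult.commute)
    show "coeff (pcompose p [:0, of_int N:]) i \<in> \<int>" for i
      using p by (intro coeff_pcompose_semiring_closed) (auto simp: coeff_pCons split: nat.splits)
    have "p \<noteq> 0" using p by auto
    then show "pcompose p [:0, of_int N:] \<noteq> 0"
      using N by (subst pcompose_eq_0_iff) auto
  qed
qed

lemma algebraic_diff: "algebraic x \<Longrightarrow> algebraic y \<Longrightarrow> algebraic (x - y :: complex)"
  and algebraic_mult: "algebraic x \<Longrightarrow> algebraic y \<Longrightarrow> algebraic (x * y :: complex)"
proof -
  assume "algebraic x" "algebraic y"
  then obtain N M :: int where N: "N > 0" "algebraic_int (of_int N * x)"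
    and M: "M > 0" "algebraic_int (of_int M * y)"
    unfolding algebraic_iff_algebraic_int by auto
  have "of_int (N * M) * (x - y) = of_int M * (of_int N * x) - of_int N * (of_int M * y)"
    "of_int (N * M) * (x * y) = (of_int N * x) * (of_int M * y)"
    by (simp_all add: algebra_simps)
  then have "algebraic_int (of_int (N * M) * (x - y))" "algebraic_int (of_int (N * M) * (x * y))"
    using N M by (metis algebraic_int_diff algebraic_int_mult algebraic_int_of_int)+
  then show "algebraic (x - y)" "algebraic (x * y)"
    unfolding algebraic_iff_algebraic_int using N M by (metis mult_pos_pos)+
qed

lemma algebraic_inverse:
  assumes "algebraic (x :: complex)"
  shows "algebraic (inverse x)"
proof (cases "x = 0")
  case True then show ?thesis using assms by simp
next
  case False
  obtain p where p: "poly p x = 0" "\<forall>i. coeff p i \<in> \<int>" "p \<noteq> 0"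
    using assms by (elim algebraicE) auto
  show ?thesis
  proof (rule algebraicI)
    show "poly (reflect_poly p) (inverse x) = 0"
      using p False by (simp add: poly_reflect_poly_nz)
    show "coeff (reflect_poly p) i \<in> \<int>" for i
      using p by (auto simp: coeff_reflect_poly)
    show "reflect_poly p \<noteq> 0" using p by simp
  qed
qed

lemma algebraic_Rats: "x \<in> \<rat> \<Longrightarrow> algebraic (x :: complex)"
  by (elim Rats_cases')
    (simp add: divide_inverse algebraic_mult algebraic_inverse algebraic_int_imp_algebraic)

lemma complex_subring_algebraic: "complex_subring {x. algebraic x}"
  by (rule complex_subring.intro) (simp_all add: algebraic_diff algebraic_mult algebraic_Rats)

section \<open>Minimal polynomials over the integers and their roots\<close>

section \<open>Minimal polynomials\<close>

abbreviation cpoly :: "int poly \<Rightarrow> complex poly" where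
  "cpoly \<equiv> map_poly of_int"

lemma coeff_cpoly [simp]: "coeff (cpoly f) i = of_int (coeff f i)"
  by (simp add: coeff_map_poly)

lemma cpoly_mult [simp]: "cpoly (f * g) = cpoly f * cpoly g"
  by (rule poly_eqI) (simp add: coeff_mult)

lemma cpoly_add [simp]: "cpoly (f + g) = cpoly f + cpoly g"
  by (rule poly_eqI) simp

lemma cpoly_diff [simp]: "cpoly (f - g) = cpoly f - cpoly g"
  by (rule poly_eqI) simp

lemma cpoly_smult [simp]: "cpoly (smult c f) = smult (of_int c) (cpoly f)"
  by (rule poly_eqI) simp

lemma cpoly_pderiv [simp]: "cpoly (pderiv f) = pderiv (cpoly f)"
  by (rule poly_eqI) (simp add: coeff_pderiv)

lemma degree_cpoly [simp]: "degree (cpoly f) = degree f"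
  by (simp add: degree_map_poly)

lemma cpoly_eq_0_iff [simp]: "cpoly f = 0 \<longleftrightarrow> f = 0"
  by (simp add: poly_eq_iff)

text \<open>Gauss's lemma: pseudo-division leaves a remainder that vanishes by minimality, and
  passing to primitive parts removes the constant c that pseudo-division introduces.\<close>

lemma dvd_if_minimal:
  fixes f h :: "int poly"
  assumes f: "content f = 1" "poly (cpoly f) \<alpha> = 0"
    and min: "\<And>g. g \<noteq> 0 \<Longrightarrow> poly (cpoly g) \<alpha> = 0 \<Longrightarrow> degree f \<le> degree g"
    and h: "poly (cpoly h) \<alpha> = 0"
  shows "f dvd h"
proof (cases "h = 0")
  case False
  have f0: "f \<noteq> 0" using f(1) by auto
  obtain q r where qr: "pseudo_divmod h f = (q, r)" by force
  note pd = pseudo_divmod[OF f0 qr]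
  define c where "c = coeff f (degree f) ^ (Suc (degree h) - degree f)"
  have c0: "c \<noteq> 0" using f0 by (simp add: c_def)
  have eq: "smult c h = f * q + r" using pd unfolding c_def by auto
  have "poly (cpoly (smult c h)) \<alpha> = poly (cpoly (f * q + r)) \<alpha>" by (simp only: eq)
  then have "poly (cpoly r) \<alpha> = 0" using f(2) h by simp
  then have "r = 0" using pd(2) min[of r] by fastforce
  then have "primitive_part (smult c h) = primitive_part (f * q)" using eq by simp
  then have "smult (sgn c) (primitive_part h) = f * primitive_part q"
    by (simp add: primitive_part_smult primitive_part_mult primitive_part_prim[OF f(1)])
  then have "smult (sgn c) (smult (sgn c) (primitive_part h)) = f * smult (sgn c) (primitive_part q)"
    by simp
  moreover have "sgn c * sgn c = 1" using c0 by (auto simp: sgn_if)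
  ultimately have "f dvd primitive_part h" by (simp add: dvd_smult)
  also have "primitive_part h dvd h"
    by (metis content_times_primitive_part dvd_refl dvd_smult)
  finally show ?thesis .
qed simp

context
  fixes \<alpha> :: complex
  assumes alg: "algebraic \<alpha>"
begin

text \<open>Taken from the primitive part of an annihilating polynomial of least degree. If it
  factors, a factor with root \<alpha> has full degree, and the other one is a constant dividing the
  content 1.\<close>

lemma min_poly_int_ex:
  "\<exists>f. irreducible f \<and> lead_coeff f > 0 \<and> poly (cpoly f) \<alpha> = 0 \<and> content f = 1 \<and>
      (\<forall>h. poly (cpoly h) \<alpha> = 0 \<longrightarrow> f dvd h)"
proof -
  obtain g0 where g0: "g0 \<noteq> 0" "poly (cpoly g0) \<alpha> = 0" using alg by (rule algebraicE')
  define g where "g = arg_min degree (\<lambda>g. g \<noteq> 0 \<and> poly (cpoly g) \<alpha> = 0)"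
  have g: "g \<noteq> 0" "poly (cpoly g) \<alpha> = 0"
    unfolding g_def using arg_min_natI[of "\<lambda>g. g \<noteq> 0 \<and> poly (cpoly g) \<alpha> = 0" g0 degree] g0 by auto
  have gmin: "degree g \<le> degree h" if "h \<noteq> 0" "poly (cpoly h) \<alpha> = 0" for h
    unfolding g_def by (rule arg_min_nat_le) (use that in auto)
  define c where "c = lead_coeff (primitive_part g)"
  define f where "f = smult (sgn c) (primitive_part g)"
  have c0: "c \<noteq> 0" unfolding c_def using g(1) by (metis leading_coeff_0_iff primitive_part_eq_0_iff)
  then have sc: "sgn c = 1 \<or> sgn c = -1" by (auto simp: sgn_if)
  have "cpoly g = smult (of_int (content g)) (cpoly (primitive_part g))"
    by (metis content_times_primitive_part cpoly_smult)
  then have "poly (cpoly (primitive_part g)) \<alpha> = 0"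
    using g by simp
  then have f\<alpha>: "poly (cpoly f) \<alpha> = 0" unfolding f_def by simp
  have fc: "content f = 1"
    unfolding f_def using g(1) sc by (auto simp: content_primitive_part)
  have df: "degree f = degree g" unfolding f_def using sc by auto
  have "lead_coeff f = sgn c * c"
    unfolding f_def c_def by (rule lead_coeff_smult)
  then have flc: "lead_coeff f > 0"
    using c0 by (auto simp: sgn_if split: if_splits)
  have dv: "f dvd h" if "poly (cpoly h) \<alpha> = 0" for h
    by (rule dvd_if_minimal[OF fc f\<alpha> _ that]) (use gmin df in auto)
  have f0: "f \<noteq> 0" using fc by auto
  have fdeg: "degree f > 0"
  proof (rule Nat.gr0I)
    assume "degree f = 0"
    then obtain c where "f = [:c:]" by (auto elim: degree_eq_zeroE)
    with f\<alpha> f0 show False by (simp add: map_poly_pCons)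
  qed
  have unit: "is_unit b" if "f = a * b" "poly (cpoly a) \<alpha> = 0" for a b
  proof -
    have nz: "a \<noteq> 0" "b \<noteq> 0" using f0 that(1) by auto
    then have "degree f \<le> degree a" using gmin that(2) df by simp
    then have "degree b = 0" using that(1) degree_mult_eq[OF nz] by simp
    then obtain c where c: "b = [:c:]" by (auto elim: degree_eq_zeroE)
    then have "c dvd content f" using that(1) by simp
    then show ?thesis using fc c by (simp add: is_unit_const_poly_iff)
  qed
  have "irreducible f"
  proof (rule Factorial_Ring.irreducibleI)
    show "f \<noteq> 0" by fact
    show "\<not> is_unit f" using fdeg by (auto simp: is_unit_poly_iff)
    fix a b assume ab: "f = a * b"
    then have "poly (cpoly a) \<alpha> = 0 \<or> poly (cpoly b) \<alpha> = 0" using f\<alpha> by simp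
    then show "is_unit a \<or> is_unit b"
      using unit[of a b] unit[of b a] ab by (auto simp: mult.commute)
  qed
  then show ?thesis using flc f\<alpha> dv fc by blast
qed

lemma irreducible_root_unique:
  assumes "irreducible f" "lead_coeff f > 0" "poly (cpoly f) \<alpha> = 0"
    "irreducible g" "lead_coeff g > 0" "poly (cpoly g) \<alpha> = 0"
  shows "f = g"
proof -
  obtain m where m: "\<not> is_unit m" "lead_coeff m > 0" "\<And>h. poly (cpoly h) \<alpha> = 0 \<Longrightarrow> m dvd h"
    using min_poly_int_ex irreducible_not_unit by metis
  have "h = m" if h: "irreducible h" "lead_coeff h > 0" "poly (cpoly h) \<alpha> = 0" for h
  proof -
    obtain k where k: "h = m * k" using m(3) h(3) by blast
    then have "is_unit k" using Factorial_Ring.irreducibleD[OF h(1)] m(1) by blast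
    then obtain u where u: "k = [:u:]" "is_unit u" by (auto simp: is_unit_poly_iff)
    then have "lead_coeff h = lead_coeff m * u" using k by simp
    then have "u > 0" using h(2) m(2) by (simp add: zero_less_mult_iff)
    then show ?thesis using u k by simp
  qed
  then show ?thesis using assms by blast
qed

lemma min_poly_int_eqI:
  assumes "irreducible f" "lead_coeff f > 0" "poly (cpoly f) \<alpha> = 0"
  shows "min_poly_int \<alpha> = f"
  unfolding min_poly_int_def
proof (rule the_equality)
  fix g assume "irreducible g \<and> lead_coeff g > 0 \<and> poly (cpoly g) \<alpha> = 0"
  then show "g = f" using irreducible_root_unique assms by blast
qed (use assms in blast)

lemma
  shows irreducible_min_poly_int: "irreducible (min_poly_int \<alpha>)"
    and lead_coeff_min_poly_int: "lead_coeff (min_poly_int \<alpha>) > 0"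
    and poly_min_poly_int: "poly (cpoly (min_poly_int \<alpha>)) \<alpha> = 0"
    and content_min_poly_int: "content (min_poly_int \<alpha>) = 1"
    and min_poly_int_dvd: "poly (cpoly h) \<alpha> = 0 \<Longrightarrow> min_poly_int \<alpha> dvd h"
proof -
  obtain f where f: "irreducible f" "lead_coeff f > 0" "poly (cpoly f) \<alpha> = 0" "content f = 1"
    "\<And>h. poly (cpoly h) \<alpha> = 0 \<Longrightarrow> f dvd h"
    using min_poly_int_ex by blast
  note [simp] = min_poly_int_eqI[OF f(1-3)]
  show "irreducible (min_poly_int \<alpha>)" "lead_coeff (min_poly_int \<alpha>) > 0"
    "poly (cpoly (min_poly_int \<alpha>)) \<alpha> = 0" "content (min_poly_int \<alpha>) = 1"
    using f(1-4) by simp_all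
  show "min_poly_int \<alpha> dvd h" if "poly (cpoly h) \<alpha> = 0"
    using f(5) that by simp
qed

lemma min_poly_int_nz: "min_poly_int \<alpha> \<noteq> 0"
  using irreducible_min_poly_int by (auto simp: irreducible_def)

lemma degree_min_poly_int: "degree (min_poly_int \<alpha>) > 0"
proof (rule Nat.gr0I)
  assume "degree (min_poly_int \<alpha>) = 0"
  then obtain c where "min_poly_int \<alpha> = [:c:]" by (auto elim: degree_eq_zeroE)
  then show False using poly_min_poly_int min_poly_int_nz by (simp add: map_poly_pCons)
qed

lemma finite_conjugates: "finite (conjugates \<alpha>)"
  unfolding conjugates_def by (rule poly_roots_finite) (simp add: min_poly_int_nz)

lemma algebraic_conjugate: "\<beta> \<in> conjugates \<alpha> \<Longrightarrow> algebraic \<beta>"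
  unfolding conjugates_def
  by (rule algebraicI[of "cpoly (min_poly_int \<alpha>)"]) (auto simp: min_poly_int_nz)

end

lemma min_poly_int_conjugate:
  assumes "algebraic \<alpha>" "\<beta> \<in> conjugates \<alpha>"
  shows "min_poly_int \<beta> = min_poly_int \<alpha>"
  using assms(2)
  by (intro min_poly_int_eqI algebraic_conjugate[OF assms] irreducible_min_poly_int[OF assms(1)]
      lead_coeff_min_poly_int[OF assms(1)]) (simp add: conjugates_def)

text \<open>A double root \<beta> is a root of the derivative. As \<beta> has the same minimal
  polynomial, this would divide its own nonzero derivative.\<close>

lemma rsquarefree_min_poly_int:
  assumes "algebraic \<alpha>"
  shows "rsquarefree (cpoly (min_poly_int \<alpha>))"
  unfolding rsquarefree_roots
proof (intro allI notI)
  let ?f = "min_poly_int \<alpha>"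
  fix \<beta> assume *: "poly (cpoly ?f) \<beta> = 0 \<and> poly (pderiv (cpoly ?f)) \<beta> = 0"
  then have b: "\<beta> \<in> conjugates \<alpha>" by (simp add: conjugates_def)
  have "min_poly_int \<beta> dvd pderiv ?f"
    by (rule min_poly_int_dvd) (use * algebraic_conjugate[OF assms b] in auto)
  then have "?f dvd pderiv ?f" by (simp add: min_poly_int_conjugate[OF assms b])
  moreover have "pderiv ?f \<noteq> 0" using degree_min_poly_int[OF assms] by (simp add: pderiv_eq_0_iff)
  ultimately have "degree ?f \<le> degree (pderiv ?f)" by (rule dvd_imp_degree_le)
  then show False using degree_min_poly_int[OF assms] by (simp add: degree_pderiv)
qed

text \<open>Since the roots are simple, products over the set \<open>conjugates\<close> count every
  root as often as the height requires.\<close>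

lemma min_poly_int_factorization:
  assumes "algebraic \<alpha>"
  shows "cpoly (min_poly_int \<alpha>) =
    smult (of_int (lead_coeff (min_poly_int \<alpha>))) (\<Prod>\<beta>\<in>conjugates \<alpha>. [:-\<beta>, 1:])"
  unfolding conjugates_def
  by (rule trans[OF complex_poly_decompose_rsquarefree[OF rsquarefree_min_poly_int[OF assms], symmetric]])
    (simp only: degree_cpoly coeff_cpoly)

lemma card_conjugates:
  assumes "algebraic \<alpha>"
  shows "card (conjugates \<alpha>) = degree (min_poly_int \<alpha>)"
proof -
  have "degree (min_poly_int \<alpha>) = degree (cpoly (min_poly_int \<alpha>))" by simp
  also have "\<dots> = degree (\<Prod>\<beta>\<in>conjugates \<alpha>. [:-\<beta>, 1:])"
    by (subst min_poly_int_factorization[OF assms]) (simp add: min_poly_int_nz[OF assms])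
  also have "\<dots> = card (conjugates \<alpha>)"
    by (subst degree_prod_sum_eq) (auto simp: finite_conjugates[OF assms])
  finally show ?thesis by simp
qed

lemma min_poly_int_coeff_not_dvd:
  assumes "algebraic \<alpha>" "prime p"
  shows "\<exists>i. \<not> int p dvd coeff (min_poly_int \<alpha>) i"
proof (rule ccontr)
  assume "\<not> ?thesis"
  then have "[:int p:] dvd min_poly_int \<alpha>" by (auto simp: const_poly_dvd_iff)
  then show False
    using content_min_poly_int[OF assms(1)] assms(2) by (simp add: const_poly_dvd_iff_dvd_content)
qed

text \<open>The Horner values of the minimal polynomial give integral multiples of \<open>z\<close>; by primitivity
  not all of the multipliers and multiples can vanish modulo a given prime.\<close>

lemma horner_sequence:
  assumes z: "algebraic z" and p: "prime p"
  obtains b j a where "\<And>i. algebraic_int (b i)" "\<And>i. algebraic_int (z * b (Suc i))" "b 0 = 0"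
    "\<not> int p dvd a" "of_int a = b j - z * b (Suc j)"
    "\<And>K i. complex_subring K \<Longrightarrow> z \<in> K \<Longrightarrow> b i \<in> K"
proof -
  define f where "f = cpoly (min_poly_int z)"
  define b where "b = (\<lambda>i. poly (poly_shift i f) z)"
  obtain j where j: "\<not> int p dvd coeff (min_poly_int z) j"
    using min_poly_int_coeff_not_dvd[OF z p] by blast
  have root: "poly f z = 0" using poly_min_poly_int[OF z] by (simp add: f_def)
  show ?thesis
  proof (rule that[of b _ j])
    show "algebraic_int (b i)" "algebraic_int (z * b (Suc i))" for i
      using algebraic_int_horner root unfolding b_def f_def by blast+
    show "of_int (coeff (min_poly_int z) j) = b j - z * b (Suc j)"
      unfolding b_def using poly_poly_shift_Suc[of j f z] by (simp add: f_def)
    show "b i \<in> K" if "complex_subring K" "z \<in> K" for K i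
      unfolding b_def f_def
      by (rule complex_subring.poly_mem[OF that(1) _ that(2)])
        (simp add: coeff_poly_shift complex_subring.of_int_mem[OF that(1)])
  qed (use root j in \<open>simp_all add: b_def\<close>)
qed

lemma prime_bezout_complex:
  assumes "prime p" "\<not> int p dvd k"
  obtains u v :: int where "of_int u * of_nat p + of_int v * of_int k = (1::complex)"
proof -
  have "coprime (int p) k" using assms by (simp add: prime_imp_coprime)
  then obtain u v where "u * int p + v * k = 1" by (metis bezout_int coprime_imp_gcd_eq_1)
  then have "of_int (u * int p + v * k) = (1::complex)" by simp
  then show ?thesis using that[of u v] by simp
qed

section \<open>The local field above a prime\<close>

section \<open>Valuations above a prime number\<close>

text \<open>Some power of p clears the denominator of any algebraic number
  (\<open>algebraic_bounded\<close>), and p divides a power of any algebraic nonunit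
  (\<open>nonunit_power_div_p\<close>). So on algebraic numbers the powers of p define the whole
  topology of V, whatever V is elsewhere.\<close>

locale p_valuation = valuation_ring +
  fixes p :: nat
  assumes prime_p: "prime p" and inverse_p: "inverse (of_nat p) \<notin> V"
begin

abbreviation \<pi> :: complex where "\<pi> \<equiv> of_nat p"

lemma p_pos [simp]: "p > 0" "p \<noteq> 0"
  using prime_p by (auto simp: prime_gt_0_nat)

lemma not_vunit_p: "\<not> vunit \<pi>"
  using inverse_p by (simp add: vunit_def)

lemma not_vunit_p_mult: "x \<in> V \<Longrightarrow> \<not> vunit (\<pi> * x)"
  using vunit_multD[of \<pi> x] not_vunit_p by auto

lemma mem_of_div_p: "x / \<pi> ^ k \<in> V \<Longrightarrow> x \<in> V"
  using mult_mem[OF power_mem[OF of_nat_mem], of "x / \<pi> ^ k" p k] by simp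

lemma div_p_mono:
  assumes "x / \<pi> ^ k \<in> V" "m \<le> k"
  shows "x / \<pi> ^ m \<in> V"
proof -
  have "x / \<pi> ^ m = \<pi> ^ (k - m) * (x / \<pi> ^ k)"
    using assms(2) by (simp add: power_diff)
  also have "\<dots> \<in> V" using assms by (intro mult_mem power_mem) auto
  finally show ?thesis .
qed

lemma vunit_of_int:
  assumes "\<not> int p dvd k"
  shows "vunit (of_int k)"
proof -
  obtain u v :: int where "of_int u * \<pi> + of_int v * of_int k = 1"
    using prime_bezout_complex[OF prime_p assms] .
  then have "vunit (\<pi> * of_int u + of_int k * of_int v)" by (simp add: algebra_simps)
  then have "vunit (\<pi> * of_int u) \<or> vunit (of_int k * of_int v)"
    by (intro vunit_add mult_mem of_nat_mem of_int_mem)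
  then have "vunit (of_int k * of_int v)"
    using not_vunit_p_mult[of "of_int u"] by auto
  then show ?thesis using vunit_multD[of "of_int k" "of_int v"] by auto
qed

lemma vunit_of_nat: "\<not> p dvd k \<Longrightarrow> vunit (of_nat k)"
  using vunit_of_int[of "int k"] by simp

lemma of_int_div_p_iff: "of_int k / \<pi> \<in> V \<longleftrightarrow> int p dvd k"
proof
  assume *: "of_int k / \<pi> \<in> V"
  show "int p dvd k"
  proof (rule ccontr)
    assume "\<not> int p dvd k"
    then have "vunit (of_int k)" by (rule vunit_of_int)
    then have "inverse (of_int k) * (of_int k / \<pi>) \<in> V" "of_int k \<noteq> (0::complex)"
      using mult_mem[OF _ *] by (auto simp only: vunit_def)
    moreover have "inverse (of_int k) * (of_int k / \<pi>) = inverse \<pi>"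
      using calculation(2) by (simp add: field_simps)
    ultimately show False using inverse_p by simp
  qed
next
  assume "int p dvd k"
  then obtain m where "k = int p * m" by (auto elim: dvdE)
  then show "of_int k / \<pi> \<in> V" by simp
qed

lemma of_int_div_p_power_iff: "of_int k / \<pi> ^ m \<in> V \<longleftrightarrow> int p ^ m dvd k"
proof
  assume "of_int k / \<pi> ^ m \<in> V"
  then show "int p ^ m dvd k"
  proof (induction m arbitrary: k)
    case (Suc m)
    have "of_int k / \<pi> ^ 1 \<in> V" by (rule div_p_mono[OF Suc.prems]) simp
    then obtain l where l: "k = int p * l" using of_int_div_p_iff[of k] by (auto elim: dvdE)
    then have "of_int l / \<pi> ^ m \<in> V" using Suc.prems by simp
    then show ?case using Suc.IH l by simp
  qed simp
next
  assume "int p ^ m dvd k"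
  then obtain l where "k = int p ^ m * l" by (auto elim: dvdE)
  then show "of_int k / \<pi> ^ m \<in> V" by simp
qed

text \<open>An integral rational number has a denominator prime to p, which is therefore invertible
  modulo p^m.\<close>

lemma Rats_cong_int:
  assumes "c \<in> \<rat>" "c \<in> V"
  shows "\<exists>k::int. (c - of_int k) / \<pi> ^ m \<in> V"
proof -
  obtain a b where ab: "b > 0" "coprime a b" "c = of_int a / of_int b"
    using assms(1) by (auto elim: Rats_cases')
  have b: "\<not> int p dvd b"
  proof
    assume pb: "int p dvd b"
    then have "\<not> int p dvd a"
      using ab(2) prime_p by (meson coprime_common_divisor not_prime_unit prime_nat_int_transfer)
    then have "vunit (of_int a)" by (rule vunit_of_int)
    then have a: "of_int a \<noteq> (0::complex)" "inverse (of_int a) \<in> V"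
      by (auto simp: vunit_def)
    have "of_int b / \<pi> \<in> V" using pb by (simp only: of_int_div_p_iff)
    then have "c * (of_int b / \<pi>) * inverse (of_int a) \<in> V"
      using a assms by (intro mult_mem)
    moreover have "c * (of_int b / \<pi>) * inverse (of_int a) = inverse \<pi>"
      using ab a by (simp add: field_simps)
    ultimately show False using inverse_p by simp
  qed
  then have "coprime (int p) b" using prime_p by (simp add: prime_imp_coprime)
  then have "coprime b (int p ^ m)" by (simp add: coprime_commute)
  then obtain b' where "[b * b' = 1] (mod int p ^ m)" using cong_solve_coprime_int by blast
  then obtain t where t: "1 - b * b' = int p ^ m * t"
    by (metis cong_iff_dvd_diff dvdE cong_sym)
  have "c - of_int (a * b') = of_int a * of_int (1 - b * b') * inverse (of_int b)"
    using ab by (simp add: field_simps)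
  then have "(c - of_int (a * b')) / \<pi> ^ m = of_int a * of_int t * inverse (of_int b)"
    unfolding t by simp
  also have "\<dots> \<in> V" using vunit_of_int[OF b] by (auto simp: vunit_def intro!: mult_mem)
  finally show ?thesis ..
qed

lemma algebraic_bounded:
  assumes "algebraic x"
  shows "\<exists>s. \<pi> ^ s * x \<in> V"
proof -
  obtain N :: int where N: "N > 0" "algebraic_int (of_int N * x)"
    using assms algebraic_iff_algebraic_int by blast
  obtain s N' where s: "N = int p ^ s * N'" "\<not> int p dvd N'"
    using N(1) prime_p multiplicity_decompose'[of N "int p"] by (metis less_irrefl not_prime_unit prime_nat_int_transfer)
  have u: "vunit (of_int N')" by (rule vunit_of_int[OF s(2)])
  then have "inverse (of_int N') * (of_int N * x) \<in> V"
    using algebraic_int_mem[OF N(2)] by (auto simp: vunit_def intro: mult_mem)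
  then have "\<pi> ^ s * x \<in> V" using u s by (simp add: vunit_def field_simps)
  then show ?thesis ..
qed

text \<open>A Newton polygon argument: if j is the lowest index of a coefficient prime to p, the
  minimal equation says that u^j w is p times an integral element, and w is that coefficient plus a
  multiple of u, hence a unit.\<close>

lemma nonunit_power_div_p:
  assumes u: "algebraic u" "u \<in> V" "\<not> vunit u"
  shows "\<exists>j. u ^ j / \<pi> \<in> V"
proof -
  define f where "f = min_poly_int u"
  have f: "poly (cpoly f) u = 0" using poly_min_poly_int[OF u(1)] by (simp add: f_def)
  have "\<exists>i. \<not> int p dvd coeff f i"
    unfolding f_def by (rule min_poly_int_coeff_not_dvd[OF u(1) prime_p])
  define j where "j = (LEAST i. \<not> int p dvd coeff f i)"
  have j: "\<not> int p dvd coeff f j" "\<And>i. i < j \<Longrightarrow> int p dvd coeff f i"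
    unfolding j_def using LeastI_ex[OF \<open>\<exists>i. \<not> int p dvd coeff f i\<close>] not_less_Least by auto
  define w where "w = poly (poly_shift j (cpoly f)) u"
  have eq: "poly (cpoly f) u = (\<Sum>i<k. of_int (coeff f i) * u ^ i) + u ^ k * poly (poly_shift k (cpoly f)) u" for k
  proof (induction k)
    case 0
    show ?case by simp
  next
    case (Suc k)
    then show ?case by (simp add: poly_poly_shift_Suc[of k "cpoly f" u] algebra_simps)
  qed
  have "w = of_int (coeff f j) + u * poly (poly_shift (Suc j) (cpoly f)) u"
    unfolding w_def by (subst poly_poly_shift_Suc) simp
  moreover have PV: "poly (poly_shift k (cpoly f)) u \<in> V" for k
    using u by (auto intro!: poly_mem simp: coeff_poly_shift)
  ultimately have "vunit (w + - (u * poly (poly_shift (Suc j) (cpoly f)) u))"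
    using vunit_of_int[OF j(1)] by simp
  moreover have "\<not> vunit (- (u * poly (poly_shift (Suc j) (cpoly f)) u))"
    using vunit_multD[of u "- poly (poly_shift (Suc j) (cpoly f)) u"] u PV minus_mem by auto
  ultimately have w: "vunit w"
    using vunit_add[of w "- (u * poly (poly_shift (Suc j) (cpoly f)) u)"] u PV unfolding w_def
    by (meson minus_mem mult_mem)
  have "u ^ j * w = - (\<Sum>i<j. of_int (coeff f i) * u ^ i)"
    using eq[of j] f by (simp add: w_def eq_neg_iff_add_eq_0 add.commute)
  moreover have "u ^ j / \<pi> = u ^ j * w / \<pi> * inverse w"
    using w by (simp add: vunit_def)
  ultimately have "u ^ j / \<pi> = - (\<Sum>i<j. of_int (coeff f i) * u ^ i) / \<pi> * inverse w"
    by simp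
  also have "\<dots> = - (\<Sum>i<j. of_int (coeff f i) / \<pi> * u ^ i) * inverse w"
    by (simp add: sum_divide_distrib)
  also have "\<dots> \<in> V"
  proof (intro mult_mem minus_mem sum_mem power_mem u(2))
    show "of_int (coeff f i) / \<pi> \<in> V" if "i \<in> {..<j}" for i
      using j(2) that by (simp add: of_int_div_p_iff)
    show "inverse w \<in> V" using w by (simp add: vunit_def)
  qed
  finally show ?thesis ..
qed

text \<open>The closure of the rationals for the \<open>V\<close>-adic topology; inside the algebraic
  numbers it plays the role of the field of \<open>p\<close>-adic numbers.\<close>

definition padic :: "complex set" where
  "padic = {x. \<forall>k. \<exists>c\<in>\<rat>. (x - c) / \<pi> ^ k \<in> V}"

lemma padicD: "x \<in> padic \<Longrightarrow> \<exists>c\<in>\<rat>. (x - c) / \<pi> ^ k \<in> V"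
  by (simp add: padic_def)

lemma Rats_padic: "x \<in> \<rat> \<Longrightarrow> x \<in> padic"
  by (auto simp: padic_def intro: bexI[of _ x])

lemma padic_diff:
  assumes "x \<in> padic" "y \<in> padic"
  shows "x - y \<in> padic"
  unfolding padic_def
proof (rule CollectI, rule allI)
  fix k
  obtain c d where c: "c \<in> \<rat>" "(x - c) / \<pi> ^ k \<in> V" and d: "d \<in> \<rat>" "(y - d) / \<pi> ^ k \<in> V"
    using padicD[OF assms(1), of k] padicD[OF assms(2), of k] by auto
  have "(x - y - (c - d)) / \<pi> ^ k = (x - c) / \<pi> ^ k - (y - d) / \<pi> ^ k"
    by (simp add: diff_divide_distrib)
  then show "\<exists>c\<in>\<rat>. (x - y - c) / \<pi> ^ k \<in> V"
    using c d diff_mem by (metis Rats_diff)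
qed

lemma padic_bounded:
  assumes "x \<in> padic"
  shows "\<exists>s. \<pi> ^ s * x \<in> V"
proof -
  obtain c where c: "c \<in> \<rat>" "x - c \<in> V" using padicD[OF assms, of 0] by auto
  obtain s where s: "\<pi> ^ s * c \<in> V" using algebraic_bounded[OF algebraic_Rats[OF c(1)]] by auto
  have "\<pi> ^ s * x = \<pi> ^ s * (x - c) + \<pi> ^ s * c" by (simp add: algebra_simps)
  also have "\<dots> \<in> V" by (rule add_mem[OF mult_mem[OF power_mem[OF of_nat_mem] c(2)] s])
  finally show ?thesis ..
qed

lemma padic_mult:
  assumes "x \<in> padic" "y \<in> padic"
  shows "x * y \<in> padic"
  unfolding padic_def
proof (rule CollectI, rule allI)
  fix k
  obtain s where s: "\<pi> ^ s * x \<in> V" using padic_bounded[OF assms(1)] by auto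
  obtain d where d: "d \<in> \<rat>" "(y - d) / \<pi> ^ (k + s) \<in> V" using padicD[OF assms(2)] by auto
  obtain t where t: "\<pi> ^ t * d \<in> V" using algebraic_bounded[OF algebraic_Rats[OF d(1)]] by auto
  \<comment> \<open>The precision for x comes last: it must absorb the denominator p^t of d.\<close>
  obtain c where c: "c \<in> \<rat>" "(x - c) / \<pi> ^ (k + t) \<in> V" using padicD[OF assms(1)] by auto
  have "\<pi> ^ s * x * ((y - d) / \<pi> ^ (k + s)) = x * (y - d) / \<pi> ^ k"
    "\<pi> ^ t * d * ((x - c) / \<pi> ^ (k + t)) = d * (x - c) / \<pi> ^ k"
    by (simp_all add: power_add)
  then have "(x * y - c * d) / \<pi> ^ k =
      \<pi> ^ s * x * ((y - d) / \<pi> ^ (k + s)) + \<pi> ^ t * d * ((x - c) / \<pi> ^ (k + t))"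
    by (simp add: algebra_simps flip: add_divide_distrib)
  also have "\<dots> \<in> V" by (rule add_mem[OF mult_mem[OF s d(2)] mult_mem[OF t c(2)]])
  finally show "\<exists>c\<in>\<rat>. (x * y - c) / \<pi> ^ k \<in> V"
    using c d by (intro bexI[of _ "c * d"]) auto
qed

lemma padic_inverse:
  assumes "x \<in> padic" "algebraic x"
  shows "inverse x \<in> padic"
proof (cases "x = 0")
  case True then show ?thesis using assms by simp
next
  case False
  obtain s where s: "\<pi> ^ s * inverse x \<in> V"
    using algebraic_bounded[OF algebraic_inverse[OF assms(2)]] by auto
  show ?thesis unfolding padic_def
  proof (rule CollectI, rule allI)
    fix k
    \<comment> \<open>The extra 2 s pays for the factors 1/x and 1/c in 1/x - 1/c; the extra 1 makes
      c/x congruent to 1 modulo p, hence a unit.\<close>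
    obtain c where c: "c \<in> \<rat>" "(x - c) / \<pi> ^ (k + s + s + 1) \<in> V" using padicD[OF assms(1)] by blast
    have ineq: "(x - c) / \<pi> ^ (s + 1) \<in> V" by (rule div_p_mono[OF c(2)]) simp
    define r where "r = \<pi> ^ s * inverse x * ((x - c) / \<pi> ^ (s + 1))"
    have rV: "r \<in> V" unfolding r_def using s ineq by (rule mult_mem)
    have cx: "c = x * (1 - \<pi> * r)" unfolding r_def using False by (simp add: field_simps)
    have "vunit ((1 - \<pi> * r) + \<pi> * r)" by simp
    then have u: "vunit (1 - \<pi> * r)"
      using vunit_add[OF diff_mem[OF one_mem mult_mem[OF of_nat_mem rV]] mult_mem[OF of_nat_mem rV]]
        not_vunit_p_mult[OF rV] by blast
    then have c0: "c \<noteq> 0" using cx False by (auto simp: vunit_def)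
    have ic: "inverse c = inverse x * inverse (1 - \<pi> * r)"
      by (subst cx) (rule inverse_mult_distrib)
    have e: "(x - c) / \<pi> ^ k = \<pi> * ((x - c) / \<pi> ^ (k + s + s + 1)) * \<pi> ^ s * \<pi> ^ s"
      by (simp add: power_add field_simps)
    have "(inverse x - inverse c) / \<pi> ^ k = - ((x - c) / \<pi> ^ k * inverse x * inverse c)"
      using False c0 by (simp add: field_simps)
    also have "\<dots> =
       - (\<pi> * ((x - c) / \<pi> ^ (k + s + s + 1)) * (\<pi> ^ s * inverse x) * (\<pi> ^ s * inverse x) * inverse (1 - \<pi> * r))"
      by (subst ic, subst e) (simp only: mult_ac)
    also have "\<dots> \<in> V"
      using u unfolding vunit_def by (intro minus_mem mult_mem[OF mult_mem[OF mult_mem[OF mult_mem]]] of_nat_mem c(2) s) auto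
    finally show "\<exists>c\<in>\<rat>. (inverse x - c) / \<pi> ^ k \<in> V" using c(1) by (intro bexI[of _ "inverse c"]) auto
  qed
qed

lemma padic_cong_int:
  assumes "x \<in> padic" "x \<in> V"
  shows "\<exists>k::int. (x - of_int k) / \<pi> ^ m \<in> V"
proof -
  obtain c where c: "c \<in> \<rat>" "(x - c) / \<pi> ^ m \<in> V" using padicD[OF assms(1)] by auto
  have "x - (x - c) \<in> V" using assms(2) mem_of_div_p[OF c(2)] by (rule diff_mem)
  then obtain k :: int where k: "(c - of_int k) / \<pi> ^ m \<in> V" using Rats_cong_int c(1) by auto
  have "(x - of_int k) / \<pi> ^ m = (x - c) / \<pi> ^ m + (c - of_int k) / \<pi> ^ m"
    by (simp add: diff_divide_distrib add_divide_distrib)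
  then show ?thesis using add_mem[OF c(2) k] by metis
qed

text \<open>Modulo p, x is an integer, and this integer is divisible by p unless x is a unit. So p
  is a uniformizer: there is no ramification.\<close>

lemma padic_nonunit:
  assumes "x \<in> padic" "x \<in> V" "\<not> vunit x"
  shows "x / \<pi> \<in> V"
proof -
  obtain k :: int where k: "(x - of_int k) / \<pi> ^ 1 \<in> V" using padic_cong_int[OF assms(1,2)] by blast
  have "int p dvd k"
  proof (rule ccontr)
    assume "\<not> int p dvd k"
    moreover have "of_int k = x + \<pi> * - ((x - of_int k) / \<pi> ^ 1)" by simp
    ultimately have "vunit (x + \<pi> * - ((x - of_int k) / \<pi> ^ 1))" using vunit_of_int by metis
    then have "vunit x \<or> vunit (\<pi> * - ((x - of_int k) / \<pi> ^ 1))"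
      by (rule vunit_add[OF assms(2) mult_mem[OF of_nat_mem minus_mem[OF k]]])
    then show False
      using assms(3) not_vunit_p_mult[OF minus_mem[OF k]] by blast
  qed
  then have "of_int k / \<pi> \<in> V" by (simp add: of_int_div_p_iff)
  with k have "(x - of_int k) / \<pi> ^ 1 + of_int k / \<pi> \<in> V" by (rule add_mem)
  then show ?thesis by (simp add: diff_divide_distrib)
qed

lemma fermat_int: "int p dvd k ^ p - k"
proof -
  have "[k ^ p = k] (mod int p)"
  proof (cases "int p dvd k")
    case True
    moreover have "int p dvd k ^ p" using True prime_p by (meson dvd_power dvd_trans prime_gt_0_nat)
    ultimately show ?thesis by (simp add: cong_iff_dvd_diff)
  next
    case False
    define m where "m = nat (k mod int p)"
    have p0: "int p > 0" using prime_p by (simp add: prime_gt_0_nat)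
    have km: "[k = int m] (mod int p)" unfolding m_def using p0 by (simp add: cong_def)
    have "\<not> p dvd m" using km False by (metis cong_dvd_iff int_dvd_int_iff)
    then have "[m ^ (p - 1) = 1] (mod p)" by (rule fermat_theorem[OF prime_p])
    then have "[m * m ^ (p - 1) = m * 1] (mod p)" by (rule cong_scalar_left)
    then have "[m ^ p = m] (mod p)"
      using prime_p by (metis mult.right_neutral power_minus_mult prime_gt_0_nat mult.commute)
    then have "[int m ^ p = int m] (mod int p)" by (metis cong_int_iff of_nat_power)
    then show ?thesis using km by (meson cong_pow cong_sym cong_trans)
  qed
  then show ?thesis by (simp add: cong_iff_dvd_diff)
qed

lemma padic_frobenius:
  assumes "x \<in> padic" "x \<in> V"
  shows "(x ^ p - x) / \<pi> \<in> V"
proof -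
  obtain k :: int where k: "(x - of_int k) / \<pi> ^ 1 \<in> V" using padic_cong_int[OF assms] by blast
  have *: "(x ^ m - of_int k ^ m) / \<pi> \<in> V" for m
  proof (induction m)
    case (Suc m)
    have "(x ^ Suc m - of_int k ^ Suc m) / \<pi> =
        x * ((x ^ m - of_int k ^ m) / \<pi>) + (x - of_int k) / \<pi> ^ 1 * of_int k ^ m"
      by (simp add: algebra_simps flip: add_divide_distrib)
    also have "\<dots> \<in> V" using Suc k assms by (intro add_mem mult_mem power_mem of_int_mem)
    finally show ?case .
  qed simp
  have "(x ^ p - x) / \<pi> = (x ^ p - of_int k ^ p) / \<pi> + of_int (k ^ p - k) / \<pi> - (x ^ 1 - of_int k ^ 1) / \<pi>"
    by (simp add: diff_divide_distrib)
  also have "\<dots> \<in> V" using *[of p] *[of 1] fermat_int[of k]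
    by (intro add_mem diff_mem) (auto simp only: of_int_div_p_iff)
  finally show ?thesis .
qed

end

lemma p_valuation_exists:
  assumes "prime p"
  obtains V where "p_valuation V p"
proof -
  have "inverse (of_nat p :: complex) \<notin> \<int>"
  proof
    assume "inverse (of_nat p :: complex) \<in> \<int>"
    then obtain k where "inverse (of_nat p :: complex) = of_int k" by (auto elim: Ints_cases)
    then have "of_int (int p * k) = (1::complex)"
      using assms by (simp add: prime_gt_0_nat field_simps)
    then have "int p * k = 1" using of_int_eq_1_iff by blast
    then show False using assms by (metis dvd_triv_left not_prime_unit prime_nat_int_transfer)
  qed
  then obtain V where "valuation_ring V" "inverse (of_nat p) \<notin> V"
    by (rule chevalley_extension[OF complex_subring_Ints, rotated]) auto
  then show ?thesis using that assms by (auto simp: p_valuation_def p_valuation_axioms_def)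
qed

section \<open>Embeddings of simple extensions and conjugation of the local condition\<close>

section \<open>Simple extensions of the rationals\<close>

definition ratp :: "complex poly \<Rightarrow> bool" where
  "ratp q \<longleftrightarrow> (\<forall>i. coeff q i \<in> \<rat>)"

lemma ratp_simps [simp]:
  "ratp 0" "ratp 1" "ratp (cpoly f)" "ratp (pCons a q) \<longleftrightarrow> a \<in> \<rat> \<and> ratp q"
proof -
  show "ratp (pCons a q) \<longleftrightarrow> a \<in> \<rat> \<and> ratp q"
    unfolding ratp_def coeff_pCons by (auto split: nat.splits)
qed (auto simp: ratp_def)

lemma ratp_diff: "ratp q \<Longrightarrow> ratp r \<Longrightarrow> ratp (q - r)"
  and ratp_add: "ratp q \<Longrightarrow> ratp r \<Longrightarrow> ratp (q + r)"
  by (simp_all add: ratp_def)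

lemma ratp_mult: "ratp q \<Longrightarrow> ratp r \<Longrightarrow> ratp (q * r)"
  unfolding ratp_def coeff_mult by (auto intro: Rats_sum)

lemma ratp_pcompose: "ratp q \<Longrightarrow> ratp r \<Longrightarrow> ratp (pcompose q r)"
  by (induction q) (auto simp: pcompose_pCons ratp_mult intro!: ratp_add)

lemma ratp_clear_denominators:
  "ratp q \<Longrightarrow> \<exists>N::int. \<exists>g. N > 0 \<and> smult (of_int N) q = cpoly g"
proof (induction q)
  case 0
  show ?case by (rule exI[of _ 1], rule exI[of _ 0]) simp
next
  case (pCons a q)
  then obtain N g where N: "N > 0" "smult (of_int N) q = cpoly g" by auto
  obtain u v :: int where u: "v > 0" "a = of_int u / of_int v" using pCons.prems by (auto elim: Rats_cases')
  have "smult (of_int (v * N)) (pCons a q) = cpoly (pCons (u * N) (smult v g))"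
    using u N(2) by (simp add: map_poly_pCons flip: N(2) smult_smult)
  then show ?case using u(1) N(1) by (intro exI[of _ "v * N"]) auto
qed

definition simple_ext :: "complex \<Rightarrow> complex set" where
  "simple_ext \<alpha> = {poly q \<alpha> | q. ratp q}"

lemma poly_mem_simple_ext: "ratp q \<Longrightarrow> poly q \<alpha> \<in> simple_ext \<alpha>"
  unfolding simple_ext_def by blast

lemma simple_extE:
  assumes "x \<in> simple_ext \<alpha>"
  obtains q where "ratp q" "x = poly q \<alpha>"
  using assms unfolding simple_ext_def by blast

lemma Rats_simple_ext: "a \<in> \<rat> \<Longrightarrow> a \<in> simple_ext \<alpha>"
  using poly_mem_simple_ext[of "[:a:]"] by simp

lemma self_simple_ext: "\<alpha> \<in> simple_ext \<alpha>"
  using poly_mem_simple_ext[of "[:0, 1:]"] by simp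

lemma complex_subring_simple_ext: "complex_subring (simple_ext \<alpha>)"
proof
  fix x y assume "x \<in> simple_ext \<alpha>" "y \<in> simple_ext \<alpha>"
  then obtain q r where q: "ratp q" "x = poly q \<alpha>" and r: "ratp r" "y = poly r \<alpha>"
    by (meson simple_extE)
  show "x - y \<in> simple_ext \<alpha>" "x * y \<in> simple_ext \<alpha>"
    using poly_mem_simple_ext[OF ratp_diff[OF q(1) r(1)]] poly_mem_simple_ext[OF ratp_mult[OF q(1) r(1)]] q r
    by simp_all
qed (simp add: Rats_simple_ext)

lemma simple_ext_poly: "x \<in> simple_ext \<alpha> \<Longrightarrow> ratp r \<Longrightarrow> poly r x \<in> simple_ext \<alpha>"
  using poly_mem_simple_ext[OF ratp_pcompose] by (metis poly_pcompose simple_extE)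

lemma simple_ext_mono: "\<beta> \<in> simple_ext \<alpha> \<Longrightarrow> simple_ext \<beta> \<subseteq> simple_ext \<alpha>"
  using simple_ext_poly by (auto elim!: simple_extE[of _ \<beta>])

lemma algebraic_poly: "algebraic x \<Longrightarrow> ratp q \<Longrightarrow> algebraic (poly q x)"
  using complex_subring.poly_mem[OF complex_subring_algebraic, of q x] algebraic_Rats by (auto simp: ratp_def)

lemma algebraic_simple_ext: "algebraic \<alpha> \<Longrightarrow> x \<in> simple_ext \<alpha> \<Longrightarrow> algebraic x"
  by (auto elim!: simple_extE intro: algebraic_poly)

text \<open>An integral equation for x with nonzero constant coefficient is solved for this
  coefficient.\<close>

lemma inverse_mem_simple_ext_self:
  assumes "algebraic x"
  shows "inverse x \<in> simple_ext x"
proof (cases "x = 0")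
  case True then show ?thesis using Rats_simple_ext[of 0] by simp
next
  case False
  obtain f where f: "coeff f 0 \<noteq> 0" "poly (cpoly f) x = 0"
    using algebraicE'_nonzero[OF assms False] by metis
  define r where "r = smult (- inverse (of_int (coeff f 0))) (poly_shift 1 (cpoly f))"
  have "poly (cpoly f) x = of_int (coeff f 0) + x * poly (poly_shift 1 (cpoly f)) x"
    using poly_poly_shift_Suc[of 0 "cpoly f" x] by simp
  then have "x * poly (poly_shift 1 (cpoly f)) x = - of_int (coeff f 0)"
    using f(2) by (simp add: add_eq_0_iff)
  moreover have "x * poly r x = - inverse (of_int (coeff f 0)) * (x * poly (poly_shift 1 (cpoly f)) x)"
    by (simp add: r_def)
  ultimately have "x * poly r x = 1" using f(1) by simp
  then have "inverse x = poly r x" by (rule inverse_unique)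
  moreover have "ratp r" by (auto simp: ratp_def r_def coeff_poly_shift)
  ultimately show ?thesis using poly_mem_simple_ext by metis
qed

lemma inverse_mem_simple_ext:
  assumes "algebraic \<alpha>" "x \<in> simple_ext \<alpha>"
  shows "inverse x \<in> simple_ext \<alpha>"
  using inverse_mem_simple_ext_self[OF algebraic_simple_ext[OF assms]] simple_ext_mono[OF assms(2)] by blast

lemma ratp_root_conjugate:
  assumes "algebraic \<alpha>" "\<beta> \<in> conjugates \<alpha>" "ratp q" "poly q \<alpha> = 0"
  shows "poly q \<beta> = 0"
proof -
  obtain N g where N: "N > (0::int)" "smult (of_int N) q = cpoly g"
    using ratp_clear_denominators[OF assms(3)] by blast
  have "poly (cpoly g) \<alpha> = 0" using assms(4) by (simp flip: N(2))
  then have "min_poly_int \<alpha> dvd g" by (rule min_poly_int_dvd[OF assms(1)])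
  then have "poly (cpoly g) \<beta> = 0" using assms(2) by (auto simp: conjugates_def elim!: dvdE)
  then show ?thesis using N(1) by (simp flip: N(2))
qed

text \<open>The embedding of Q(\<alpha>) that sends \<alpha> to \<beta>. It does not depend on the
  polynomial chosen, because rational relations of \<alpha> hold for its conjugates; outside
  Q(\<alpha>) the values mean nothing.\<close>

definition emb :: "complex \<Rightarrow> complex \<Rightarrow> complex \<Rightarrow> complex" where
  "emb \<alpha> \<beta> x = poly (SOME q. ratp q \<and> poly q \<alpha> = x) \<beta>"

context
  fixes \<alpha> \<beta> :: complex
  assumes alg: "algebraic \<alpha>" and conj: "\<beta> \<in> conjugates \<alpha>"
begin

lemma emb_poly:
  assumes "ratp q"
  shows "emb \<alpha> \<beta> (poly q \<alpha>) = poly q \<beta>"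
proof -
  define r where "r = (SOME r. ratp r \<and> poly r \<alpha> = poly q \<alpha>)"
  have r: "ratp r \<and> poly r \<alpha> = poly q \<alpha>"
    unfolding r_def by (rule someI[of _ q]) (use assms in auto)
  then have "poly (r - q) \<beta> = 0"
    by (intro ratp_root_conjugate[OF alg conj] ratp_diff) (use assms in auto)
  then show ?thesis by (simp add: emb_def r_def)
qed

lemma emb_diff: "x \<in> simple_ext \<alpha> \<Longrightarrow> y \<in> simple_ext \<alpha> \<Longrightarrow> emb \<alpha> \<beta> (x - y) = emb \<alpha> \<beta> x - emb \<alpha> \<beta> y"
  and emb_add: "x \<in> simple_ext \<alpha> \<Longrightarrow> y \<in> simple_ext \<alpha> \<Longrightarrow> emb \<alpha> \<beta> (x + y) = emb \<alpha> \<beta> x + emb \<alpha> \<beta> y"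
  and emb_mult: "x \<in> simple_ext \<alpha> \<Longrightarrow> y \<in> simple_ext \<alpha> \<Longrightarrow> emb \<alpha> \<beta> (x * y) = emb \<alpha> \<beta> x * emb \<alpha> \<beta> y"
  by (elim simple_extE, metis emb_poly poly_diff ratp_diff poly_add ratp_add poly_mult ratp_mult)+

lemma emb_Rats: "a \<in> \<rat> \<Longrightarrow> emb \<alpha> \<beta> a = a"
  using emb_poly[of "[:a:]"] by simp

lemma emb_self: "emb \<alpha> \<beta> \<alpha> = \<beta>"
  using emb_poly[of "[:0, 1:]"] by simp

lemma emb_inverse:
  assumes "x \<in> simple_ext \<alpha>" "x \<noteq> 0"
  shows "emb \<alpha> \<beta> (inverse x) = inverse (emb \<alpha> \<beta> x)"
proof -
  have "emb \<alpha> \<beta> x * emb \<alpha> \<beta> (inverse x) = emb \<alpha> \<beta> (x * inverse x)"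
    by (rule emb_mult[symmetric]) (rule assms inverse_mem_simple_ext[OF alg])+
  also have "\<dots> = 1" using assms emb_Rats[of 1] by simp
  finally show ?thesis by (simp add: inverse_unique)
qed

lemma emb_power: "x \<in> simple_ext \<alpha> \<Longrightarrow> emb \<alpha> \<beta> (x ^ n) = emb \<alpha> \<beta> x ^ n"
  by (induction n) (simp_all add: emb_Rats emb_mult complex_subring.power_mem[OF complex_subring_simple_ext])

lemma emb_root:
  assumes "x \<in> simple_ext \<alpha>" "ratp f" "poly f x = 0"
  shows "poly f (emb \<alpha> \<beta> x) = 0"
proof -
  obtain q where q: "ratp q" "x = poly q \<alpha>" using assms(1) by (rule simple_extE)
  have "poly (pcompose f q) \<beta> = 0"
    by (rule ratp_root_conjugate[OF alg conj ratp_pcompose]) (use assms q in \<open>auto simp: poly_pcompose\<close>)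
  then show ?thesis using q emb_poly by (simp add: poly_pcompose)
qed

lemma emb_algebraic_int:
  assumes "x \<in> simple_ext \<alpha>" "algebraic_int x"
  shows "algebraic_int (emb \<alpha> \<beta> x)"
proof -
  obtain f where f: "lead_coeff f = 1" "\<forall>i. coeff f i \<in> \<int>" "poly f x = 0"
    using assms(2) by (auto simp: algebraic_int.simps)
  have "ratp f" unfolding ratp_def using f(2) Ints_subset_Rats by blast
  then show ?thesis using f emb_root[OF assms(1)] by (auto intro: algebraic_int.intros)
qed

text \<open>The hypothesis covers all valuations above p, so V can be pulled back along the
  embedding and extended to some W, where \<alpha> has rational approximations; the embedding fixes
  these and turns them into approximations of \<beta>. The point is that W is not larger on
  Q(\<alpha>) than the pullback.\<close>

theorem padic_conjugate:
  assumes V: "p_valuation V p" and \<alpha>: "\<And>W. p_valuation W p \<Longrightarrow> \<alpha> \<in> p_valuation.padic W p"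
  shows "\<beta> \<in> p_valuation.padic V p"
proof -
  interpret V: p_valuation V p by (rule V)
  let ?\<sigma> = "emb \<alpha> \<beta>" and ?F = "simple_ext \<alpha>"
  interpret F: complex_subring ?F by (rule complex_subring_simple_ext)
  define W0 where "W0 = {x \<in> ?F. ?\<sigma> x \<in> V}"
  have W0: "complex_subring W0"
    by unfold_locales
      (auto simp: W0_def emb_diff emb_mult emb_Rats F.diff_mem F.mult_mem V.diff_mem V.mult_mem)
  have pW: "of_nat p \<in> W0" "inverse (of_nat p) \<notin> W0"
    using V.inverse_p by (auto simp: W0_def emb_Rats)
  obtain W where W: "valuation_ring W" "W0 \<subseteq> W" "inverse (of_nat p) \<notin> W"
    by (rule chevalley_extension[OF W0 pW])
  interpret W: p_valuation W p
    using W V.prime_p by (simp add: p_valuation_def p_valuation_axioms_def)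
  show ?thesis
    unfolding V.padic_def
  proof (rule CollectI, rule allI)
    fix k
    obtain c where c: "c \<in> \<rat>" "(\<alpha> - c) / of_nat p ^ k \<in> W"
      using W.padicD[OF \<alpha>[OF W.p_valuation_axioms]] by blast
    define x y where "x = (\<alpha> - c) / of_nat p ^ k" and "y = (\<beta> - c) / of_nat p ^ k"
    have cF: "c \<in> ?F" "inverse (of_nat p ^ k) \<in> ?F" "inverse (of_nat p) \<in> ?F"
      using c(1) by (auto intro!: Rats_simple_ext)
    have x: "x \<in> ?F" unfolding x_def divide_inverse
      by (intro F.mult_mem F.diff_mem self_simple_ext cF)
    have \<sigma>x: "?\<sigma> x = y" unfolding x_def y_def divide_inverse
      using c(1) cF by (simp add: emb_mult emb_diff emb_self emb_Rats F.diff_mem self_simple_ext)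
    have "y \<in> V"
    proof (rule ccontr)
      assume y: "y \<notin> V"
      then have y0: "y \<noteq> 0" "inverse y \<in> V" using V.mem_inverse by auto
      then have x0: "x \<noteq> 0" using \<sigma>x emb_Rats[of 0] by auto
      have ix: "inverse x \<in> ?F" by (rule inverse_mem_simple_ext[OF alg x])
      have "\<not> V.vunit (inverse y)" using y by (simp add: V.vunit_def)
      moreover have "algebraic (inverse y)"
        unfolding y_def divide_inverse using c(1) algebraic_conjugate[OF alg conj]
        by (intro algebraic_inverse algebraic_mult algebraic_diff) (auto intro: algebraic_Rats)
      ultimately obtain j where j: "inverse y ^ j / of_nat p \<in> V"
        using V.nonunit_power_div_p y0(2) by blast
      \<comment> \<open>As y is not in V, p divides a power of 1/y. The preimage w of the quotient
        lies in W, and multiplying it by x^j puts 1/p into W.\<close>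
      define w where "w = inverse x ^ j * inverse (of_nat p)"
      have "?\<sigma> w = inverse y ^ j / of_nat p"
        unfolding w_def using ix x x0 cF
        by (simp add: emb_mult emb_power emb_inverse \<sigma>x emb_Rats F.power_mem divide_inverse)
      moreover have "w \<in> ?F" unfolding w_def by (intro F.mult_mem F.power_mem ix cF)
      ultimately have "w \<in> W" using j W(2) by (auto simp: W0_def)
      moreover have "x \<in> W" using c(2) by (simp add: x_def)
      ultimately have "x ^ j * w \<in> W" by (intro W.mult_mem W.power_mem)
      moreover have "x ^ j * w = inverse (of_nat p)" using x0 by (simp add: w_def field_simps)
      ultimately show False using W(3) by simp
    qed
    then show "\<exists>c\<in>\<rat>. (\<beta> - c) / of_nat p ^ k \<in> V" using c(1) by (auto simp: y_def)
  qed
qed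

end

section \<open>The primitive element theorem\<close>

section \<open>Primitive elements\<close>

text \<open>Division with remainder over a field given as a set: leading terms are cancelled one at
  a time, with all coefficients kept in F.\<close>

lemma minimal_degree_dvd:
  fixes F :: "complex set" and m a :: "complex poly"
  assumes F: "complex_subring F" "\<And>x. x \<in> F \<Longrightarrow> inverse x \<in> F"
    and m: "m \<noteq> 0" "\<And>i. coeff m i \<in> F" "poly m \<beta> = 0"
    and min: "\<And>q. q \<noteq> 0 \<Longrightarrow> (\<And>i. coeff q i \<in> F) \<Longrightarrow> poly q \<beta> = 0 \<Longrightarrow> degree m \<le> degree q"
    and a: "\<And>i. coeff a i \<in> F" "poly a \<beta> = 0"
  shows "m dvd a"
  using a
proof (induction "degree a" arbitrary: a rule: less_induct)
  case less
  interpret complex_subring F by (rule F(1))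
  show ?case
  proof (cases "a = 0")
    case False
    then have deg: "degree m \<le> degree a" using min less.prems by blast
    define c where "c = lead_coeff a * inverse (lead_coeff m)"
    define b where "b = monom c (degree a - degree m) * m"
    define a' where "a' = a - b"
    have c: "c \<in> F" "c \<noteq> 0" using less.prems m False F(2) by (auto simp: c_def intro: mult_mem)
    have coef: "coeff a' i \<in> F" for i
      unfolding a'_def b_def using less.prems(1) m(2) c(1) by (auto simp: coeff_monom_mult intro!: diff_mem mult_mem)
    have root: "poly a' \<beta> = 0" unfolding a'_def b_def using m(3) less.prems(2) by simp
    have db: "degree b = degree a"
      unfolding b_def using m(1) c(2) deg by (simp add: degree_mult_eq degree_monom_eq monom_eq_0_iff)
    have "coeff b (degree a) = c * lead_coeff m"
      unfolding b_def using deg by (simp add: coeff_monom_mult)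
    then have lb: "coeff b (degree a) = lead_coeff a"
      using m(1) by (simp add: c_def)
    have "m dvd a'"
    proof (cases "degree a' < degree a")
      case True
      then show ?thesis using less.hyps coef root by blast
    next
      case False
      have "degree a' \<le> degree a" unfolding a'_def using db by (metis degree_diff_le order_refl)
      then have "degree a' = degree a" using False by simp
      moreover have "coeff a' (degree a) = 0" unfolding a'_def using lb by simp
      ultimately have "a' = 0" by (metis leading_coeff_0_iff)
      then show ?thesis by simp
    qed
    moreover have "m dvd b" unfolding b_def by simp
    ultimately have "m dvd a' + b" by (rule dvd_add)
    then show ?thesis by (simp add: a'_def)
  qed simp
qed

lemma primitive_element_pair:
  assumes alg: "algebraic \<alpha>" "algebraic \<beta>"
  obtains c :: int where "\<alpha> \<in> simple_ext (\<alpha> + of_int c * \<beta>)" "\<beta> \<in> simple_ext (\<alpha> + of_int c * \<beta>)"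
proof -
  \<comment> \<open>The bad values of c are those for which another pair of conjugates gives a + c b
    = \<alpha> + c \<beta>. Pairs with b = \<beta> contribute only 0.\<close>
  define B where "B = (\<lambda>(a, b). (a - \<alpha>) / (\<beta> - b)) ` (conjugates \<alpha> \<times> conjugates \<beta>)"
  have "finite B" unfolding B_def using finite_conjugates alg by auto
  moreover have "infinite (range (of_int :: int \<Rightarrow> complex))"
    using finite_imageD[of "of_int :: int \<Rightarrow> complex" UNIV] infinite_UNIV_int by (auto simp: inj_on_def)
  ultimately obtain c :: int where c: "of_int c \<notin> B" by (metis finite_subset image_subsetI)
  define \<gamma> where "\<gamma> = \<alpha> + of_int c * \<beta>"
  have alg\<gamma>: "algebraic \<gamma>"
    unfolding \<gamma>_def using complex_subring.add_mem[OF complex_subring_algebraic, of \<alpha> "of_int c * \<beta>"] alg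
    by (simp add: algebraic_mult algebraic_int_imp_algebraic)
  let ?F = "simple_ext \<gamma>"
  interpret F: complex_subring ?F by (rule complex_subring_simple_ext)
  have invF: "\<And>x. x \<in> ?F \<Longrightarrow> inverse x \<in> ?F" by (rule inverse_mem_simple_ext[OF alg\<gamma>])
  define g where "g = cpoly (min_poly_int \<beta>)"
  define h where "h = pcompose (cpoly (min_poly_int \<alpha>)) [:\<gamma>, - of_int c:]"
  have g: "g \<noteq> 0" "coeff g i \<in> ?F" "poly g \<beta> = 0" for i
    unfolding g_def using alg min_poly_int_nz poly_min_poly_int by (auto intro: Rats_simple_ext)
  have h: "poly h \<beta> = 0"
    unfolding h_def using poly_min_poly_int[OF alg(1)] by (simp add: poly_pcompose \<gamma>_def)
  have hF: "coeff h i \<in> ?F" for i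
  proof -
    have "\<forall>i. coeff (pcompose q [:\<gamma>, - of_int c:]) i \<in> ?F" if "ratp q" for q
      using that
    proof (induction q)
      case (pCons a q)
      then show ?case
        by (auto simp: pcompose_pCons coeff_pCons self_simple_ext Rats_simple_ext
            split: nat.splits intro!: poly_mem_simple_ext F.add_mem F.mult_mem F.diff_mem F.minus_mem)
    qed simp
    then show ?thesis unfolding h_def by simp
  qed
  \<comment> \<open>Up to scaling this is the minimal polynomial of \<beta> over Q(\<gamma>). It
    divides both g and h, whose only common root is \<beta> by the choice of c.\<close>
  define m where "m = arg_min degree (\<lambda>q. q \<noteq> 0 \<and> (\<forall>i. coeff q i \<in> ?F) \<and> poly q \<beta> = 0)"
  have "m \<noteq> 0 \<and> (\<forall>i. coeff m i \<in> ?F) \<and> poly m \<beta> = 0"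
    unfolding m_def by (rule arg_min_natI[of _ g]) (use g in auto)
  then have m: "m \<noteq> 0" "\<And>i. coeff m i \<in> ?F" "poly m \<beta> = 0" by auto
  have mmin: "degree m \<le> degree q" if "q \<noteq> 0" "\<And>i. coeff q i \<in> ?F" "poly q \<beta> = 0" for q
    unfolding m_def by (rule arg_min_nat_le) (use that in auto)
  have mg: "m dvd g" and mh: "m dvd h"
    by (rule minimal_degree_dvd[OF F.complex_subring_axioms invF m mmin]; use g hF h in blast)+
  have only: "z = \<beta>" if "poly m z = 0" for z
  proof (rule ccontr)
    assume z: "z \<noteq> \<beta>"
    have zb: "z \<in> conjugates \<beta>" using mg that by (auto simp: conjugates_def g_def elim!: dvdE)
    have "poly h z = 0" using mh that by (auto elim!: dvdE)
    then have za: "\<gamma> - of_int c * z \<in> conjugates \<alpha>"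
      by (simp add: h_def poly_pcompose conjugates_def mult.commute)
    have "of_int c = (\<gamma> - of_int c * z - \<alpha>) / (\<beta> - z)"
      using z unfolding \<gamma>_def by (simp add: field_simps)
    then have "of_int c \<in> B" unfolding B_def using za zb by force
    with c show False by simp
  qed
  have roots: "{z. poly m z = 0} = {\<beta>}" using only m(3) by blast
  \<comment> \<open>The root \<beta> of m is simple because g is squarefree, so m is linear and
    \<beta> is a quotient of its coefficients.\<close>
  have rsq: "rsquarefree g" unfolding g_def by (rule rsquarefree_min_poly_int[OF alg(2)])
  have "order \<beta> m \<le> order \<beta> g" by (rule dvd_imp_order_le[OF g(1) mg])
  also have "order \<beta> g = 1"
    by (rule rsquarefree_root_order[OF rsq g(3) g(1)])
  finally have "order \<beta> m \<le> 1" .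
  moreover have "order \<beta> m \<noteq> 0" using m order_root[of m \<beta>] by blast
  ultimately have "order \<beta> m = 1" by linarith
  then have "m = smult (lead_coeff m) [:-\<beta>, 1:]"
    using complex_poly_decompose[of m] unfolding roots by simp
  then have "coeff m 0 = - (lead_coeff m * \<beta>)" by (metis coeff_pCons_0 coeff_smult mult_minus_right)
  then have "\<beta> = - (coeff m 0) * inverse (lead_coeff m)" using m(1) by (simp add: field_simps)
  also have "\<dots> \<in> ?F" by (intro F.mult_mem F.minus_mem m invF)
  finally have \<beta>: "\<beta> \<in> ?F" .
  have "\<gamma> - of_int c * \<beta> \<in> ?F" by (intro F.diff_mem F.mult_mem self_simple_ext F.of_int_mem \<beta>)
  then have "\<alpha> \<in> ?F" by (simp add: \<gamma>_def)
  with \<beta> show ?thesis using that unfolding \<gamma>_def by blast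
qed

text \<open>The last clause later places \<gamma> inside the number field from which the list is
  taken.\<close>

lemma primitive_element_list:
  assumes "\<And>u. u \<in> set us \<Longrightarrow> algebraic u"
  shows "\<exists>\<gamma>. algebraic \<gamma> \<and> set us \<subseteq> simple_ext \<gamma> \<and> (\<forall>F. complex_subring F \<longrightarrow> set us \<subseteq> F \<longrightarrow> \<gamma> \<in> F)"
  using assms
proof (induction us)
  case Nil
  show ?case by (rule exI[of _ 0]) (simp add: complex_subring.zero_mem)
next
  case (Cons u us)
  then obtain \<gamma> where \<gamma>: "algebraic \<gamma>" "set us \<subseteq> simple_ext \<gamma>"
    "\<And>F. complex_subring F \<Longrightarrow> set us \<subseteq> F \<Longrightarrow> \<gamma> \<in> F" by auto
  have u: "algebraic u" using Cons.prems by simp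
  obtain c :: int where c: "\<gamma> \<in> simple_ext (\<gamma> + of_int c * u)" "u \<in> simple_ext (\<gamma> + of_int c * u)"
    using primitive_element_pair[OF \<gamma>(1) u] .
  have mem: "\<gamma> + of_int c * u \<in> F" if "complex_subring F" "set (u # us) \<subseteq> F" for F
    using that \<gamma>(3)[OF that(1)]
    by (auto intro!: complex_subring.add_mem complex_subring.mult_mem complex_subring.of_int_mem)
  have "algebraic (\<gamma> + of_int c * u)"
    using mem[OF complex_subring_algebraic] Cons.prems by auto
  then show ?case
    using c simple_ext_mono[OF c(1)] \<gamma>(2) mem by (intro exI[of _ "\<gamma> + of_int c * u"]) auto
qed

section \<open>The field of totally \<open>S\<close>-adic numbers\<close>

definition totally_padic :: "nat set \<Rightarrow> complex set" where
  "totally_padic S =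
     {x. algebraic x \<and> (\<forall>p\<in>S. \<forall>V. p_valuation V p \<longrightarrow> x \<in> p_valuation.padic V p)}"

lemma complex_subring_totally_padic: "complex_subring (totally_padic S)"
  by (rule complex_subring.intro)
    (simp_all add: totally_padic_def algebraic_diff algebraic_mult algebraic_Rats
      p_valuation.padic_diff p_valuation.padic_mult p_valuation.Rats_padic)

lemma totally_padic_inverse: "x \<in> totally_padic S \<Longrightarrow> inverse x \<in> totally_padic S"
  by (simp add: totally_padic_def algebraic_inverse p_valuation.padic_inverse)

text \<open>Allows the divisibility of the auxiliary polynomial to be used at all factors of a
  norm.\<close>

lemma totally_padic_conjugate:
  assumes "\<alpha> \<in> totally_padic S" "\<beta> \<in> conjugates \<alpha>"
  shows "\<beta> \<in> totally_padic S"
  using assms padic_conjugate[of \<alpha> \<beta>] algebraic_conjugate[of \<alpha> \<beta>] unfolding totally_padic_def by blast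

section \<open>Comaximal primes above p and residues of algebraic integers\<close>

section \<open>Split primes in rings of integers\<close>

locale complex_prime_ideal = complex_subring R for R +
  fixes P :: "complex set"
  assumes P_sub: "P \<subseteq> R"
    and P_add: "x \<in> P \<Longrightarrow> y \<in> P \<Longrightarrow> x + y \<in> P"
    and P_mult: "r \<in> R \<Longrightarrow> x \<in> P \<Longrightarrow> r * x \<in> P"
    and P_one: "1 \<notin> P"
    and P_nonempty: "0 \<in> P"
    and P_prime: "x \<in> R \<Longrightarrow> y \<in> R \<Longrightarrow> x * y \<in> P \<Longrightarrow> x \<in> P \<or> y \<in> P"
begin

lemma P_minus: "x \<in> P \<Longrightarrow> - x \<in> P"
  using P_mult[of "-1" x] minus_mem[OF one_mem] by simp

lemma P_diff: "x \<in> P \<Longrightarrow> y \<in> P \<Longrightarrow> x - y \<in> P"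
  using P_add[of x "- y"] P_minus by simp

lemma P_mult_right: "r \<in> R \<Longrightarrow> x \<in> P \<Longrightarrow> x * r \<in> P"
  using P_mult by (simp add: mult.commute)

lemma P_sum: "(\<And>i. i \<in> I \<Longrightarrow> f i \<in> P) \<Longrightarrow> sum f I \<in> P"
  by (induction I rule: infinite_finite_induct) (auto intro: P_add P_nonempty)

lemma P_prod_one:
  "(\<And>i. i \<in> I \<Longrightarrow> f i \<in> R) \<Longrightarrow> (\<And>i. i \<in> I \<Longrightarrow> f i - 1 \<in> P) \<Longrightarrow> prod f I - 1 \<in> P"
proof (induction I rule: infinite_finite_induct)
  case (insert i I)
  have "prod f (insert i I) - 1 = f i * (prod f I - 1) + (f i - 1)"
    using insert.hyps by (simp add: algebra_simps)
  also have "\<dots> \<in> P" using insert by (intro P_add P_mult) auto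
  finally show ?case .
qed (auto simp: P_nonempty)

lemma P_of_int:
  assumes "prime p" "of_nat p \<in> P"
  shows "of_int k \<in> P \<longleftrightarrow> int p dvd k"
proof
  assume *: "of_int k \<in> P"
  show "int p dvd k"
  proof (rule ccontr)
    assume "\<not> int p dvd k"
    then obtain u v :: int where "of_int u * of_nat p + of_int v * of_int k = (1::complex)"
      using prime_bezout_complex[OF assms(1)] by blast
    moreover have "of_int u * of_nat p + of_int v * of_int k \<in> P"
      using assms(2) * by (intro P_add P_mult of_int_mem)
    ultimately show False using P_one by simp
  qed
next
  assume "int p dvd k"
  then obtain m where "k = int p * m" by (auto elim: dvdE)
  then have "of_int k = of_int m * (of_nat p :: complex)" by simp
  also have "\<dots> \<in> P" using assms(2) by (intro P_mult of_int_mem)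
  finally show "of_int k \<in> P" .
qed

text \<open>R / P is a field: among the monic integer polynomials with value at x in P, one of least
  degree has constant coefficient prime to p, for otherwise x could be cancelled. This coefficient
  is inverted by Bezout.\<close>

lemma P_inverse:
  assumes p: "prime p" "of_nat p \<in> P" and x: "x \<in> R" "x \<notin> P" "algebraic_int x"
  shows "\<exists>y\<in>R. x * y - 1 \<in> P"
proof -
  define Q where "Q = (\<lambda>f. lead_coeff f = 1 \<and> poly (cpoly f) x \<in> P)"
  obtain f0 where "Q f0"
    using x(3) P_nonempty unfolding Q_def algebraic_int_altdef_ipoly by metis
  define f where "f = arg_min degree Q"
  have f: "Q f" unfolding f_def by (rule arg_min_natI) (rule \<open>Q f0\<close>)
  have fmin: "degree f \<le> degree g" if "Q g" for g
    unfolding f_def by (rule arg_min_nat_le) (rule that)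
  obtain a g where ag: "f = pCons a g" by (cases f)
  have gR: "poly (cpoly g) x \<in> R" using x(1) by (auto intro: poly_mem)
  have fx: "of_int a + x * poly (cpoly g) x \<in> P"
    using f by (simp add: Q_def ag map_poly_pCons)
  have "g \<noteq> 0"
    using f P_one by (auto simp: Q_def ag map_poly_pCons)
  have "\<not> int p dvd a"
  proof
    assume "int p dvd a"
    then have "of_int a \<in> P" using P_of_int[OF p] by simp
    then have "x * poly (cpoly g) x \<in> P" using P_diff[OF fx, of "of_int a"] by simp
    then have "poly (cpoly g) x \<in> P" using P_prime[OF x(1) gR] x(2) by blast
    then have "Q g" using f \<open>g \<noteq> 0\<close> by (simp add: Q_def ag)
    then show False using fmin[of g] \<open>g \<noteq> 0\<close> by (simp add: ag)
  qed
  then obtain u v :: int where uv': "of_int u * of_nat p + of_int v * of_int a = (1::complex)"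
    using prime_bezout_complex[OF p(1)] by blast
  define y where "y = - of_int v * poly (cpoly g) x"
  have "x * y - 1 = - (of_int v * (of_int a + x * poly (cpoly g) x)) - of_int u * of_nat p"
    unfolding y_def by (subst uv'[symmetric]) (simp add: algebra_simps)
  also have "\<dots> \<in> P" using fx p(2) by (intro P_diff P_minus P_mult of_int_mem)
  finally show ?thesis
    unfolding y_def using gR by (intro bexI[of _ y]) (auto simp: y_def intro!: mult_mem minus_mem)
qed

end

text \<open>Any \<open>n + 1\<close> elements of \<open>R\<close> satisfy an integral relation that is
  nontrivial modulo \<open>p\<close>, so that \<open>R/pR\<close> has dimension at most \<open>n\<close>;
  \<open>n\<close> distinct primes above \<open>p\<close> then force \<open>pR\<close> to be their intersection.\<close>

locale split_prime = complex_subring R for R +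
  fixes p n :: nat and P :: "nat \<Rightarrow> complex set"
  assumes prime_p: "prime p"
    and R_int: "x \<in> R \<Longrightarrow> algebraic_int x"
    and relation: "(\<And>i. i \<le> n \<Longrightarrow> y i \<in> R) \<Longrightarrow>
      \<exists>c::nat \<Rightarrow> int. (\<exists>i\<le>n. \<not> int p dvd c i) \<and> (\<Sum>i\<le>n. of_int (c i) * y i) = 0"
    and P_ideal: "i < n \<Longrightarrow> complex_prime_ideal R (P i)"
    and P_inj: "inj_on P {..<n}"
    and p_mem: "i < n \<Longrightarrow> of_nat p \<in> P i"
begin

text \<open>Primes above p are maximal by \<open>P_inverse\<close>, so distinct ones do not contain
  each other; an element of \<open>P j\<close> outside \<open>P i\<close> is then scaled to be 1
  modulo \<open>P i\<close>.\<close>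

lemma separating:
  assumes "i < n" "j < n" "i \<noteq> j"
  shows "\<exists>a\<in>P j. a - 1 \<in> P i"
proof -
  interpret I: complex_prime_ideal R "P i" by (rule P_ideal[OF assms(1)])
  interpret J: complex_prime_ideal R "P j" by (rule P_ideal[OF assms(2)])
  have "\<not> P j \<subseteq> P i"
  proof
    assume sub: "P j \<subseteq> P i"
    have "P i \<noteq> P j" using P_inj assms by (auto simp: inj_on_def)
    then obtain x where x: "x \<in> P i" "x \<notin> P j" using sub by blast
    have xR: "x \<in> R" using I.P_sub x by blast
    obtain y where y: "y \<in> R" "x * y - 1 \<in> P j"
      using J.P_inverse[OF prime_p p_mem[OF assms(2)] xR x(2) R_int[OF xR]] by blast
    have "x * y - 1 \<in> P i" using sub y(2) by blast
    from I.P_diff[OF I.P_mult_right[OF y(1) x(1)] this]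
    show False using I.P_one by simp
  qed
  then obtain a where a: "a \<in> P j" "a \<notin> P i" by blast
  have aR: "a \<in> R" using J.P_sub a by blast
  obtain y where y: "y \<in> R" "a * y - 1 \<in> P i"
    using I.P_inverse[OF prime_p p_mem[OF assms(1)] aR a(2) R_int[OF aR]] by blast
  then show ?thesis using J.P_mult_right[OF y(1) a(1)] by blast
qed

lemma separating_set:
  assumes "i < n" "J \<subseteq> {..<n}" "i \<notin> J"
  shows "\<exists>b\<in>R. b - 1 \<in> P i \<and> (\<forall>j\<in>J. b \<in> P j)"
proof -
  interpret I: complex_prime_ideal R "P i" by (rule P_ideal[OF assms(1)])
  have "\<forall>j\<in>J. \<exists>a. a \<in> P j \<and> a - 1 \<in> P i" using separating assms by blast
  then obtain a where a: "\<And>j. j \<in> J \<Longrightarrow> a j \<in> P j" "\<And>j. j \<in> J \<Longrightarrow> a j - 1 \<in> P i" by metis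
  have aR: "a j \<in> R" if "j \<in> J" for j
    using a(1)[OF that] complex_prime_ideal.P_sub[OF P_ideal] assms(2) that by blast
  have "prod a J \<in> P j" if "j \<in> J" for j
  proof -
    interpret J: complex_prime_ideal R "P j" using that assms(2) by (intro P_ideal) auto
    have "finite J" using assms(2) finite_subset by blast
    then have "prod a J = prod a (J - {j}) * a j" using that by (subst prod.remove[of J j]) (auto simp: mult.commute)
    also have "\<dots> \<in> P j" using a that aR by (intro J.P_mult prod_mem) auto
    finally show ?thesis .
  qed
  then show ?thesis
    using I.P_prod_one[of J a] a aR prod_mem[of J a] by blast
qed

text \<open>Chinese remainders: lifts of the idempotents of the product of the residue rings R / P
  i.\<close>

definition e :: "nat \<Rightarrow> complex" where
  "e i = (SOME b. b \<in> R \<and> b - 1 \<in> P i \<and> (\<forall>j\<in>{..<n} - {i}. b \<in> P j))"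

lemma e:
  assumes "i < n"
  shows "e i \<in> R" "e i - 1 \<in> P i" "\<And>j. j < n \<Longrightarrow> j \<noteq> i \<Longrightarrow> e i \<in> P j"
proof -
  have "\<exists>b. b \<in> R \<and> b - 1 \<in> P i \<and> (\<forall>j\<in>{..<n} - {i}. b \<in> P j)"
    using separating_set[OF assms, of "{..<n} - {i}"] by auto
  from someI_ex[OF this, folded e_def]
  show "e i \<in> R" "e i - 1 \<in> P i" "\<And>j. j < n \<Longrightarrow> j \<noteq> i \<Longrightarrow> e i \<in> P j" by auto
qed

lemma sum_e_mem:
  assumes "j < n" "(\<Sum>i<n. of_int (d i) * e i) \<in> P j"
  shows "int p dvd d j"
proof -
  interpret J: complex_prime_ideal R "P j" by (rule P_ideal[OF assms(1)])
  have "(\<Sum>i<n. of_int (d i) * e i) = of_int (d j) * e j + (\<Sum>i\<in>{..<n} - {j}. of_int (d i) * e i)"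
    using assms(1) by (subst sum.remove[of _ j]) auto
  moreover have "(\<Sum>i\<in>{..<n} - {j}. of_int (d i) * e i) \<in> P j"
    using assms(1) e by (intro J.P_sum J.P_mult) auto
  moreover have "of_int (d j) * (e j - 1) \<in> P j"
    using assms(1) e by (intro J.P_mult) auto
  ultimately have "(\<Sum>i<n. of_int (d i) * e i) - (\<Sum>i\<in>{..<n} - {j}. of_int (d i) * e i)
      - of_int (d j) * (e j - 1) \<in> P j"
    using assms(2) by (intro J.P_diff)
  then have "of_int (d j) \<in> P j"
    using \<open>(\<Sum>i<n. of_int (d i) * e i) = _\<close> by (simp add: algebra_simps)
  then show ?thesis using J.P_of_int[OF prime_p p_mem[OF assms(1)]] by simp
qed

text \<open>In the relation between the \<open>e i\<close> and x the coefficient of x is prime to p: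
  otherwise reduction modulo each \<open>P i\<close> would make the other coefficients divisible by
  p as well. So the relation can be solved for x modulo p.\<close>

lemma span_e:
  assumes "x \<in> R"
  shows "\<exists>d. \<exists>r\<in>R. x = (\<Sum>i<n. of_int (d i) * e i) + of_nat p * r"
proof -
  define y where "y = (\<lambda>i. if i < n then e i else x)"
  have "y i \<in> R" for i using assms e by (simp add: y_def)
  then obtain c :: "nat \<Rightarrow> int" where c: "\<exists>i\<le>n. \<not> int p dvd c i" "(\<Sum>i\<le>n. of_int (c i) * y i) = 0"
    using relation[of y] by blast
  have "(\<Sum>i\<le>n. of_int (c i) * y i) = (\<Sum>i<n. of_int (c i) * e i) + of_int (c n) * x"
    by (simp add: y_def flip: lessThan_Suc_atMost)
  then have rel: "(\<Sum>i<n. of_int (c i) * e i) = - (of_int (c n) * x)"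
    using c(2) by (simp add: eq_neg_iff_add_eq_0)
  have "\<not> int p dvd c n"
  proof
    assume cn: "int p dvd c n"
    have "int p dvd c i" if "i < n" for i
    proof (rule sum_e_mem[OF that])
      interpret I: complex_prime_ideal R "P i" by (rule P_ideal[OF that])
      have "of_int (c n) \<in> P i" using I.P_of_int[OF prime_p p_mem[OF that]] cn by simp
      then show "(\<Sum>i<n. of_int (c i) * e i) \<in> P i"
        unfolding rel using assms by (intro I.P_minus I.P_mult_right)
    qed
    with cn have "int p dvd c i" if "i \<le> n" for i using that by (cases "i = n") auto
    with c(1) show False by blast
  qed
  then obtain u v :: int where "of_int u * of_nat p + of_int v * of_int (c n) = (1::complex)"
    using prime_bezout_complex[OF prime_p] by blast
  then have "x = (of_int u * of_nat p + of_int v * of_int (c n)) * x" by simp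
  also have "\<dots> = - (of_int v * - (of_int (c n) * x)) + of_nat p * (of_int u * x)"
    by (simp add: algebra_simps)
  also have "- (of_int v * - (of_int (c n) * x)) = (\<Sum>i<n. of_int (- v * c i) * e i)"
    unfolding rel[symmetric] by (simp add: sum_distrib_left sum_negf mult.assoc)
  finally show ?thesis using assms by (intro exI[of _ "\<lambda>i. - v * c i"] bexI[of _ "of_int u * x"]) (auto intro: mult_mem)
qed

text \<open>Reduction modulo \<open>P j\<close> isolates the coefficient of \<open>e j\<close> in
  the expansion from \<open>span_e\<close>, so all coefficients are divisible by p.\<close>

lemma Inter_P:
  assumes x: "x \<in> R" "\<And>i. i < n \<Longrightarrow> x \<in> P i"
  shows "\<exists>r\<in>R. x = of_nat p * r"
proof -
  obtain d r where d: "r \<in> R" "x = (\<Sum>i<n. of_int (d i) * e i) + of_nat p * r"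
    using span_e[OF x(1)] by blast
  have "int p dvd d i" if "i < n" for i
  proof (rule sum_e_mem[OF that])
    interpret I: complex_prime_ideal R "P i" by (rule P_ideal[OF that])
    have "x - of_nat p * r \<in> P i"
      using x that d(1) p_mem by (intro I.P_diff I.P_mult_right) auto
    then show "(\<Sum>i<n. of_int (d i) * e i) \<in> P i" using d(2) by simp
  qed
  then have "\<forall>i. \<exists>k. i < n \<longrightarrow> d i = int p * k" by (auto elim: dvdE)
  then obtain k where k: "\<And>i. i < n \<Longrightarrow> d i = int p * k i" by metis
  have "x = of_nat p * ((\<Sum>i<n. of_int (k i) * e i) + r)"
    unfolding d(2) by (simp add: k sum_distrib_left distrib_left mult.assoc)
  moreover have "(\<Sum>i<n. of_int (k i) * e i) + r \<in> R"
    using d(1) e by (intro add_mem sum_mem mult_mem) auto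
  ultimately show ?thesis by blast
qed

text \<open>The \<open>e i\<close> add up to 1 modulo p, so one of them is a unit of V. The products
  \<open>e i * e j\<close> and \<open>e i * (e i - 1)\<close> lie in all primes, hence in p R; so in
  V the other \<open>e j\<close> are 0 and this \<open>e i\<close> is 1 modulo p, and x reduces to
  its coefficient at \<open>e i\<close>.\<close>

lemma residue_int:
  assumes V: "p_valuation V p" and x: "x \<in> R"
  shows "\<exists>k::int. (x - of_int k) / of_nat p \<in> V"
proof -
  interpret V: p_valuation V p by (rule V)
  have RV: "y \<in> V" if "y \<in> R" for y using V.algebraic_int_mem[OF R_int[OF that]] .
  have div: "y / of_nat p \<in> V" if "y \<in> R" "\<And>i. i < n \<Longrightarrow> y \<in> P i" for y
    using Inter_P[OF that] RV by auto
  have eR: "(\<Sum>i<n. e i) \<in> R" using e by (intro sum_mem) auto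
  have "(\<Sum>i<n. e i) - 1 \<in> P j" if j: "j < n" for j
  proof -
    interpret J: complex_prime_ideal R "P j" by (rule P_ideal[OF j])
    have "(\<Sum>i<n. e i) - 1 = (e j - 1) + (\<Sum>i\<in>{..<n} - {j}. e i)"
      using j by (subst sum.remove[of _ j]) auto
    also have "\<dots> \<in> P j" using e j by (intro J.P_add J.P_sum) auto
    finally show ?thesis .
  qed
  then have s: "((\<Sum>i<n. e i) - 1) / of_nat p \<in> V"
    using eR by (intro div diff_mem) auto
  have "V.vunit ((\<Sum>i<n. e i) + of_nat p * - (((\<Sum>i<n. e i) - 1) / of_nat p))" by simp
  then have "V.vunit (\<Sum>i<n. e i) \<or> V.vunit (of_nat p * - (((\<Sum>i<n. e i) - 1) / of_nat p))"
    by (rule V.vunit_add[OF RV[OF eR] V.mult_mem[OF V.of_nat_mem V.minus_mem[OF s]]])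
  then have "V.vunit (\<Sum>i<n. e i)" using V.not_vunit_p_mult[OF V.minus_mem[OF s]] by blast
  then obtain i where i: "i < n" "V.vunit (e i)"
    using V.vunit_sum[of "{..<n}" e] e RV by auto
  have other: "e j / of_nat p \<in> V" if j: "j < n" "j \<noteq> i" for j
  proof -
    have "e i * e j \<in> P l" if "l < n" for l
    proof -
      interpret L: complex_prime_ideal R "P l" by (rule P_ideal[OF that])
      show ?thesis
        using e i j that L.P_mult[of "e i" "e j"] L.P_mult_right[of "e j" "e i"] by (cases "l = i") auto
    qed
    then have "e i * e j / of_nat p \<in> V" using e i j by (intro div mult_mem) auto
    then have "inverse (e i) * (e i * e j / of_nat p) \<in> V"
      using i(2) unfolding V.vunit_def by (intro V.mult_mem) auto
    then show ?thesis using i(2) by (simp add: V.vunit_def field_simps)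
  qed
  have self: "(e i - 1) / of_nat p \<in> V"
  proof -
    have "e i * (e i - 1) \<in> P l" if "l < n" for l
    proof -
      interpret L: complex_prime_ideal R "P l" by (rule P_ideal[OF that])
      show ?thesis
        using e i that L.P_mult[of "e i" "e i - 1"] L.P_mult_right[of "e i - 1" "e i"]
          diff_mem[OF e(1)[OF i(1)] one_mem]
        by (cases "l = i") auto
    qed
    then have "e i * (e i - 1) / of_nat p \<in> V" using e i by (intro div mult_mem diff_mem) auto
    then have "inverse (e i) * (e i * (e i - 1) / of_nat p) \<in> V"
      using i(2) unfolding V.vunit_def by (intro V.mult_mem) auto
    then show ?thesis using i(2) by (simp add: V.vunit_def field_simps)
  qed
  obtain d r where d: "r \<in> R" "x = (\<Sum>i<n. of_int (d i) * e i) + of_nat p * r"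
    using span_e[OF x] by blast
  have "(\<Sum>j<n. of_int (d j) * e j) = of_int (d i) * e i + (\<Sum>j\<in>{..<n} - {i}. of_int (d j) * e j)"
    using i by (subst sum.remove[of _ i]) auto
  then have "x - of_int (d i) = of_int (d i) * (e i - 1) + (\<Sum>j\<in>{..<n} - {i}. of_int (d j) * e j) + of_nat p * r"
    using d(2) by (simp add: algebra_simps)
  then have "(x - of_int (d i)) / of_nat p =
      of_int (d i) * ((e i - 1) / of_nat p) + (\<Sum>j\<in>{..<n} - {i}. of_int (d j) * (e j / of_nat p)) + r"
    by (simp add: add_divide_distrib sum_divide_distrib)
  also have "\<dots> \<in> V" using self other d(1) RV by (intro V.add_mem V.sum_mem V.mult_mem) auto
  finally show ?thesis ..
qed

end

text \<open>For z in K and V, the Horner values provide an integral b that is a unit of V and for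
  which z b is integral; so z has an integer residue k. Then (z - k) / p is again in K, and in V,
  and iterating produces the p-adic digits of z.\<close>

lemma padic_of_residues:
  assumes V: "p_valuation V p"
    and K: "complex_subring K" "\<And>x. x \<in> K \<Longrightarrow> inverse x \<in> K" "\<And>x. x \<in> K \<Longrightarrow> algebraic x"
    and res: "\<And>x. x \<in> K \<Longrightarrow> algebraic_int x \<Longrightarrow> \<exists>k::int. (x - of_int k) / of_nat p \<in> V"
  shows "K \<subseteq> p_valuation.padic V p"
proof -
  interpret V: p_valuation V p by (rule V)
  interpret K: complex_subring K by (rule K(1))
  have res': "\<exists>k::int. (z - of_int k) / of_nat p \<in> V" if z: "z \<in> K" "z \<in> V" for z
  proof -
    have alg: "algebraic z" by (rule K(3)[OF z(1)])
    obtain b j a' where bint: "\<And>i. algebraic_int (b i)" "\<And>i. algebraic_int (z * b (Suc i))"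
      and b0: "b 0 = 0" and a': "\<not> int p dvd a'" "of_int a' = b j - z * b (Suc j)"
      and bK': "\<And>K i. complex_subring K \<Longrightarrow> z \<in> K \<Longrightarrow> b i \<in> K"
      using horner_sequence[OF alg V.prime_p] by metis
    have bK: "b i \<in> K" for i by (rule bK'[OF K(1) z(1)])
    have bV: "b i \<in> V" for i using bint V.algebraic_int_mem by blast
    \<comment> \<open>A combination of two Horner values with coefficients in V is an integer prime
      to p, so some Horner value is a unit.\<close>
    have "V.vunit (b j + - (z * b (Suc j)))" using V.vunit_of_int[OF a'(1)] a'(2) by simp
    then have "V.vunit (b j) \<or> V.vunit (- (z * b (Suc j)))"
      by (rule V.vunit_add[OF bV V.minus_mem[OF V.mult_mem[OF z(2) bV]]])
    then have "\<exists>l. V.vunit (b l)"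
      using V.vunit_multD[of "b (Suc j)" "- z"] bV z(2) V.minus_mem by (auto simp: mult.commute)
    then obtain l where l: "V.vunit (b l)" by blast
    have "l \<noteq> 0" using l b0 by (metis V.vunit_def)
    then obtain m where m: "l = Suc m" using not0_implies_Suc by blast
    define s where "s = b l"
    obtain a :: int where a: "(s - of_int a) / of_nat p \<in> V"
      using res[OF bK bint(1)] unfolding s_def by blast
    obtain k :: int where k: "(z * s - of_int k) / of_nat p \<in> V"
      using res[OF K.mult_mem[OF z(1) bK] bint(2)] unfolding s_def m by blast
    have "\<not> int p dvd a"
    proof
      assume "int p dvd a"
      then have "of_int a / of_nat p \<in> V" by (simp add: V.of_int_div_p_iff)
      then have "(s - of_int a) / of_nat p + of_int a / of_nat p \<in> V" using a by (intro V.add_mem)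
      then have sp: "s / of_nat p \<in> V" by (simp add: diff_divide_distrib)
      have "s = of_nat p * (s / of_nat p)" by simp
      then show False using V.not_vunit_p_mult[OF sp] l unfolding s_def by simp
    qed
    then obtain u v :: int where "of_int u * of_nat p + of_int v * of_int a = (1::complex)"
      using prime_bezout_complex[OF V.prime_p] by blast
    then have "z = z * (of_int u * of_nat p + of_int v * of_int a)" by simp
    then have "(z - of_int (v * k)) / of_nat p =
        (z * (of_int u * of_nat p + of_int v * of_int a) - of_int (v * k)) / of_nat p" by simp
    also have "\<dots> = z * of_int u - of_int v * z * ((s - of_int a) / of_nat p)
        + of_int v * ((z * s - of_int k) / of_nat p)"
      by (simp add: field_simps)
    also have "\<dots> \<in> V" using a k z by (intro V.add_mem V.diff_mem V.mult_mem V.of_int_mem)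
    finally show ?thesis ..
  qed
  have approx: "\<exists>c\<in>\<rat>. (z - c) / of_nat p ^ m \<in> V" if "z \<in> K" "z \<in> V" for z m
    using that
  proof (induction m arbitrary: z)
    case (Suc m)
    obtain k :: int where k: "(z - of_int k) / of_nat p \<in> V" using res' Suc.prems by blast
    have "(z - of_int k) / of_nat p \<in> K"
      unfolding divide_inverse using Suc.prems by (intro K.mult_mem K.diff_mem K.of_int_mem K(2) K.of_nat_mem)
    then obtain c where c: "c \<in> \<rat>" "((z - of_int k) / of_nat p - c) / of_nat p ^ m \<in> V"
      using Suc.IH k by blast
    have "((z - of_int k) / of_nat p - c) / of_nat p ^ m = (z - (of_int k + of_nat p * c)) / of_nat p ^ Suc m"
      by (simp add: field_simps)
    then show ?case using c by (intro bexI[of _ "of_int k + of_nat p * c"]) auto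
  qed (auto intro: bexI[of _ 0])
  show ?thesis
  proof
    fix z assume z: "z \<in> K"
    obtain s where s: "of_nat p ^ s * z \<in> V" using V.algebraic_bounded[OF K(3)[OF z]] by blast
    have "of_nat p ^ s * z \<in> K" by (intro K.mult_mem K.power_mem K.of_nat_mem z)
    then have "of_nat p ^ s * z \<in> V.padic"
      unfolding V.padic_def using approx[OF _ s] by auto
    moreover have "inverse (of_nat p ^ s) \<in> V.padic" by (rule V.Rats_padic) simp
    ultimately have "inverse (of_nat p ^ s) * (of_nat p ^ s * z) \<in> V.padic"
      using V.padic_mult by blast
    then show "z \<in> V.padic" by (simp add: mult.assoc[symmetric])
  qed
qed

section \<open>Bases and integral relations in number fields\<close>

section \<open>Number fields in HOL-Algebra\<close>

lemma C_simps [simp]: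
  "carrier \<C> = UNIV" "x \<otimes>\<^bsub>\<C>\<^esub> y = x * y" "x \<oplus>\<^bsub>\<C>\<^esub> y = x + y"
  "\<one>\<^bsub>\<C>\<^esub> = 1" "\<zero>\<^bsub>\<C>\<^esub> = 0"
  by (simp_all add: ring_of_type_algebra_def)

lemma field_C: "Ring.field \<C>"
  by (rule field_from_type_algebra)

lemma a_inv_C [simp]: "\<ominus>\<^bsub>\<C>\<^esub> x = - x"
proof -
  interpret Ring.field \<C> by (rule field_C)
  show ?thesis using minus_equality[of "- x" x] by simp
qed

lemma m_inv_C: "x \<noteq> 0 \<Longrightarrow> m_inv \<C> x = inverse x"
proof -
  interpret Ring.field \<C> by (rule field_C)
  assume "x \<noteq> 0"
  then show ?thesis using comm_inv_char[of x "inverse x"] by simp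
qed

lemma subfield_C_iff: "subfield K \<C> \<longleftrightarrow> complex_subring K \<and> (\<forall>x\<in>K. inverse x \<in> K)"
proof -
  interpret Ring.field \<C> by (rule field_C)
  show ?thesis
  proof
    assume K: "subfield K \<C>"
    note S = subringE[OF subfieldE(1)[OF K]]
    have "complex_subring K"
    proof
      fix x y assume xy: "x \<in> K" "y \<in> K"
      then have "x \<oplus>\<^bsub>\<C>\<^esub> (\<ominus>\<^bsub>\<C>\<^esub> y) \<in> K" using S(5,7) by blast
      then show "x - y \<in> K" by simp
      show "x * y \<in> K" using S(6)[OF xy] by simp
    qed (use S(3) in simp)
    moreover have "inverse x \<in> K" if "x \<in> K" for x
    proof (cases "x = 0")
      case False
      then have "m_inv \<C> x \<in> K" using subfield_m_inv(1)[OF K, of x] that by simp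
      then show ?thesis using m_inv_C False by simp
    qed (use that in simp)
    ultimately show "complex_subring K \<and> (\<forall>x\<in>K. inverse x \<in> K)" by blast
  next
    assume K: "complex_subring K \<and> (\<forall>x\<in>K. inverse x \<in> K)"
    then interpret K: complex_subring K by blast
    have "subring K \<C>"
      by (rule subringI) (auto simp: K.minus_mem K.mult_mem K.add_mem)
    then show "subfield K \<C>"
      by (rule subfieldI') (use K m_inv_C in auto)
  qed
qed

lemma Rats_subfield: "subfield \<rat> \<C>"
  by (simp add: subfield_C_iff complex_subring_def)

lemma complex_subring_Rats_subset:
  assumes "complex_subring K" "\<And>x. x \<in> K \<Longrightarrow> inverse x \<in> K"
  shows "\<rat> \<subseteq> K"
proof
  interpret complex_subring K by (rule assms(1))
  fix x :: complex assume "x \<in> \<rat>"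
  then show "x \<in> K"
    by (elim Rats_cases') (auto simp: divide_inverse intro!: mult_mem assms(2))
qed

lemma simple_ext_subset:
  assumes "complex_subring K" "\<And>x. x \<in> K \<Longrightarrow> inverse x \<in> K" "\<alpha> \<in> K"
  shows "simple_ext \<alpha> \<subseteq> K"
proof
  fix x assume "x \<in> simple_ext \<alpha>"
  then obtain q where "ratp q" "x = poly q \<alpha>" by (rule simple_extE)
  then show "x \<in> K"
    using complex_subring_Rats_subset[OF assms(1,2)] complex_subring.poly_mem[OF assms(1) _ assms(3), of q]
    by (auto simp: ratp_def)
qed

lemma combine_C:
  "ring.combine \<C> Ks Us = (\<Sum>i<min (length Ks) (length Us). Ks ! i * Us ! i)"
proof -
  interpret Ring.field \<C> by (rule field_C)
  show ?thesis
  proof (induction Ks arbitrary: Us)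
    case (Cons k Ks)
    then show ?case by (cases Us) (auto simp del: sum.lessThan_Suc simp: sum.lessThan_Suc_shift)
  qed simp
qed

lemma ratp_reduce:
  assumes alg: "algebraic \<alpha>" and q: "ratp q"
  shows "\<exists>r. ratp r \<and> degree r < degree (min_poly_int \<alpha>) \<and> poly r \<alpha> = poly q \<alpha>"
  using q
proof (induction "degree q" arbitrary: q rule: less_induct)
  case less
  let ?m = "cpoly (min_poly_int \<alpha>)" and ?d = "degree (min_poly_int \<alpha>)"
  show ?case
  proof (cases "degree q < ?d")
    case False
    define c where "c = lead_coeff q / lead_coeff ?m"
    define b where "b = monom c (degree q - ?d) * ?m"
    have m0: "?m \<noteq> 0" using min_poly_int_nz[OF alg] by simp
    have "?d > 0" by (rule degree_min_poly_int[OF alg])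
    then have q0: "q \<noteq> 0" "degree q > 0" using False by auto
    have "c \<in> \<rat>" unfolding c_def using less.prems by (auto simp: ratp_def)
    then have rb: "ratp b" unfolding b_def by (intro ratp_mult) (auto simp: ratp_def)
    have "c \<noteq> 0" unfolding c_def using q0 m0 by auto
    then have db: "degree b = degree q"
      unfolding b_def using m0 False by (simp add: degree_mult_eq degree_monom_eq monom_eq_0_iff)
    have "coeff b (degree q) = c * lead_coeff ?m"
      unfolding b_def using False by (simp add: coeff_monom_mult)
    also have "\<dots> = lead_coeff q" unfolding c_def using m0 by simp
    finally have lb: "coeff (q - b) (degree q) = 0" by simp
    have "degree (q - b) \<le> degree q" using db by (metis degree_diff_le order_refl)
    moreover have "degree (q - b) \<noteq> degree q"
    proof
      assume "degree (q - b) = degree q"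
      then have "q - b = 0" using lb by (metis leading_coeff_0_iff)
      then show False using \<open>degree (q - b) = degree q\<close> q0 by simp
    qed
    ultimately have "degree (q - b) < degree q" by simp
    then obtain r where "ratp r" "degree r < ?d" "poly r \<alpha> = poly (q - b) \<alpha>"
      using less.hyps ratp_diff[OF less.prems rb] by blast
    then show ?thesis using poly_min_poly_int[OF alg] by (auto simp: b_def)
  qed (use less.prems in auto)
qed

text \<open>The powers of \<alpha> below the degree form a basis: a relation between them is, up to
  denominators, a multiple of the minimal polynomial of too small degree.\<close>

lemma dimension_simple_ext:
  assumes alg: "algebraic \<alpha>"
  shows "ring.dimension \<C> (card (conjugates \<alpha>)) \<rat> (simple_ext \<alpha>)"
proof -
  interpret C: Ring.field \<C> by (rule field_C)
  define d where "d = degree (min_poly_int \<alpha>)"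
  define Us where "Us = map (\<lambda>i. \<alpha> ^ i) [0..<d]"
  have comb: "C.combine Ks Us = poly (\<Sum>i<min (length Ks) d. monom (Ks ! i) i) \<alpha>" for Ks
    unfolding combine_C Us_def by (simp add: poly_sum poly_monom)
  have ratsum: "ratp (\<Sum>i<min (length Ks) d. monom (Ks ! i) i)" if "set Ks \<subseteq> \<rat>" for Ks
    unfolding ratp_def using that by (auto simp: coeff_sum intro!: Rats_sum)
  have ind: "C.independent \<rat> Us"
  proof (rule C.trivial_combine_imp_independent[OF Rats_subfield])
    fix Ks assume Ks: "set Ks \<subseteq> \<rat>" "C.combine Ks Us = \<zero>\<^bsub>\<C>\<^esub>"
    define q where "q = (\<Sum>i<min (length Ks) d. monom (Ks ! i) i)"
    have q: "ratp q" "poly q \<alpha> = 0" using ratsum[OF Ks(1)] Ks(2) unfolding comb by (simp_all add: q_def)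
    have cq: "coeff q i = (if i < min (length Ks) d then Ks ! i else 0)" for i
      unfolding q_def by (simp add: coeff_sum)
    obtain N g where g: "N > (0::int)" "smult (of_int N) q = cpoly g"
      using ratp_clear_denominators[OF q(1)] by blast
    have "poly (cpoly g) \<alpha> = 0" using q(2) by (simp flip: g(2))
    then have dv: "min_poly_int \<alpha> dvd g" by (rule min_poly_int_dvd[OF alg])
    have cg: "coeff g i = 0" if "i \<ge> d" for i
    proof -
      have "of_int (coeff g i) = coeff (smult (of_int N) q) i" unfolding g(2) by simp
      then have "of_int (coeff g i) = (0::complex)" using that by (simp add: cq)
      then show ?thesis by simp
    qed
    have "g = 0"
    proof (rule ccontr)
      assume "g \<noteq> 0"
      then have "d \<le> degree g" unfolding d_def using dv by (intro dvd_imp_degree_le) auto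
      then show False using cg[of "degree g"] \<open>g \<noteq> 0\<close> by simp
    qed
    then have "q = 0" using g by simp
    then have "Ks ! i = 0" if "i < min (length Ks) d" for i using cq[of i] that by simp
    then show "set (take (length Us) Ks) \<subseteq> {\<zero>\<^bsub>\<C>\<^esub>}"
      by (auto simp: in_set_conv_nth Us_def)
  qed simp
  have "C.Span \<rat> Us = simple_ext \<alpha>"
  proof
    show "C.Span \<rat> Us \<subseteq> simple_ext \<alpha>"
      using C.Span_eq_combine_set[OF Rats_subfield, of Us] ratsum
      by (auto simp: comb intro!: poly_mem_simple_ext)
    show "simple_ext \<alpha> \<subseteq> C.Span \<rat> Us"
    proof
      fix x assume "x \<in> simple_ext \<alpha>"
      then obtain q where q: "ratp q" "x = poly q \<alpha>" by (rule simple_extE)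
      obtain r where r: "ratp r" "degree r < d" "poly r \<alpha> = x"
        using ratp_reduce[OF alg q(1)] q(2) unfolding d_def by auto
      define Ks where "Ks = map (coeff r) [0..<d]"
      have "poly r \<alpha> = (\<Sum>i<d. coeff r i * \<alpha> ^ i)"
        unfolding poly_altdef using r(2) by (intro sum.mono_neutral_left) (auto simp: coeff_eq_0)
      also have "\<dots> = C.combine Ks Us"
        unfolding combine_C by (simp add: Ks_def Us_def)
      finally have "x = C.combine Ks Us" using r(3) by simp
      moreover have "set Ks \<subseteq> \<rat>" using r(1) by (auto simp: Ks_def ratp_def)
      ultimately show "x \<in> C.Span \<rat> Us" using C.Span_eq_combine_set[OF Rats_subfield, of Us] by auto
    qed
  qed
  moreover have "length Us = card (conjugates \<alpha>)" by (simp add: Us_def d_def card_conjugates[OF alg])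
  ultimately show ?thesis using C.dimensionI[OF Rats_subfield ind] by simp
qed

lemma dim_simple_ext:
  assumes "algebraic \<alpha>"
  shows "ring.dim \<C> \<rat> (simple_ext \<alpha>) = card (conjugates \<alpha>)"
proof -
  interpret C: Ring.field \<C> by (rule field_C)
  show ?thesis using C.dimI[OF Rats_subfield dimension_simple_ext[OF assms]] by (simp add: over_def)
qed

lemma number_field_simple_ext:
  assumes "algebraic \<alpha>"
  shows "number_field (simple_ext \<alpha>)"
proof -
  interpret C: Ring.field \<C> by (rule field_C)
  show ?thesis
    unfolding number_field_def subfield_C_iff
    using complex_subring_simple_ext inverse_mem_simple_ext[OF assms]
      C.finite_dimensionI[OF dimension_simple_ext[OF assms]] by auto
qed

lemma number_field_relation:
  assumes K: "number_field K" and x: "\<And>i. i \<le> ring.dim \<C> \<rat> K \<Longrightarrow> x i \<in> K"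
  shows "\<exists>c. (\<forall>i. c i \<in> \<rat>) \<and> (\<exists>i\<le>ring.dim \<C> \<rat> K. c i \<noteq> 0) \<and> (\<Sum>i\<le>ring.dim \<C> \<rat> K. c i * x i) = 0"
proof -
  interpret C: Ring.field \<C> by (rule field_C)
  define n where "n = ring.dim \<C> \<rat> K"
  define Us where "Us = map x [0..<Suc n]"
  have dim: "C.dimension n \<rat> K"
    using C.finite_dimensionE[OF Rats_subfield] K unfolding number_field_def n_def over_def by auto
  have "C.dependent \<rat> Us"
  proof
    assume "C.independent \<rat> Us"
    then have "length Us \<le> n"
      using x unfolding n_def[symmetric]
      by (intro C.independent_length_le_dimension[OF Rats_subfield dim]) (auto simp: Us_def)
    then show False by (simp add: Us_def)
  qed
  then obtain Ks where Ks: "length Ks = length Us" "C.combine Ks Us = 0" "set Ks \<subseteq> \<rat>" "set Ks \<noteq> {0}"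
    using C.dependent_imp_non_trivial_combine[OF Rats_subfield, of Us] by auto
  define c where "c = (\<lambda>i. if i \<le> n then Ks ! i else 0)"
  have len: "length Ks = Suc n" using Ks(1) by (simp add: Us_def)
  have "c i \<in> \<rat>" for i using Ks(3) len by (auto simp: c_def)
  moreover have "\<exists>i\<le>n. c i \<noteq> 0"
  proof (rule ccontr)
    assume "\<not> ?thesis"
    then have "set Ks \<subseteq> {0}" using len by (auto simp: c_def in_set_conv_nth)
    moreover have "set Ks \<noteq> {}" using len by auto
    ultimately show False using Ks(4) by (auto dest: subset_singletonD)
  qed
  moreover have "(\<Sum>i\<le>n. c i * x i) = 0"
  proof -
    have "(\<Sum>i\<le>n. c i * x i) = (\<Sum>i<Suc n. Ks ! i * Us ! i)"
      unfolding lessThan_Suc_atMost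
      by (intro sum.cong) (auto simp: c_def Us_def nth_append less_Suc_eq_le simp del: upt_Suc)
    also have "\<dots> = 0" using Ks(2) len unfolding combine_C by (simp add: Us_def)
    finally show ?thesis .
  qed
  ultimately show ?thesis unfolding n_def by blast
qed

text \<open>Writing the coefficients as a polynomial makes content and primitive part available for
  them.\<close>

lemma number_field_int_relation:
  assumes "number_field K" "\<And>i. i \<le> ring.dim \<C> \<rat> K \<Longrightarrow> x i \<in> K"
  obtains g :: "int poly" where "g \<noteq> 0" "degree g \<le> ring.dim \<C> \<rat> K"
    "(\<Sum>i\<le>ring.dim \<C> \<rat> K. of_int (coeff g i) * x i) = 0"
proof -
  define n where "n = ring.dim \<C> \<rat> K"
  obtain c where c: "\<forall>i. c i \<in> \<rat>" "\<exists>i\<le>n. c i \<noteq> 0" "(\<Sum>i\<le>n. c i * x i) = 0"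
    using number_field_relation[of K x, OF assms] unfolding n_def by metis
  define q where "q = (\<Sum>i\<le>n. monom (c i) i)"
  have cq: "coeff q i = (if i \<le> n then c i else 0)" for i
    unfolding q_def by (simp add: coeff_sum)
  have "ratp q" unfolding ratp_def using c(1) cq by simp
  then obtain N g where g: "N > (0::int)" "smult (of_int N) q = cpoly g"
    using ratp_clear_denominators by blast
  have gq: "of_int (coeff g i) = of_int N * coeff q i" for i
    by (metis coeff_cpoly coeff_smult g(2))
  show ?thesis
  proof (rule that[of g]; (fold n_def)?)
    have "q \<noteq> 0" using c(2) cq by (metis coeff_0)
    then show "g \<noteq> 0" using g by auto
    show "degree g \<le> n"
      by (rule degree_le) (metis cq gq leD mult_zero_right of_int_eq_0_iff)
    have "(\<Sum>i\<le>n. of_int (coeff g i) * x i) = of_int N * (\<Sum>i\<le>n. c i * x i)"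
      by (simp add: gq cq sum_distrib_left mult.assoc)
    then show "(\<Sum>i\<le>n. of_int (coeff g i) * x i) = 0" using c(3) by simp
  qed
qed

lemma number_field_algebraic:
  assumes K: "number_field K" and x: "x \<in> K"
  shows "algebraic x"
proof -
  have "complex_subring K" using K by (simp add: number_field_def subfield_C_iff)
  then have "x ^ i \<in> K" for i using complex_subring.power_mem x by blast
  then obtain g where g: "g \<noteq> 0" "degree g \<le> ring.dim \<C> \<rat> K"
    "(\<Sum>i\<le>ring.dim \<C> \<rat> K. of_int (coeff g i) * x ^ i) = 0"
    using number_field_int_relation[OF K, of "\<lambda>i. x ^ i"] by metis
  have "poly (cpoly g) x = (\<Sum>i\<le>ring.dim \<C> \<rat> K. of_int (coeff g i) * x ^ i)"
    unfolding poly_altdef using g(2) by (intro sum.mono_neutral_cong_left) (auto simp: coeff_eq_0)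
  then show ?thesis using g by (intro algebraicI[of "cpoly g"]) auto
qed

theorem number_field_primitive_element:
  assumes K: "number_field K"
  obtains \<alpha> where "algebraic \<alpha>" "K = simple_ext \<alpha>"
proof -
  interpret C: Ring.field \<C> by (rule field_C)
  have sub: "complex_subring K" "\<And>x. x \<in> K \<Longrightarrow> inverse x \<in> K"
    using K by (auto simp: number_field_def subfield_C_iff)
  obtain n where "C.dimension n \<rat> K"
    using K unfolding number_field_def C.finite_dimension_def by blast
  then obtain us where us: "C.Span \<rat> us = K" using C.exists_base[OF Rats_subfield] by blast
  have usK: "set us \<subseteq> K" using C.Span_base_incl[OF Rats_subfield, of us] us by simp
  obtain \<gamma> where g: "algebraic \<gamma>" "set us \<subseteq> simple_ext \<gamma>" "\<gamma> \<in> K"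
    using primitive_element_list[of us] usK number_field_algebraic[OF K] sub(1) by blast
  interpret E: complex_subring "simple_ext \<gamma>" by (rule complex_subring_simple_ext)
  have "K \<subseteq> simple_ext \<gamma>"
  proof
    fix x assume "x \<in> K"
    then obtain Ks where Ks: "x = C.combine Ks us" "set Ks \<subseteq> \<rat>"
      using C.Span_eq_combine_set[OF Rats_subfield, of us] us by auto
    then have "Ks ! i \<in> simple_ext \<gamma>" if "i < length Ks" for i
      using that Rats_simple_ext by (meson nth_mem subsetD)
    moreover have "us ! i \<in> simple_ext \<gamma>" if "i < length us" for i using g(2) that by auto
    ultimately show "x \<in> simple_ext \<gamma>"
      unfolding Ks(1) combine_C by (intro E.sum_mem E.mult_mem) auto
  qed
  with simple_ext_subset[OF sub g(3)] g(1) that show ?thesis by blast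
qed

section \<open>Total splitting by ideals against the local condition\<close>

subsection \<open>Ideals of the ring of integers\<close>

abbreviation OK :: "complex set \<Rightarrow> complex set" where
  "OK K \<equiv> {x \<in> K. algebraic_int x}"

lemma O_simps [simp]:
  "carrier (\<O> K) = OK K" "x \<otimes>\<^bsub>\<O> K\<^esub> y = x * y" "x \<oplus>\<^bsub>\<O> K\<^esub> y = x + y"
  "\<one>\<^bsub>\<O> K\<^esub> = 1" "\<zero>\<^bsub>\<O> K\<^esub> = 0"
  by (simp_all add: ring_of_integers_def ring_of_type_algebra_def)

lemma complex_subring_OK: "complex_subring K \<Longrightarrow> complex_subring (OK K)"
  by (auto simp: complex_subring_def algebraic_int_diff algebraic_int_mult)

lemma cring_O:
  assumes "complex_subring K"
  shows "cring (\<O> K)"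
proof -
  interpret complex_subring "OK K" by (rule complex_subring_OK[OF assms])
  interpret C: Ring.field \<C> by (rule field_C)
  have "subring (OK K) \<C>"
    by (rule C.subringI) (use minus_mem mult_mem add_mem one_mem in auto)
  then show ?thesis
    unfolding ring_of_integers_def
    by (intro C.subcring_iff[THEN iffD1] C.subcringI') simp_all
qed

lemma primeideal_imp_complex_prime_ideal:
  assumes K: "complex_subring K" and P: "primeideal P (\<O> K)"
  shows "complex_prime_ideal (OK K) P"
proof -
  interpret P: primeideal P "\<O> K" by (rule P)
  interpret R: complex_subring "OK K" by (rule complex_subring_OK[OF K])
  show ?thesis
  proof
    show "P \<subseteq> OK K" using P.a_subset by simp
    show "x + y \<in> P" if "x \<in> P" "y \<in> P" for x y using additive_subgroup.a_closed[OF P.is_additive_subgroup that] by simp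
    show "r * x \<in> P" if "r \<in> OK K" "x \<in> P" for r x using P.I_l_closed[of x r] that by simp
    show "1 \<notin> P" using P.one_imp_carrier P.I_notcarr by auto
    show "0 \<in> P" using additive_subgroup.zero_closed[OF P.is_additive_subgroup] by simp
    show "x \<in> P \<or> y \<in> P" if "x \<in> OK K" "y \<in> OK K" "x * y \<in> P" for x y
      using P.I_prime[of x y] that by simp
  qed
qed

lemma complex_prime_ideal_imp_primeideal:
  assumes K: "complex_subring K" and P: "complex_prime_ideal (OK K) P"
  shows "primeideal P (\<O> K)"
proof -
  interpret P: complex_prime_ideal "OK K" P by (rule P)
  interpret R: cring "\<O> K" by (rule cring_O[OF K])
  have minv: "a_inv (\<O> K) x = - x" if "x \<in> OK K" for x
    using R.minus_equality[of "- x" x] that P.minus_mem[OF that] by simp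
  have "subgroup P (add_monoid (\<O> K))"
  proof (rule R.add.subgroupI)
    show "P \<subseteq> carrier (\<O> K)" using P.P_sub by simp
    show "P \<noteq> {}" using P.P_nonempty by blast
    show "\<ominus>\<^bsub>\<O> K\<^esub> a \<in> P" if "a \<in> P" for a
    proof -
      have "a \<in> OK K" using P.P_sub that by blast
      then show ?thesis using minv P.P_minus[OF that] by simp
    qed
    show "a \<oplus>\<^bsub>\<O> K\<^esub> b \<in> P" if "a \<in> P" "b \<in> P" for a b using P.P_add[OF that] by simp
  qed
  then have "ideal P (\<O> K)"
    by (rule idealI[OF R.ring_axioms]) (use P.P_mult P.P_mult_right in auto)
  then show ?thesis
  proof (rule primeidealI[OF _ R.is_cring])
    show "carrier (\<O> K) \<noteq> P" using P.P_one P.one_mem by (metis O_simps(1))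
  next
    fix a b assume "a \<in> carrier (\<O> K)" "b \<in> carrier (\<O> K)" "a \<otimes>\<^bsub>\<O> K\<^esub> b \<in> P"
    then show "a \<in> P \<or> b \<in> P" using P.P_prime[of a b] by simp
  qed
qed

text \<open>Dividing an integral relation by its content leaves one that is nontrivial modulo
  p.\<close>

lemma split_prime_number_field:
  assumes K: "number_field K" and p: "prime p"
    and P: "\<And>i. i < ring.dim \<C> \<rat> K \<Longrightarrow> complex_prime_ideal (OK K) (P i)"
    "\<And>i. i < ring.dim \<C> \<rat> K \<Longrightarrow> of_nat p \<in> P i" "inj_on P {..<ring.dim \<C> \<rat> K}"
  shows "split_prime (OK K) p (ring.dim \<C> \<rat> K) P"
proof -
  define n where "n = ring.dim \<C> \<rat> K"
  have sub: "complex_subring K" using K by (simp add: number_field_def subfield_C_iff)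
  show ?thesis
    unfolding n_def[symmetric]
  proof (intro split_prime.intro complex_subring_OK[OF sub] split_prime_axioms.intro)
    fix y :: "nat \<Rightarrow> complex" assume y: "\<And>i. i \<le> n \<Longrightarrow> y i \<in> OK K"
    obtain g where g: "g \<noteq> 0" "degree g \<le> n" "(\<Sum>i\<le>n. of_int (coeff g i) * y i) = 0"
      using number_field_int_relation[OF K, of y] y unfolding n_def by blast
    define h where "h = primitive_part g"
    have gh: "coeff g i = content g * coeff h i" for i
      unfolding h_def by (metis coeff_smult content_times_primitive_part)
    have "\<not> [:int p:] dvd h"
      using g(1) prime_gt_1_nat[OF p] unfolding const_poly_dvd_iff_dvd_content h_def by (simp add: content_primitive_part)
    then obtain i where i: "\<not> int p dvd coeff h i" by (auto simp: const_poly_dvd_iff)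
    then have "i \<le> degree h" by (intro le_degree) auto
    then have "i \<le> n" using g(2) by (simp add: h_def)
    moreover have "of_int (content g) * (\<Sum>i\<le>n. of_int (coeff h i) * y i) = 0"
      using g(3) by (simp add: gh sum_distrib_left mult.assoc)
    then have "(\<Sum>i\<le>n. of_int (coeff h i) * y i) = 0" using g(1) by simp
    ultimately show "\<exists>c::nat \<Rightarrow> int. (\<exists>i\<le>n. \<not> int p dvd c i) \<and> (\<Sum>i\<le>n. of_int (c i) * y i) = 0"
      using i by blast
  qed (use p P in \<open>auto simp: n_def\<close>)
qed

lemma splits_totally_nf_imp_padic:
  assumes K: "number_field K" and p: "prime p" and spl: "splits_totally_nf p K"
    and V: "p_valuation V p"
  shows "K \<subseteq> p_valuation.padic V p"
proof -
  define n where "n = ring.dim \<C> \<rat> K"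
  have sub: "complex_subring K" "\<And>x. x \<in> K \<Longrightarrow> inverse x \<in> K"
    using K by (auto simp: number_field_def subfield_C_iff)
  interpret O: cring "\<O> K" by (rule cring_O[OF sub(1)])
  obtain Ps where Ps: "distinct Ps" "length Ps = n" "\<And>P. P \<in> set Ps \<Longrightarrow> primeideal P (\<O> K)"
    "PIdl\<^bsub>\<O> K\<^esub> (of_nat p) = foldr (ideal_prod (\<O> K)) Ps (carrier (\<O> K))"
    using spl unfolding splits_totally_nf_def n_def by blast
  \<comment> \<open>A product of ideals lies in each of its factors, so all the given primes contain
    p.\<close>
  have sub_fold: "ideal (foldr (ideal_prod (\<O> K)) Qs (carrier (\<O> K))) (\<O> K) \<and>
      (\<forall>Q\<in>set Qs. foldr (ideal_prod (\<O> K)) Qs (carrier (\<O> K)) \<subseteq> Q)"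
    if "\<And>P. P \<in> set Qs \<Longrightarrow> primeideal P (\<O> K)" for Qs
    using that
  proof (induction Qs)
    case Nil
    then show ?case using O.oneideal by simp
  next
    case (Cons Q Qs)
    then have Q: "ideal Q (\<O> K)" using primeideal.axioms(1) by auto
    have IH: "ideal (foldr (ideal_prod (\<O> K)) Qs (carrier (\<O> K))) (\<O> K)"
      "\<And>P. P \<in> set Qs \<Longrightarrow> foldr (ideal_prod (\<O> K)) Qs (carrier (\<O> K)) \<subseteq> P"
      using Cons by auto
    have "foldr (ideal_prod (\<O> K)) (Q # Qs) (carrier (\<O> K)) \<subseteq>
        Q \<inter> foldr (ideal_prod (\<O> K)) Qs (carrier (\<O> K))"
      using O.ideal_prod_inter[OF Q IH(1)] by simp
    then show ?case
      using O.ideal_prod_is_ideal[OF Q IH(1)] IH(2) by auto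
  qed
  have "of_nat p \<in> PIdl\<^bsub>\<O> K\<^esub> (of_nat p)"
    unfolding cgenideal_def using complex_subring.one_mem[OF sub(1)] by force
  then have pP: "of_nat p \<in> P" if "P \<in> set Ps" for P
    using sub_fold[of Ps] Ps(3,4) that by blast
  have "split_prime (OK K) p n ((!) Ps)"
    unfolding n_def
  proof (rule split_prime_number_field[OF K p]; (fold n_def)?)
    show "complex_prime_ideal (OK K) (Ps ! i)" if "i < n" for i
      using Ps that by (intro primeideal_imp_complex_prime_ideal sub) auto
    show "of_nat p \<in> Ps ! i" if "i < n" for i using Ps(2) that by (intro pP) auto
    show "inj_on ((!) Ps) {..<n}" using Ps(1,2) by (simp add: inj_on_nth)
  qed
  then interpret S: split_prime "OK K" p n "(!) Ps" .
  show ?thesis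
    by (rule padic_of_residues[OF V sub number_field_algebraic[OF K]]) (auto intro: S.residue_int[OF V])
qed

lemma (in split_prime) Inter_P_eq:
  "{x \<in> R. \<forall>i<n. x \<in> P i} = {r * of_nat p | r. r \<in> R}"
proof (intro equalityI subsetI)
  fix x assume "x \<in> {x \<in> R. \<forall>i<n. x \<in> P i}"
  then show "x \<in> {r * of_nat p | r. r \<in> R}" using Inter_P[of x] by (auto simp: mult.commute)
next
  fix x assume "x \<in> {r * of_nat p | r. r \<in> R}"
  then obtain r where r: "r \<in> R" "x = r * of_nat p" by auto
  then show "x \<in> {x \<in> R. \<forall>i<n. x \<in> P i}"
    using p_mem complex_prime_ideal.P_mult[OF P_ideal] by (auto intro: mult_mem)
qed

text \<open>Comaximality turns products into intersections: with b in all the later primes and 1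
  modulo \<open>P i\<close>, an x in the intersection is (1 - b) x + x b.\<close>

lemma foldr_ideal_prod:
  assumes K: "complex_subring K" and S: "split_prime (OK K) p n P"
    and js: "distinct js" "set js \<subseteq> {..<n}"
  shows "foldr (ideal_prod (\<O> K)) (map P js) (carrier (\<O> K)) = {x \<in> OK K. \<forall>j\<in>set js. x \<in> P j}"
  using js
proof (induction js)
  case (Cons i js)
  interpret S: split_prime "OK K" p n P by (rule S)
  interpret O: cring "\<O> K" by (rule cring_O[OF K])
  define J where "J = {x \<in> OK K. \<forall>j\<in>set js. x \<in> P j}"
  have IH: "foldr (ideal_prod (\<O> K)) (map P js) (carrier (\<O> K)) = J"
    using Cons by (simp add: J_def)
  have i: "i < n" "i \<notin> set js" "set js \<subseteq> {..<n}" using Cons.prems by auto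
  interpret I: complex_prime_ideal "OK K" "P i" by (rule S.P_ideal[OF i(1)])
  have Jadd: "x + y \<in> J" if "x \<in> J" "y \<in> J" for x y
    using that i(3) complex_prime_ideal.P_add[OF S.P_ideal] S.add_mem unfolding J_def by blast
  have Jmult: "r * x \<in> J" if "r \<in> OK K" "x \<in> J" for r x
    using that i(3) complex_prime_ideal.P_mult[OF S.P_ideal] S.mult_mem unfolding J_def by blast
  have "ideal_prod (\<O> K) (P i) J = P i \<inter> J"
  proof (intro equalityI subsetI)
    fix x assume "x \<in> ideal_prod (\<O> K) (P i) J"
    then show "x \<in> P i \<inter> J"
    proof induction
      case (prod a b)
      have "b \<in> OK K" using prod(2) by (simp add: J_def)
      moreover have "a \<in> OK K" using prod(1) I.P_sub by blast
      ultimately show ?case using I.P_mult_right Jmult prod by simp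
    next
      case (sum a b)
      then show ?case using I.P_add Jadd by simp
    qed
  next
    fix x assume x: "x \<in> P i \<inter> J"
    obtain b where b: "b \<in> OK K" "b - 1 \<in> P i" "\<And>j. j \<in> set js \<Longrightarrow> b \<in> P j"
      using S.separating_set[OF i(1,3,2)] by blast
    have bJ: "b \<in> J" using b by (simp add: J_def)
    have b': "1 - b \<in> P i" using I.P_minus[OF b(2)] by simp
    have "(1 - b) \<otimes>\<^bsub>\<O> K\<^esub> x \<oplus>\<^bsub>\<O> K\<^esub> x \<otimes>\<^bsub>\<O> K\<^esub> b \<in> ideal_prod (\<O> K) (P i) J"
      using x bJ b' by (intro ideal_prod.sum ideal_prod.prod) auto
    then show "x \<in> ideal_prod (\<O> K) (P i) J" by (simp add: algebra_simps)
  qed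
  then have "foldr (ideal_prod (\<O> K)) (map P (i # js)) (carrier (\<O> K)) = P i \<inter> J"
    using IH by simp
  also have "\<dots> = {x \<in> OK K. \<forall>j\<in>set (i # js). x \<in> P j}" using I.P_sub by (auto simp: J_def)
  finally show ?case .
qed simp

text \<open>The primes are the pullbacks of one valuation along the \<open>n\<close> embeddings. They are distinct
  because a prime determines the valuation ring of \<open>K\<close> it comes from, and the valuation ring
  determines the \<open>p\<close>-adic limit of the rational approximations of a generator.\<close>

lemma padic_imp_splits_totally_nf:
  assumes K: "number_field K" and p: "prime p"
    and pad: "\<And>V. p_valuation V p \<Longrightarrow> K \<subseteq> p_valuation.padic V p"
  shows "splits_totally_nf p K"
proof -
  define n where "n = ring.dim \<C> \<rat> K"
  have sub: "complex_subring K" "\<And>x. x \<in> K \<Longrightarrow> inverse x \<in> K"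
    using K by (auto simp: number_field_def subfield_C_iff)
  interpret K: complex_subring K by (rule sub(1))
  interpret R: complex_subring "OK K" by (rule complex_subring_OK[OF sub(1)])
  obtain \<alpha> where alg: "algebraic \<alpha>" and K\<alpha>: "K = simple_ext \<alpha>"
    using number_field_primitive_element[OF K] .
  have n: "n = card (conjugates \<alpha>)" unfolding n_def K\<alpha> by (rule dim_simple_ext[OF alg])
  obtain \<beta> where \<beta>: "bij_betw \<beta> {0..<n} (conjugates \<alpha>)"
    unfolding n using ex_bij_betw_nat_finite[OF finite_conjugates[OF alg]] by blast
  have conj: "\<beta> i \<in> conjugates \<alpha>" if "i < n" for i using \<beta> that by (auto dest: bij_betwE)
  obtain V where V: "p_valuation V p" using p_valuation_exists[OF p] .
  interpret V: p_valuation V p by (rule V)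
  define \<sigma> where "\<sigma> = (\<lambda>i. emb \<alpha> (\<beta> i))"
  note emb = emb_diff[OF alg conj] emb_add[OF alg conj] emb_mult[OF alg conj] emb_Rats[OF alg conj]
  have \<sigma>V: "\<sigma> i x \<in> V" if "i < n" "x \<in> OK K" for i x
    unfolding \<sigma>_def using that emb_algebraic_int[OF alg conj] V.algebraic_int_mem by (simp add: K\<alpha>)
  have \<sigma>pad: "\<sigma> i x \<in> V.padic" if i: "i < n" and x: "x \<in> K" for i x
  proof -
    obtain q where q: "ratp q" "x = poly q \<alpha>" using x unfolding K\<alpha> by (rule simple_extE)
    have "\<beta> i \<in> V.padic"
      by (rule padic_conjugate[OF alg conj[OF i] V]) (use pad self_simple_ext K\<alpha> in auto)
    moreover have "complex_subring V.padic"
      by unfold_locales (auto intro: V.Rats_padic V.padic_diff V.padic_mult)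
    ultimately have "poly q (\<beta> i) \<in> V.padic"
      using complex_subring.poly_mem[of V.padic q] q(1) V.Rats_padic by (auto simp: ratp_def)
    then show ?thesis unfolding \<sigma>_def q(2) emb_poly[OF alg conj[OF i] q(1)] .
  qed
  \<comment> \<open>As p is a uniformizer on p-adic elements, this is the preimage of the maximal
    ideal of V.\<close>
  define P where "P = (\<lambda>i. {x \<in> OK K. \<sigma> i x / of_nat p \<in> V})"
  have unit: "V.vunit (\<sigma> i x)" if "i < n" "x \<in> OK K" "x \<notin> P i" for i x
    using V.padic_nonunit[OF \<sigma>pad \<sigma>V] that by (auto simp: P_def)
  have not_unit: "\<not> V.vunit (\<sigma> i x)" if "x \<in> P i" for i x
    using V.not_vunit_p_mult[of "\<sigma> i x / of_nat p"] that by (simp add: P_def)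
  have ideal: "complex_prime_ideal (OK K) (P i)" if i: "i < n" for i
  proof
    show "P i \<subseteq> OK K" by (auto simp: P_def)
    show "x + y \<in> P i" if "x \<in> P i" "y \<in> P i" for x y
      using that R.add_mem[of x y] V.add_mem[of "\<sigma> i x / of_nat p" "\<sigma> i y / of_nat p"]
      by (auto simp: P_def \<sigma>_def emb[OF i] K\<alpha> add_divide_distrib)
    show "r * x \<in> P i" if "r \<in> OK K" "x \<in> P i" for r x
      using that R.mult_mem[of r x] V.mult_mem[OF \<sigma>V[OF i that(1)], of "\<sigma> i x / of_nat p"]
      by (auto simp: P_def \<sigma>_def emb[OF i] K\<alpha>)
    show "1 \<notin> P i" using V.inverse_p by (auto simp: P_def \<sigma>_def emb[OF i] divide_inverse)
    show "0 \<in> P i" by (auto simp: P_def \<sigma>_def emb[OF i])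
    show "x \<in> P i \<or> y \<in> P i" if xy: "x \<in> OK K" "y \<in> OK K" "x * y \<in> P i" for x y
    proof (rule ccontr)
      assume "\<not> (x \<in> P i \<or> y \<in> P i)"
      then have "V.vunit (\<sigma> i x * \<sigma> i y)" using unit[OF i] xy by (intro V.vunit_mult) auto
      moreover have "\<sigma> i (x * y) = \<sigma> i x * \<sigma> i y"
        unfolding \<sigma>_def using emb(3)[OF i] xy by (simp add: K\<alpha>)
      ultimately show False using not_unit[OF xy(3)] by simp
    qed
  qed
  \<comment> \<open>The element z is a quotient z b / b of algebraic integers with b outside
    \<open>P i\<close>, which is also \<open>P j\<close>, so b is a unit under both
    embeddings.\<close>
  have same_ring: "\<sigma> j z \<in> V" if ij: "i < n" "j < n" and Pij: "P i = P j" and z: "z \<in> K" "\<sigma> i z \<in> V" for i j z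
  proof -
    have algz: "algebraic z" by (rule number_field_algebraic[OF K z(1)])
    obtain b k a where bint: "\<And>i. algebraic_int (b i)" "\<And>i. algebraic_int (z * b (Suc i))"
      and b0: "b 0 = 0" and a: "\<not> int p dvd a" "of_int a = b k - z * b (Suc k)"
      and bK': "\<And>K i. complex_subring K \<Longrightarrow> z \<in> K \<Longrightarrow> b i \<in> K"
      using horner_sequence[OF algz p] by metis
    have bK: "b l \<in> K" for l by (rule bK'[OF sub(1) z(1)])
    have bR: "b l \<in> OK K" "z * b (Suc l) \<in> OK K" for l
      using bint bK K.mult_mem[OF z(1) bK] by auto
    from a(2) have "of_int a = \<sigma> i (b k - z * b (Suc k))"
      by (metis emb(4)[OF ij(1)] \<sigma>_def Rats_of_int)
    also have "\<dots> = \<sigma> i (b k) - \<sigma> i z * \<sigma> i (b (Suc k))"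
      unfolding \<sigma>_def using bR bK z K.mult_mem[OF z(1) bK] by (simp add: emb[OF ij(1)] K\<alpha>)
    finally have eq: "of_int a = \<sigma> i (b k) - \<sigma> i z * \<sigma> i (b (Suc k))" .
    have "\<exists>l. b l \<notin> P i"
    proof (rule ccontr)
      assume "\<not> ?thesis"
      then have "\<sigma> i (b l) / of_nat p \<in> V" for l by (auto simp: P_def)
      then have "\<sigma> i (b k) / of_nat p - \<sigma> i z * (\<sigma> i (b (Suc k)) / of_nat p) \<in> V"
        using z(2) by (intro V.diff_mem V.mult_mem)
      then have "of_int a / of_nat p \<in> V" unfolding eq by (simp add: diff_divide_distrib)
      then show False using a(1) by (simp add: V.of_int_div_p_iff)
    qed
    then obtain l where l: "b l \<notin> P i" by blast
    have "l \<noteq> 0" using b0 l complex_prime_ideal.P_nonempty[OF ideal[OF ij(1)]] by metis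
    then obtain m where m: "l = Suc m" using not0_implies_Suc by blast
    have u: "V.vunit (\<sigma> j (b l))" using unit[OF ij(2) bR(1)] l Pij by simp
    have "\<sigma> j z * \<sigma> j (b l) = \<sigma> j (z * b l)"
      unfolding \<sigma>_def using z bK by (simp add: emb[OF ij(2)] K\<alpha>)
    also have "\<dots> \<in> V" using \<sigma>V[OF ij(2) bR(2)] m by simp
    finally have "\<sigma> j z * \<sigma> j (b l) * inverse (\<sigma> j (b l)) \<in> V"
      using u by (auto simp: V.vunit_def intro: V.mult_mem)
    then show ?thesis using u by (simp add: V.vunit_def mult.assoc)
  qed
  have inj: "inj_on P {..<n}"
  proof (rule inj_onI)
    fix i j assume ij: "i \<in> {..<n}" "j \<in> {..<n}" and Pij: "P i = P j"
    then have i: "i < n" and j: "j < n" by auto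
    \<comment> \<open>A rational approximation of \<open>\<beta> i\<close> to precision k says that
      some z in K is integral under the i-th embedding; then it is so under the j-th, and the same
      rational approximates \<open>\<beta> j\<close>.\<close>
    have close: "(\<beta> i - \<beta> j) / of_nat p ^ k \<in> V" for k
    proof -
      have "\<beta> i \<in> V.padic" using \<sigma>pad[OF i, of \<alpha>] by (simp add: K\<alpha> self_simple_ext \<sigma>_def emb_self[OF alg conj[OF i]])
      then obtain c where c: "c \<in> \<rat>" "(\<beta> i - c) / of_nat p ^ k \<in> V" using V.padicD by blast
      define z where "z = (\<alpha> - c) * inverse (of_nat p ^ k)"
      have mem: "c \<in> K" "\<alpha> \<in> K" "inverse (of_nat p ^ k) \<in> K" "\<alpha> - c \<in> K"
        using c(1) self_simple_ext Rats_simple_ext K.diff_mem by (auto simp: K\<alpha>)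
      then have zK: "z \<in> K" unfolding z_def by (intro K.mult_mem)
      have \<sigma>z: "\<sigma> l z = (\<beta> l - c) / of_nat p ^ k" if "l < n" for l
        unfolding \<sigma>_def z_def using mem c(1) by (simp add: emb[OF that] emb_self[OF alg conj[OF that]] K\<alpha> divide_inverse)
      have "\<sigma> j z \<in> V" by (rule same_ring[OF i j Pij zK]) (use c(2) \<sigma>z[OF i] in simp)
      then have "(\<beta> i - c) / of_nat p ^ k - (\<beta> j - c) / of_nat p ^ k \<in> V"
        using c(2) \<sigma>z[OF j] by (intro V.diff_mem) auto
      then show ?thesis by (simp add: diff_divide_distrib)
    qed
    have "\<beta> i = \<beta> j"
    proof (rule ccontr)
      assume ne: "\<beta> i \<noteq> \<beta> j"
      \<comment> \<open>An algebraic number divisible by all powers of p is 0, since its inverse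
        would have a bounded denominator.\<close>
      have "algebraic (inverse (\<beta> i - \<beta> j))"
        by (intro algebraic_inverse algebraic_diff algebraic_conjugate[OF alg] conj i j)
      then obtain s where s: "of_nat p ^ s * inverse (\<beta> i - \<beta> j) \<in> V" using V.algebraic_bounded by blast
      have "(\<beta> i - \<beta> j) / of_nat p ^ Suc s * (of_nat p ^ s * inverse (\<beta> i - \<beta> j)) \<in> V"
        by (intro V.mult_mem close s)
      moreover have "(\<beta> i - \<beta> j) / of_nat p ^ Suc s * (of_nat p ^ s * inverse (\<beta> i - \<beta> j)) = inverse (of_nat p)"
        using ne by (simp add: field_simps)
      ultimately show False using V.inverse_p by simp
    qed
    then show "i = j" using \<beta> i j by (auto simp: bij_betw_def inj_on_def)
  qed
  have pP: "of_nat p \<in> P i" if "i < n" for i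
    by (simp add: P_def \<sigma>_def emb[OF that])
  have S: "split_prime (OK K) p n P"
    unfolding n_def by (rule split_prime_number_field[OF K p]; (fold n_def)?) (use ideal pP inj in auto)
  show ?thesis
    unfolding splits_totally_nf_def
  proof (intro exI[of _ "map P [0..<n]"] conjI ballI)
    show "distinct (map P [0..<n])" using inj by (simp add: distinct_map lessThan_atLeast0)
    show "length (map P [0..<n]) = ring.dim \<C> \<rat> K" by (simp add: n_def)
    show "primeideal Q (\<O> K)" if "Q \<in> set (map P [0..<n])" for Q
      using that complex_prime_ideal_imp_primeideal[OF sub(1) ideal] by auto
    have "foldr (ideal_prod (\<O> K)) (map P [0..<n]) (carrier (\<O> K)) = {x \<in> OK K. \<forall>i<n. x \<in> P i}"
      by (subst foldr_ideal_prod[OF sub(1) S]) auto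
    also have "\<dots> = {r * of_nat p | r. r \<in> OK K}" by (rule split_prime.Inter_P_eq[OF S])
    finally show "PIdl\<^bsub>\<O> K\<^esub> (of_nat p) = foldr (ideal_prod (\<O> K)) (map P [0..<n]) (carrier (\<O> K))"
      by (simp add: cgenideal_def)
  qed
qed

text \<open>The local condition defines a field, which is a candidate itself. Any other candidate L
  contains Q(x) for each of its elements x, and total splitting in this number field makes x
  p-adic.\<close>

theorem max_totally_split_field_eq:
  assumes S: "\<And>p. p \<in> S \<Longrightarrow> prime p"
  shows "max_totally_split_field S = totally_padic S"
  unfolding max_totally_split_field_def
proof (rule Greatest_equality, intro conjI ballI)
  show "subfield (totally_padic S) \<C>"
    unfolding subfield_C_iff using complex_subring_totally_padic totally_padic_inverse by blast
  show "totally_padic S \<subseteq> {x. algebraic x}" by (auto simp: totally_padic_def)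
  show "splits_totally p (totally_padic S)" if "p \<in> S" for p
    unfolding splits_totally_def
    using padic_imp_splits_totally_nf[OF _ S[OF that]] that by (auto simp: totally_padic_def)
next
  fix L assume L: "subfield L \<C> \<and> L \<subseteq> {x. algebraic x} \<and> (\<forall>p\<in>S. splits_totally p L)"
  show "L \<subseteq> totally_padic S"
  proof
    fix x assume x: "x \<in> L"
    then have alg: "algebraic x" using L by blast
    have "simple_ext x \<subseteq> L" by (rule simple_ext_subset) (use L x in \<open>auto simp: subfield_C_iff\<close>)
    then have "splits_totally_nf p (simple_ext x)" if "p \<in> S" for p
      using L that number_field_simple_ext[OF alg] unfolding splits_totally_def by blast
    then have "x \<in> p_valuation.padic V p" if "p \<in> S" "p_valuation V p" for p V
      using splits_totally_nf_imp_padic[OF number_field_simple_ext[OF alg] S] that self_simple_ext by blast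
    with alg show "x \<in> totally_padic S" by (simp add: totally_padic_def)
  qed
qed

section \<open>Resultants: rationality and p-adic size\<close>

section \<open>Values of a polynomial at a full set of conjugates\<close>

abbreviation qpoly :: "rat poly \<Rightarrow> complex poly" where
  "qpoly \<equiv> map_poly of_rat"

lemma coeff_qpoly [simp]: "coeff (qpoly f) i = of_rat (coeff f i)"
  by (simp add: coeff_map_poly)

lemma qpoly_add: "qpoly (f + g) = qpoly f + qpoly g"
  by (rule poly_eqI) (simp add: of_rat_add)

lemma qpoly_mult: "qpoly (f * g) = qpoly f * qpoly g"
  by (rule poly_eqI) (simp add: coeff_mult of_rat_sum of_rat_mult)

lemma degree_qpoly [simp]: "degree (qpoly f) = degree f"
  by (simp add: degree_map_poly)

lemma qpoly_eq_0_iff [simp]: "qpoly f = 0 \<longleftrightarrow> f = 0"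
  by (simp add: poly_eq_iff)

lemma prod_mset_mem_Rats: "(\<And>x. x \<in># A \<Longrightarrow> f x \<in> \<rat>) \<Longrightarrow> (\<Prod>x\<in>#A. f x) \<in> (\<rat> :: complex set)"
  by (induction A) auto

text \<open>Up to sign both sides are the product of lc(F)^deg(G), lc(G)^deg(F) and all differences
  of roots.\<close>

lemma resultant_swap:
  fixes F G :: "complex poly"
  assumes "F \<noteq> 0" "G \<noteq> 0"
  shows "(\<Prod>x\<in>#proots F. poly G x) * lead_coeff F ^ degree G =
    (-1) ^ (degree F * degree G) * lead_coeff G ^ degree F * (\<Prod>y\<in>#proots G. poly F y)"
proof -
  have val: "poly H x = lead_coeff H * (\<Prod>y\<in>#proots H. x - y)" for H :: "complex poly" and x
  proof -
    have "poly H x = poly (smult (lead_coeff H) (\<Prod>y\<in>#proots H. [:-y, 1:])) x"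
      by (simp only: complex_poly_decompose_multiset)
    also have "\<dots> = lead_coeff H * (\<Prod>y\<in>#proots H. x - y)"
      by (simp add: poly_prod_mset image_mset.compositionality o_def)
    finally show ?thesis .
  qed
  have 1: "(\<Prod>x\<in>#proots F. poly G x) = lead_coeff G ^ degree F * (\<Prod>x\<in>#proots F. \<Prod>y\<in>#proots G. x - y)"
    for F G :: "complex poly"
    by (simp add: val[of G] prod_mset.distrib size_proots_complex)
  have "(\<Prod>x\<in>#proots F. \<Prod>y\<in>#proots G. x - y) = (\<Prod>y\<in>#proots G. \<Prod>x\<in>#proots F. x - y)"
    by (rule prod_mset.swap)
  also have "\<dots> = (\<Prod>y\<in>#proots G. (-1) ^ degree F * (\<Prod>x\<in>#proots F. y - x))"
  proof -
    have "(\<Prod>x\<in>#A. x - y) = (-1) ^ size A * (\<Prod>x\<in>#A. y - x)" for A and y :: complex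
      by (induction A) (auto simp: algebra_simps)
    then show ?thesis by (simp add: size_proots_complex)
  qed
  also have "\<dots> = (-1) ^ (degree F * degree G) * (\<Prod>y\<in>#proots G. \<Prod>x\<in>#proots F. y - x)"
    by (simp add: prod_mset.distrib size_proots_complex power_mult)
  finally have 2: "(\<Prod>x\<in>#proots F. \<Prod>y\<in>#proots G. x - y) =
    (-1) ^ (degree F * degree G) * (\<Prod>y\<in>#proots G. \<Prod>x\<in>#proots F. y - x)" .
  show ?thesis unfolding 1[of G F] 1[of F G] 2 by simp
qed

text \<open>A resultant without its power of the leading coefficient. Euclid's algorithm computes
  it: g may be reduced modulo f, and \<open>resultant_swap\<close> exchanges the roles, which lowers
  the degree.\<close>

lemma prod_roots_Rats:
  "f \<noteq> 0 \<Longrightarrow> (\<Prod>x\<in>#proots (qpoly f). poly (qpoly g) x) \<in> \<rat>"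
proof (induction "degree f" arbitrary: f g rule: less_induct)
  case less
  show ?case
  proof (cases "degree f = 0")
    case True
    then obtain c where "f = [:c:]" by (auto elim: degree_eq_zeroE)
    then show ?thesis by (simp add: map_poly_pCons)
  next
    case False
    define h where "h = g mod f"
    have "qpoly g = qpoly (g div f) * qpoly f + qpoly h"
      unfolding h_def by (simp flip: qpoly_add qpoly_mult)
    then have "(\<Prod>x\<in>#proots (qpoly f). poly (qpoly g) x) = (\<Prod>x\<in>#proots (qpoly f). poly (qpoly h) x)"
      using less.prems by (intro arg_cong[where f = prod_mset] image_mset_cong) auto
    also have "\<dots> \<in> \<rat>"
    proof (cases "h = 0")
      case True
      then show ?thesis by (auto intro: prod_mset_mem_Rats)
    next
      case h: False
      then have deg: "degree h < degree f"
        unfolding h_def using less.prems degree_mod_less' by blast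
      have IH: "(\<Prod>x\<in>#proots (qpoly h). poly (qpoly f) x) \<in> \<rat>"
        by (rule less.hyps[OF deg h])
      have "(\<Prod>x\<in>#proots (qpoly f). poly (qpoly h) x) * of_rat (lead_coeff f) ^ degree h \<in> \<rat>"
        using resultant_swap[of "qpoly f" "qpoly h"] less.prems h IH by simp
      then have "(\<Prod>x\<in>#proots (qpoly f). poly (qpoly h) x) * of_rat (lead_coeff f) ^ degree h *
          inverse (of_rat (lead_coeff f) ^ degree h) \<in> \<rat>"
        by (intro Rats_mult[OF _ Rats_inverse]) auto
      then show ?thesis using less.prems by (simp add: mult.assoc)
    qed
    finally show ?thesis .
  qed
qed

lemma proots_min_poly_int:
  assumes "algebraic \<alpha>"
  shows "proots (cpoly (min_poly_int \<alpha>)) = mset_set (conjugates \<alpha>)"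
proof -
  have "proots (cpoly (min_poly_int \<alpha>)) = proots (\<Prod>\<beta>\<in>conjugates \<alpha>. [:-\<beta>, 1:])"
    by (subst min_poly_int_factorization[OF assms]) (simp add: min_poly_int_nz[OF assms])
  also have "\<dots> = (\<Sum>\<beta>\<in>conjugates \<alpha>. {#\<beta>#})" by (subst proots_prod) auto
  also have "\<dots> = mset_set (conjugates \<alpha>)"
    by (rule sum_multiset_singleton)
  finally show ?thesis .
qed

lemma prod_conjugates_Rats:
  assumes "algebraic \<alpha>"
  shows "(\<Prod>\<beta>\<in>conjugates \<alpha>. poly (cpoly F) \<beta>) \<in> \<rat>"
proof -
  have q: "cpoly f = qpoly (map_poly of_int f)" for f
    by (rule poly_eqI) (simp add: coeff_map_poly)
  have "map_poly of_int (min_poly_int \<alpha>) \<noteq> (0 :: rat poly)"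
    using min_poly_int_nz[OF assms] by (simp add: poly_eq_iff coeff_map_poly)
  then have "(\<Prod>x\<in>#proots (cpoly (min_poly_int \<alpha>)). poly (cpoly F) x) \<in> \<rat>"
    unfolding q by (rule prod_roots_Rats)
  then show ?thesis unfolding proots_min_poly_int[OF assms] by (simp add: prod_unfold_prod_mset)
qed


text \<open>Synthetic division: the coefficients of the quotient by X - \<beta> are Horner values at
  \<beta>.\<close>

lemma coeff_quotient:
  "coeff g i = poly (poly_shift (Suc i) ([:-\<beta>, 1:] * g)) (\<beta> :: complex)"
proof -
  have "poly_shift (Suc i) ([:-\<beta>, 1:] * g) = [:-\<beta>, 1:] * poly_shift (Suc i) g + [:coeff g i:]"
    by (rule poly_eqI) (auto simp: coeff_poly_shift coeff_pCons split: nat.splits)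
  then show ?thesis by simp
qed

text \<open>Gauss's lemma for a valuation ring, in the form that \<open>c\<close> times the product of the
  nonintegral roots is integral.\<close>

lemma (in valuation_ring) lead_times_roots_mem:
  assumes "finite C" "\<And>i. coeff (smult c (\<Prod>\<beta>\<in>C. [:-\<beta>, 1:])) i \<in> V"
  shows "c * (\<Prod>\<beta>\<in>C - V. \<beta>) \<in> V"
  using assms
proof (induction C arbitrary: c rule: finite_induct)
  case empty
  from empty.prems[of 0] show ?case by simp
next
  case (insert \<beta> C)
  define g where "g = smult c (\<Prod>\<beta>\<in>C. [:-\<beta>, 1:])"
  have eq: "smult c (\<Prod>\<beta>\<in>insert \<beta> C. [:-\<beta>, 1:]) = [:-\<beta>, 1:] * g"
    unfolding g_def prod.insert[OF insert.hyps] by (rule mult_smult_right[symmetric])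
  have cV: "coeff ([:-\<beta>, 1:] * g) i \<in> V" for i using insert.prems[of i] unfolding eq .
  have root: "poly ([:-\<beta>, 1:] * g) \<beta> = 0" by simp
  note H = horner_mem[OF root cV]
  show ?case
  proof (cases "\<beta> \<in> V")
    case True
    have "coeff g i \<in> V" for i unfolding coeff_quotient[of g i \<beta>] using H by blast
    then have "c * (\<Prod>\<beta>\<in>C - V. \<beta>) \<in> V" unfolding g_def by (rule insert.IH)
    then show ?thesis using True by (simp add: insert_Diff_if)
  next
    case False
    have "coeff (smult (\<beta> * c) (\<Prod>\<beta>\<in>C. [:-\<beta>, 1:])) i \<in> V" for i
    proof -
      have "\<beta> * coeff g i \<in> V" unfolding coeff_quotient[of g i \<beta>] using H by blast
      then show ?thesis unfolding g_def by (simp add: mult.assoc)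
    qed
    then have "\<beta> * c * (\<Prod>\<beta>\<in>C - V. \<beta>) \<in> V" by (rule insert.IH)
    moreover have "(\<Prod>\<beta>\<in>insert \<beta> C - V. \<beta>) = \<beta> * (\<Prod>\<beta>\<in>C - V. \<beta>)"
      using False insert.hyps by (simp add: insert_Diff_if)
    ultimately show ?thesis by (simp add: mult_ac)
  qed
qed

text \<open>At a conjugate outside V the value of F is \<beta>^N times an integral element; by
  \<open>lead_times_roots_mem\<close> the N-th power of the leading coefficient absorbs these
  factors. Every conjugate then contributes p^m.\<close>

lemma (in p_valuation) resultant_mem:
  assumes alg: "algebraic \<alpha>"
    and F: "\<And>\<beta>. \<beta> \<in> conjugates \<alpha> \<Longrightarrow> \<beta> \<in> V \<Longrightarrow> poly (cpoly F) \<beta> / \<pi> ^ m \<in> V"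
    and F': "\<And>\<beta>. \<beta> \<in> conjugates \<alpha> \<Longrightarrow> \<beta> \<notin> V \<Longrightarrow> inverse \<beta> ^ N * poly (cpoly F) \<beta> / \<pi> ^ m \<in> V"
  shows "of_int (lead_coeff (min_poly_int \<alpha>)) ^ N * (\<Prod>\<beta>\<in>conjugates \<alpha>. poly (cpoly F) \<beta>)
      / \<pi> ^ (m * degree (min_poly_int \<alpha>)) \<in> V"
proof -
  define C where "C = conjugates \<alpha>"
  define a :: complex where "a = of_int (lead_coeff (min_poly_int \<alpha>))"
  have fin: "finite C" unfolding C_def by (rule finite_conjugates[OF alg])
  have "coeff (smult a (\<Prod>\<beta>\<in>C. [:-\<beta>, 1:])) i \<in> V" for i
    unfolding a_def C_def min_poly_int_factorization[OF alg, symmetric] by simp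
  then have A: "a * (\<Prod>\<beta>\<in>C - V. \<beta>) \<in> V" by (rule lead_times_roots_mem[OF fin])
  have nz: "\<beta> \<noteq> 0" if "\<beta> \<in> C - V" for \<beta> using that by auto
  have "(\<Prod>\<beta>\<in>C. poly (cpoly F) \<beta>) = (\<Prod>\<beta>\<in>C \<inter> V. poly (cpoly F) \<beta>) * (\<Prod>\<beta>\<in>C - V. poly (cpoly F) \<beta>)"
    by (rule prod.Int_Diff[OF fin])
  also have "(\<Prod>\<beta>\<in>C - V. poly (cpoly F) \<beta>) = (\<Prod>\<beta>\<in>C - V. \<beta> ^ N * (inverse \<beta> ^ N * poly (cpoly F) \<beta>))"
    using nz by (intro prod.cong) (auto simp: field_simps)
  also have "\<dots> = (\<Prod>\<beta>\<in>C - V. \<beta>) ^ N * (\<Prod>\<beta>\<in>C - V. inverse \<beta> ^ N * poly (cpoly F) \<beta>)"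
    by (simp add: prod.distrib prod_power_distrib)
  finally have 1: "a ^ N * (\<Prod>\<beta>\<in>C. poly (cpoly F) \<beta>) = (a * (\<Prod>\<beta>\<in>C - V. \<beta>)) ^ N *
      ((\<Prod>\<beta>\<in>C \<inter> V. poly (cpoly F) \<beta>) * (\<Prod>\<beta>\<in>C - V. inverse \<beta> ^ N * poly (cpoly F) \<beta>))"
    by (simp add: power_mult_distrib mult_ac)
  have "card C = card (C \<inter> V) + card (C - V)" using fin by (metis card_Int_Diff)
  then have 2: "\<pi> ^ (m * card C) = (\<pi> ^ m) ^ card (C \<inter> V) * (\<pi> ^ m) ^ card (C - V)"
    by (simp add: power_mult power_add)
  have "a ^ N * (\<Prod>\<beta>\<in>C. poly (cpoly F) \<beta>) / \<pi> ^ (m * card C) = (a * (\<Prod>\<beta>\<in>C - V. \<beta>)) ^ N *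
      ((\<Prod>\<beta>\<in>C \<inter> V. poly (cpoly F) \<beta> / \<pi> ^ m) * (\<Prod>\<beta>\<in>C - V. inverse \<beta> ^ N * poly (cpoly F) \<beta> / \<pi> ^ m))"
    unfolding 1 2 by (simp add: prod_dividef)
  also have "\<dots> \<in> V"
    by (intro mult_mem power_mem prod_mem A) (use F F' in \<open>auto simp: C_def\<close>)
  finally show ?thesis unfolding C_def a_def card_conjugates[OF alg] .
qed

text \<open>F is treated as a form of degree N on the projective line; the second clause is the
  chart at infinity, for conjugates that are not p-integral. Hence p + 1 residue classes instead of
  p.\<close>

definition p_divisible :: "nat \<Rightarrow> nat \<Rightarrow> nat \<Rightarrow> int poly \<Rightarrow> bool" where
  "p_divisible p m N F \<longleftrightarrow> (\<forall>V. p_valuation V p \<longrightarrow> (\<forall>x\<in>p_valuation.padic V p \<inter> V.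
     poly (cpoly F) x / of_nat p ^ m \<in> V \<and>
     (x \<noteq> 0 \<longrightarrow> x ^ N * poly (cpoly F) (inverse x) / of_nat p ^ m \<in> V)))"

lemma reversed_value:
  assumes "degree F \<le> N" "(x::complex) \<noteq> 0"
  shows "x ^ N * poly (cpoly F) (inverse x) = (\<Sum>i\<le>N. of_int (coeff F i) * x ^ (N - i))"
proof -
  have "poly (cpoly F) (inverse x) = (\<Sum>i\<le>N. of_int (coeff F i) * inverse x ^ i)"
    unfolding poly_altdef using assms(1) by (intro sum.mono_neutral_cong_left) (auto simp: coeff_eq_0)
  then have "x ^ N * poly (cpoly F) (inverse x) = (\<Sum>i\<le>N. x ^ N * (of_int (coeff F i) * inverse x ^ i))"
    by (simp add: sum_distrib_left)
  also have "\<dots> = (\<Sum>i\<le>N. of_int (coeff F i) * x ^ (N - i))"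
    using assms(2) by (intro sum.cong refl) (auto simp: field_simps power_diff)
  finally show ?thesis .
qed

lemma p_divisible_coeffs:
  assumes "degree F \<le> N" "\<And>i. int p ^ m dvd coeff F i"
  shows "p_divisible p m N F"
  unfolding p_divisible_def
proof (intro allI impI ballI)
  fix V x assume "p_valuation V p"
  then interpret p_valuation V p .
  assume "x \<in> padic \<inter> V"
  then have x: "x \<in> V" by blast
  have c: "of_int (coeff F i) / \<pi> ^ m \<in> V" for i using assms(2) by (simp only: of_int_div_p_power_iff)
  have "poly (cpoly F) x / \<pi> ^ m = (\<Sum>i\<le>degree F. of_int (coeff F i) / \<pi> ^ m * x ^ i)"
    by (simp add: poly_altdef sum_divide_distrib)
  also have "\<dots> \<in> V" by (intro sum_mem mult_mem power_mem c x)
  finally have 1: "poly (cpoly F) x / \<pi> ^ m \<in> V" .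
  have "x ^ N * poly (cpoly F) (inverse x) / \<pi> ^ m \<in> V" if "x \<noteq> 0"
  proof -
    have "x ^ N * poly (cpoly F) (inverse x) / \<pi> ^ m = (\<Sum>i\<le>N. of_int (coeff F i) / \<pi> ^ m * x ^ (N - i))"
      unfolding reversed_value[OF assms(1) that] by (simp add: sum_divide_distrib)
    also have "\<dots> \<in> V" by (intro sum_mem mult_mem power_mem c x)
    finally show ?thesis .
  qed
  with 1 show "poly (cpoly F) x / \<pi> ^ m \<in> V \<and>
      (x \<noteq> 0 \<longrightarrow> x ^ N * poly (cpoly F) (inverse x) / \<pi> ^ m \<in> V)" by blast
qed

lemma p_divisible_add:
  assumes "p_divisible p m N F" "p_divisible p m N G"
  shows "p_divisible p m N (F + G)"
  unfolding p_divisible_def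
proof (intro allI impI ballI)
  fix V x assume V: "p_valuation V p"
  then interpret p_valuation V p .
  assume x: "x \<in> padic \<inter> V"
  have F: "poly (cpoly F) x / \<pi> ^ m \<in> V" "x \<noteq> 0 \<Longrightarrow> x ^ N * poly (cpoly F) (inverse x) / \<pi> ^ m \<in> V"
    and G: "poly (cpoly G) x / \<pi> ^ m \<in> V" "x \<noteq> 0 \<Longrightarrow> x ^ N * poly (cpoly G) (inverse x) / \<pi> ^ m \<in> V"
    using assms V x unfolding p_divisible_def by blast+
  have "poly (cpoly (F + G)) x / \<pi> ^ m = poly (cpoly F) x / \<pi> ^ m + poly (cpoly G) x / \<pi> ^ m"
    "x ^ N * poly (cpoly (F + G)) (inverse x) / \<pi> ^ m =
      x ^ N * poly (cpoly F) (inverse x) / \<pi> ^ m + x ^ N * poly (cpoly G) (inverse x) / \<pi> ^ m"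
    by (simp_all add: add_divide_distrib distrib_left)
  then show "poly (cpoly (F + G)) x / \<pi> ^ m \<in> V \<and>
      (x \<noteq> 0 \<longrightarrow> x ^ N * poly (cpoly (F + G)) (inverse x) / \<pi> ^ m \<in> V)"
    using F G add_mem by metis
qed

definition frob_poly :: "nat \<Rightarrow> int poly" where
  "frob_poly p = monom 1 p - monom 1 1"

lemma poly_frob_poly [simp]: "poly (cpoly (frob_poly p)) x = x ^ p - x"
proof -
  have "cpoly (monom 1 k) = monom 1 k" for k by (rule poly_eqI) simp
  then show ?thesis by (simp add: frob_poly_def poly_monom)
qed

lemma frob_poly_monic:
  assumes "p > 1"
  shows "degree (frob_poly p) = p" "lead_coeff (frob_poly p) = 1"
proof -
  have "degree (frob_poly p) \<le> p"
    by (rule degree_le) (use assms in \<open>auto simp: frob_poly_def\<close>)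
  moreover have c: "coeff (frob_poly p) p = 1" using assms by (simp add: frob_poly_def)
  ultimately show "degree (frob_poly p) = p" by (metis antisym le_degree zero_neq_one)
  then show "lead_coeff (frob_poly p) = 1" using c by simp
qed

text \<open>The form X^p Y - X Y^p vanishes at all p + 1 points of the projective line over the
  residue field, and in the chart at infinity it is again x^p - x up to sign. So each factor p is
  bought with degree p + 1.\<close>

lemma p_divisible_frob:
  assumes "p_divisible p m N F"
  shows "p_divisible p (Suc m) (N + Suc p) (frob_poly p * F)"
  unfolding p_divisible_def
proof (intro allI impI ballI)
  fix V x assume V: "p_valuation V p"
  then interpret p_valuation V p .
  assume x: "x \<in> padic \<inter> V"
  have F: "poly (cpoly F) x / \<pi> ^ m \<in> V" "x \<noteq> 0 \<Longrightarrow> x ^ N * poly (cpoly F) (inverse x) / \<pi> ^ m \<in> V"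
    using assms V x unfolding p_divisible_def by blast+
  have fr: "(x ^ p - x) / \<pi> \<in> V" using padic_frobenius x by blast
  have "poly (cpoly (frob_poly p * F)) x / \<pi> ^ Suc m = (x ^ p - x) / \<pi> * (poly (cpoly F) x / \<pi> ^ m)"
    by simp
  then have 1: "poly (cpoly (frob_poly p * F)) x / \<pi> ^ Suc m \<in> V" using mult_mem[OF fr F(1)] by metis
  have "x ^ (N + Suc p) * poly (cpoly (frob_poly p * F)) (inverse x) / \<pi> ^ Suc m \<in> V" if x0: "x \<noteq> 0"
  proof -
    have "x ^ Suc p * (inverse x ^ p - inverse x) = - (x ^ p - x)"
      using x0 by (simp add: field_simps)
    moreover have "x ^ (N + Suc p) * poly (cpoly (frob_poly p * F)) (inverse x) =
        x ^ Suc p * (inverse x ^ p - inverse x) * (x ^ N * poly (cpoly F) (inverse x))"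
      by (simp only: power_add cpoly_mult poly_mult poly_frob_poly mult_ac)
    ultimately have e: "x ^ (N + Suc p) * poly (cpoly (frob_poly p * F)) (inverse x) =
        - (x ^ p - x) * (x ^ N * poly (cpoly F) (inverse x))"
      by metis
    have "x ^ (N + Suc p) * poly (cpoly (frob_poly p * F)) (inverse x) / \<pi> ^ Suc m =
        - ((x ^ p - x) / \<pi> * (x ^ N * poly (cpoly F) (inverse x) / \<pi> ^ m))"
      unfolding e by (simp only: mult_minus_left minus_divide_left times_divide_times_eq power_Suc)
    then show ?thesis using minus_mem[OF mult_mem[OF fr F(2)[OF x0]]] by metis
  qed
  with 1 show "poly (cpoly (frob_poly p * F)) x / \<pi> ^ Suc m \<in> V \<and>
      (x \<noteq> 0 \<longrightarrow> x ^ (N + Suc p) * poly (cpoly (frob_poly p * F)) (inverse x) / \<pi> ^ Suc m \<in> V)" by blast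
qed

text \<open>The polynomials of degree at most \<open>N\<close> with large \<open>p\<close>-divisibility form a lattice of small
  index: expand in powers of \<open>X\<^sup>p - X\<close>, keeping at each step the \<open>p + 1\<close> coefficients
  of the remainder and of the top monomial.\<close>

lemma p_divisible_classes:
  assumes p: "prime p"
  shows "m * Suc p \<le> N \<Longrightarrow> \<exists>(\<kappa> :: int poly \<Rightarrow> int list) A. finite A \<and> card A \<le> p ^ (Suc p * (\<Sum>i\<le>m. i)) \<and>
    (\<forall>F. degree F \<le> N \<longrightarrow> \<kappa> F \<in> A) \<and>
    (\<forall>F G. degree F \<le> N \<longrightarrow> degree G \<le> N \<longrightarrow> \<kappa> F = \<kappa> G \<longrightarrow> p_divisible p m N (F - G))"
proof (induction m arbitrary: N)
  case 0
  have "p_divisible p 0 N (F - G)" if "degree F \<le> N" "degree G \<le> N" for F G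
    using that by (intro p_divisible_coeffs) (auto intro: degree_diff_le)
  then show ?case by (intro exI[of _ "\<lambda>_. []"] exI[of _ "{[]}"]) auto
next
  case (Suc m)
  define M where "M = N - Suc p"
  have N: "N = M + Suc p" using Suc.prems unfolding M_def by simp
  have p1: "p > 1" using p by (rule prime_gt_1_nat)
  have pre: "m * Suc p \<le> M" using Suc.prems N by simp
  obtain \<kappa> :: "int poly \<Rightarrow> int list" and A where A: "finite A" "card A \<le> p ^ (Suc p * (\<Sum>i\<le>m. i))"
    "\<And>F. degree F \<le> M \<Longrightarrow> \<kappa> F \<in> A"
    "\<And>F G. degree F \<le> M \<Longrightarrow> degree G \<le> M \<Longrightarrow> \<kappa> F = \<kappa> G \<Longrightarrow> p_divisible p m M (F - G)"
    using Suc.IH[OF pre] by blast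
  \<comment> \<open>Without the top monomial the degree is at most N - 1, so division by X^p - X
    leaves a quotient of degree at most N - (p + 1), as the chart at infinity demands.\<close>
  have "\<exists>Q r. F = monom (coeff F N) N + r + frob_poly p * Q \<and> degree r < p \<and> degree Q \<le> M"
    if F: "degree F \<le> N" for F
  proof -
    define F1 where "F1 = F - monom (coeff F N) N"
    have F1: "degree F1 \<le> M + p"
    proof (rule degree_le, intro allI impI)
      fix i assume "M + p < i"
      then show "coeff F1 i = 0" using F N by (cases "i = N") (auto simp: F1_def coeff_eq_0)
    qed
    obtain Q r where qr: "pseudo_divmod F1 (frob_poly p) = (Q, r)" by force
    have fr0: "frob_poly p \<noteq> 0" using frob_poly_monic(2)[OF p1] by auto
    note pd = pseudo_divmod[OF fr0 qr, unfolded frob_poly_monic(1)[OF p1]]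
    have "coeff (frob_poly p) p = 1" using frob_poly_monic[OF p1] by simp
    then have eq: "F1 = frob_poly p * Q + r" using pd(1) by simp
    have r: "degree r < p" using pd(2) p1 by auto
    have "degree Q \<le> M"
    proof (cases "Q = 0")
      case False
      have "p + degree Q = degree (frob_poly p * Q)"
        using False fr0 by (simp add: degree_mult_eq frob_poly_monic[OF p1])
      also have "frob_poly p * Q = F1 - r" using eq by simp
      also have "degree (F1 - r) \<le> M + p" using F1 r by (intro degree_diff_le) auto
      finally show ?thesis by simp
    qed simp
    then show ?thesis using eq r unfolding F1_def by (intro exI[of _ Q] exI[of _ r]) (auto simp: algebra_simps)
  qed
  then obtain Q r where Qr: "\<And>F. degree F \<le> N \<Longrightarrow> F = monom (coeff F N) N + r F + frob_poly p * Q F"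
    "\<And>F. degree F \<le> N \<Longrightarrow> degree (r F) < p" "\<And>F. degree F \<le> N \<Longrightarrow> degree (Q F) \<le> M" by metis
  define q where "q = int p ^ Suc m"
  have q0: "q > 0" unfolding q_def using p1 by simp
  \<comment> \<open>There are p + 1 residues modulo p^(m + 1); the quotient needs only its class for
    p^m, as the factor X^p - X supplies one more p.\<close>
  define \<kappa>' where "\<kappa>' = (\<lambda>F. (coeff F N mod q) # map (\<lambda>i. coeff (r F) i mod q) [0..<p] @ \<kappa> (Q F))"
  define L where "L = {xs. set xs \<subseteq> {0..<q} \<and> length xs = p}"
  define A' where "A' = (\<lambda>(x, ys, zs). x # ys @ zs) ` ({0..<q} \<times> L \<times> A)"
  have finL: "finite L" unfolding L_def by (rule finite_lists_length_eq) simp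
  have cardL: "card L = nat q ^ p" unfolding L_def by (subst card_lists_length_eq) auto
  have fin: "finite A'" unfolding A'_def using finL A(1) by auto
  have "card A' \<le> card ({0..<q} \<times> L \<times> A)" unfolding A'_def using finL A(1) by (intro card_image_le) auto
  also have "\<dots> = nat q ^ Suc p * card A" by (simp add: card_cartesian_product cardL)
  also have "\<dots> \<le> nat q ^ Suc p * p ^ (Suc p * (\<Sum>i\<le>m. i))" using A(2) by simp
  also have "nat q ^ Suc p = p ^ (Suc p * Suc m)"
    unfolding q_def by (simp add: nat_power_eq power_mult[symmetric] mult.commute del: power_Suc)
  also have "p ^ (Suc p * Suc m) * p ^ (Suc p * (\<Sum>i\<le>m. i)) = p ^ (Suc p * (\<Sum>i\<le>Suc m. i))"
    by (simp add: power_add[symmetric] algebra_simps)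
  finally have card: "card A' \<le> p ^ (Suc p * (\<Sum>i\<le>Suc m. i))" .
  have mem: "\<kappa>' F \<in> A'" if "degree F \<le> N" for F
  proof -
    have "(coeff F N mod q, map (\<lambda>i. coeff (r F) i mod q) [0..<p], \<kappa> (Q F)) \<in> {0..<q} \<times> L \<times> A"
      using A(3) Qr(3)[OF that] q0 by (auto simp: L_def)
    then show ?thesis unfolding A'_def \<kappa>'_def by (rule rev_image_eqI) simp
  qed
  have div: "p_divisible p (Suc m) N (F - G)" if FG: "degree F \<le> N" "degree G \<le> N" "\<kappa>' F = \<kappa>' G" for F G
  proof -
    have k: "coeff F N mod q = coeff G N mod q"
      "map (\<lambda>i. coeff (r F) i mod q) [0..<p] = map (\<lambda>i. coeff (r G) i mod q) [0..<p]" "\<kappa> (Q F) = \<kappa> (Q G)"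
      using FG(3) unfolding \<kappa>'_def by auto
    have "p_divisible p m M (Q F - Q G)" by (rule A(4)[OF Qr(3)[OF FG(1)] Qr(3)[OF FG(2)] k(3)])
    then have 1: "p_divisible p (Suc m) N (frob_poly p * (Q F - Q G))"
      unfolding N by (rule p_divisible_frob)
    have 2: "p_divisible p (Suc m) N (monom (coeff F N - coeff G N) N)"
      using k(1) by (intro p_divisible_coeffs) (auto simp: degree_monom_le mod_eq_dvd_iff q_def)
    have "q dvd coeff (r F - r G) i" for i
    proof (cases "i < p")
      case True
      then have "coeff (r F) i mod q = coeff (r G) i mod q" using k(2) by simp
      then show ?thesis by (simp add: mod_eq_dvd_iff)
    next
      case False
      then show ?thesis using Qr(2)[OF FG(1)] Qr(2)[OF FG(2)] by (simp add: coeff_eq_0)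
    qed
    moreover have "degree (r F - r G) \<le> N"
      using Qr(2)[OF FG(1)] Qr(2)[OF FG(2)] N by (intro degree_diff_le) auto
    ultimately have 3: "p_divisible p (Suc m) N (r F - r G)"
      by (intro p_divisible_coeffs) (auto simp: q_def)
    have "F - G = monom (coeff F N - coeff G N) N + (r F - r G) + frob_poly p * (Q F - Q G)"
      by (subst Qr(1)[OF FG(1)], subst Qr(1)[OF FG(2)]) (simp add: algebra_simps diff_monom[symmetric])
    then show ?thesis using p_divisible_add[OF p_divisible_add[OF 2 3] 1] by metis
  qed
  from fin card mem div show ?case by (intro exI[of _ \<kappa>'] exI[of _ A']) blast
qed

section \<open>A Liouville inequality and the lower bound\<close>

section \<open>The lower bound\<close>

text \<open>Siegel's lemma for these congruences: there are more polynomials with coefficients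
  between 0 and H than joint classes for the primes in S, and the difference of two in the same
  class is as desired.\<close>

lemma auxiliary_polynomial:
  fixes H N :: nat and m :: "nat \<Rightarrow> nat"
  assumes S: "finite S" "\<And>p. p \<in> S \<Longrightarrow> prime p" and m: "\<And>p. p \<in> S \<Longrightarrow> m p * Suc p \<le> N"
    and card: "(\<Prod>p\<in>S. p ^ (Suc p * (\<Sum>i\<le>m p. i))) < (H + 1) ^ (N + 1)"
  obtains F where "F \<noteq> 0" "degree F \<le> N" "\<And>i. \<bar>coeff F i\<bar> \<le> int H"
    "\<And>p. p \<in> S \<Longrightarrow> p_divisible p (m p) N F"
proof -
  have "\<forall>p\<in>S. \<exists>(\<kappa> :: int poly \<Rightarrow> int list) A. finite A \<and> card A \<le> p ^ (Suc p * (\<Sum>i\<le>m p. i)) \<and>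
    (\<forall>F. degree F \<le> N \<longrightarrow> \<kappa> F \<in> A) \<and>
    (\<forall>F G. degree F \<le> N \<longrightarrow> degree G \<le> N \<longrightarrow> \<kappa> F = \<kappa> G \<longrightarrow> p_divisible p (m p) N (F - G))"
    using p_divisible_classes[OF S(2) m] by blast
  then obtain \<kappa> :: "nat \<Rightarrow> int poly \<Rightarrow> int list" and A where
    A: "\<And>p. p \<in> S \<Longrightarrow> finite (A p)" "\<And>p. p \<in> S \<Longrightarrow> card (A p) \<le> p ^ (Suc p * (\<Sum>i\<le>m p. i))"
    "\<And>p F. p \<in> S \<Longrightarrow> degree F \<le> N \<Longrightarrow> \<kappa> p F \<in> A p"
    "\<And>p F G. p \<in> S \<Longrightarrow> degree F \<le> N \<Longrightarrow> degree G \<le> N \<Longrightarrow> \<kappa> p F = \<kappa> p G \<Longrightarrow> p_divisible p (m p) N (F - G)"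
    by metis
  define L where "L = {xs :: int list. set xs \<subseteq> {0..int H} \<and> length xs = N + 1}"
  define \<Phi> where "\<Phi> = Poly ` L"
  have degP: "degree (Poly xs) \<le> N" if "length xs = N + 1" for xs :: "int list"
    by (rule degree_le) (use that in \<open>auto simp: coeff_Poly_eq nth_default_def\<close>)
  have cP: "coeff (Poly xs) i \<in> {0..int H}" if "xs \<in> L" for xs i
  proof (cases "i < length xs")
    case True
    then have "xs ! i \<in> {0..int H}" using that nth_mem[OF True] unfolding L_def by blast
    then show ?thesis using True by (simp add: coeff_Poly_eq nth_default_def)
  qed (simp add: coeff_Poly_eq nth_default_def)
  have "inj_on Poly L"
  proof (rule inj_onI)
    fix xs ys assume xy: "xs \<in> L" "ys \<in> L" "Poly xs = Poly ys"
    show "xs = ys"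
    proof (rule nth_equalityI)
      show "length xs = length ys" using xy by (simp add: L_def)
      fix i assume i: "i < length xs"
      have "nth_default 0 xs i = nth_default 0 ys i" by (metis coeff_Poly_eq xy(3))
      then show "xs ! i = ys ! i" using i xy by (simp add: L_def nth_default_def)
    qed
  qed
  then have "card \<Phi> = card L" unfolding \<Phi>_def by (rule card_image)
  also have "\<dots> = (H + 1) ^ (N + 1)" unfolding L_def by (subst card_lists_length_eq) (auto simp: nat_add_distrib)
  finally have card\<Phi>: "card \<Phi> = (H + 1) ^ (N + 1)" .
  have \<Phi>: "degree F \<le> N" "coeff F i \<in> {0..int H}" if "F \<in> \<Phi>" for F i
    using that degP cP unfolding \<Phi>_def by (auto simp: L_def)
  define K where "K = (\<lambda>F. restrict (\<lambda>p. \<kappa> p F) S)"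
  have "card (K ` \<Phi>) \<le> card (PiE S A)"
    using S(1) A(1,3) \<Phi>(1) by (intro card_mono finite_PiE) (auto simp: K_def)
  also have "\<dots> = (\<Prod>p\<in>S. card (A p))" by (rule card_PiE[OF S(1)])
  also have "\<dots> \<le> (\<Prod>p\<in>S. p ^ (Suc p * (\<Sum>i\<le>m p. i)))" by (intro prod_mono) (use A(2) in auto)
  also have "\<dots> < card \<Phi>" using card card\<Phi> by simp
  finally have "\<not> inj_on K \<Phi>" by (rule pigeonhole)
  then obtain F G where FG: "F \<in> \<Phi>" "G \<in> \<Phi>" "K F = K G" "F \<noteq> G" unfolding inj_on_def by blast
  show ?thesis
  proof (rule that[of "F - G"])
    show "F - G \<noteq> 0" using FG by simp
    show "degree (F - G) \<le> N" using FG \<Phi>(1) by (intro degree_diff_le) auto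
    show "\<bar>coeff (F - G) i\<bar> \<le> int H" for i using \<Phi>(2)[OF FG(1), of i] \<Phi>(2)[OF FG(2), of i] by auto
    show "p_divisible p (m p) N (F - G)" if "p \<in> S" for p
    proof (rule A(4)[OF that \<Phi>(1)[OF FG(1)] \<Phi>(1)[OF FG(2)]])
      show "\<kappa> p F = \<kappa> p G" using FG(3) that unfolding K_def by (metis restrict_apply')
    qed
  qed
qed

text \<open>A prime dividing the denominator is detected by each single valuation above it, so one
  valuation per prime suffices.\<close>

lemma Rats_integral_everywhere:
  assumes "x \<in> \<rat>" "\<And>q. prime q \<Longrightarrow> \<exists>V. p_valuation V q \<and> x \<in> V"
  shows "x \<in> (\<int> :: complex set)"
proof -
  obtain a b where ab: "b > 0" "coprime a b" "x = of_int a / of_int b"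
    using assms(1) by (auto elim: Rats_cases')
  have "b = 1"
  proof (rule ccontr)
    assume "b \<noteq> 1"
    then have "nat b \<noteq> 1" using ab(1) by simp
    then obtain q where q: "prime q" "q dvd nat b" using prime_factor_nat by blast
    then have "int q dvd int (nat b)" by (simp only: int_dvd_int_iff)
    then have qb: "int q dvd b" using ab(1) by simp
    obtain V where V: "p_valuation V q" "x \<in> V" using assms(2)[OF q(1)] by blast
    interpret p_valuation V q by (rule V(1))
    have "of_int b / \<pi> \<in> V" using qb by (simp only: of_int_div_p_iff)
    then have "x * (of_int b / \<pi>) \<in> V" using V(2) by (intro mult_mem)
    moreover have "x * (of_int b / \<pi>) = of_int a / \<pi>" using ab by simp
    ultimately have "int q dvd a" using of_int_div_p_iff by simp
    then have "is_unit (int q)" using qb ab(2) by (meson coprime_common_divisor)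
    then show False using q(1) by (simp add: prime_gt_1_nat)
  qed
  then show ?thesis using ab by simp
qed

lemma prod_prime_powers_dvd:
  assumes "finite S" "\<And>p. p \<in> S \<Longrightarrow> prime p" "\<And>p. p \<in> S \<Longrightarrow> int p ^ e p dvd k"
  shows "(\<Prod>p\<in>S. int p ^ e p) dvd k"
  using assms
proof (induction S rule: finite_induct)
  case (insert p S)
  have "coprime (int p ^ e p) (\<Prod>p\<in>S. int p ^ e p)"
  proof (rule prod_coprime_right)
    fix q assume q: "q \<in> S"
    then have "coprime (int p) (int q)"
      using insert.prems(1) insert.hyps by (intro primes_coprime) auto
    then show "coprime (int p ^ e p) (int q ^ e q)" by simp
  qed
  then show ?case using insert by (simp add: divides_mult)
qed simp

text \<open>The integer to be compared is R, up to sign the resultant of the minimal polynomial with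
  F as a polynomial of formal degree N. The divisibility of F bounds it below, and the Mahler
  measure of \<alpha> bounds it above.\<close>

lemma height_inequality:
  assumes S: "finite S" "\<And>p. p \<in> S \<Longrightarrow> prime p" and \<alpha>: "\<alpha> \<in> totally_padic S"
    and F: "degree F \<le> N" "\<And>i. \<bar>coeff F i\<bar> \<le> int H" "\<And>p. p \<in> S \<Longrightarrow> p_divisible p (m p) N F"
    and F\<alpha>: "poly (cpoly F) \<alpha> \<noteq> 0"
  shows "(\<Sum>p\<in>S. real (m p) * ln p) \<le> ln (real (N + 1) * real H) + real N * weil_height \<alpha>"
proof -
  have alg: "algebraic \<alpha>" using \<alpha> by (simp add: totally_padic_def)
  define C where "C = conjugates \<alpha>"
  define f where "f = min_poly_int \<alpha>"
  define d where "d = degree f"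
  define a where "a = lead_coeff f"
  have fin: "finite C" unfolding C_def by (rule finite_conjugates[OF alg])
  have cardC: "card C = d" unfolding C_def d_def f_def by (rule card_conjugates[OF alg])
  have d0: "d > 0" unfolding d_def f_def by (rule degree_min_poly_int[OF alg])
  have a0: "a > 0" unfolding a_def f_def by (rule lead_coeff_min_poly_int[OF alg])
  have nz: "poly (cpoly F) \<beta> \<noteq> 0" if "\<beta> \<in> C" for \<beta>
  proof
    assume "poly (cpoly F) \<beta> = 0"
    then have "min_poly_int \<beta> dvd F"
      using that algebraic_conjugate[OF alg] min_poly_int_dvd unfolding C_def by blast
    then have "f dvd F" using that min_poly_int_conjugate[OF alg] unfolding C_def f_def by metis
    then show False using F\<alpha> poly_min_poly_int[OF alg] unfolding f_def by (auto elim!: dvdE)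
  qed
  define R where "R = of_int a ^ N * (\<Prod>\<beta>\<in>C. poly (cpoly F) \<beta>)"
  have R0: "R \<noteq> 0" unfolding R_def using a0 nz fin by simp
  have RQ: "R \<in> \<rat>" unfolding R_def C_def using prod_conjugates_Rats[OF alg] by (intro Rats_mult) auto
  have "\<exists>V. p_valuation V q \<and> R \<in> V" if q: "prime q" for q
  proof -
    obtain V where V: "p_valuation V q" using p_valuation_exists[OF q] .
    interpret p_valuation V q by (rule V)
    \<comment> \<open>Exponent 0 expresses plain integrality, at all primes and not only at those in
      S.\<close>
    have "R / \<pi> ^ (0 * d) \<in> V"
      unfolding R_def C_def a_def d_def f_def
    proof (rule resultant_mem[OF alg])
      fix \<beta> assume "\<beta> \<in> V"
      then show "poly (cpoly F) \<beta> / \<pi> ^ 0 \<in> V" by (auto intro!: poly_mem)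
    next
      fix \<beta> assume \<beta>: "\<beta> \<notin> V"
      then have i: "inverse \<beta> \<in> V" "inverse \<beta> \<noteq> 0" using mem_inverse by auto
      have "inverse \<beta> ^ N * poly (cpoly F) (inverse (inverse \<beta>)) \<in> V"
        unfolding reversed_value[OF F(1) i(2)] by (intro sum_mem mult_mem power_mem of_int_mem i(1))
      then show "inverse \<beta> ^ N * poly (cpoly F) \<beta> / \<pi> ^ 0 \<in> V" by simp
    qed
    then show ?thesis using V by auto
  qed
  then have "R \<in> \<int>" by (rule Rats_integral_everywhere[OF RQ])
  then obtain k where k: "R = of_int k" by (auto elim: Ints_cases)
  have dvd: "int p ^ (m p * d) dvd k" if p: "p \<in> S" for p
  proof -
    obtain V where V: "p_valuation V p" using p_valuation_exists[OF S(2)[OF p]] .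
    interpret p_valuation V p by (rule V)
    have pad: "\<beta> \<in> padic" "algebraic \<beta>" if "\<beta> \<in> conjugates \<alpha>" for \<beta>
      using totally_padic_conjugate[OF \<alpha> that] p V by (auto simp: totally_padic_def)
    have "R / \<pi> ^ (m p * d) \<in> V"
      unfolding R_def C_def a_def d_def f_def
    proof (rule resultant_mem[OF alg])
      fix \<beta> assume "\<beta> \<in> conjugates \<alpha>" "\<beta> \<in> V"
      then show "poly (cpoly F) \<beta> / \<pi> ^ m p \<in> V"
        using F(3)[OF p] V pad unfolding p_divisible_def by blast
    next
      fix \<beta> assume \<beta>: "\<beta> \<in> conjugates \<alpha>" "\<beta> \<notin> V"
      then have "inverse \<beta> \<in> padic \<inter> V" "inverse \<beta> \<noteq> 0" using mem_inverse pad padic_inverse by auto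
      then have "inverse \<beta> ^ N * poly (cpoly F) (inverse (inverse \<beta>)) / \<pi> ^ m p \<in> V"
        using F(3)[OF p] V unfolding p_divisible_def by blast
      then show "inverse \<beta> ^ N * poly (cpoly F) \<beta> / \<pi> ^ m p \<in> V" by simp
    qed
    then show ?thesis unfolding k of_int_div_p_power_iff .
  qed
  have "(\<Prod>p\<in>S. int p ^ (m p * d)) dvd k" by (rule prod_prime_powers_dvd[OF S dvd])
  then have "(\<Prod>p\<in>S. int p ^ (m p * d)) \<le> \<bar>k\<bar>" using R0 k by (intro zdvd_imp_le) auto
  then have "real_of_int (\<Prod>p\<in>S. int p ^ (m p * d)) \<le> real_of_int \<bar>k\<bar>" by (rule of_int_le_iff[THEN iffD2])
  also have "real_of_int \<bar>k\<bar> = cmod R" unfolding k by simp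
  finally have lower: "(\<Prod>p\<in>S. real p ^ (m p * d)) \<le> cmod R" by simp
  have Fb: "cmod (poly (cpoly F) \<beta>) \<le> real (N + 1) * real H * max 1 (cmod \<beta>) ^ N" for \<beta>
  proof -
    have "cmod (poly (cpoly F) \<beta>) \<le> (\<Sum>i\<le>degree F. cmod (of_int (coeff F i) * \<beta> ^ i))"
      unfolding poly_altdef by (simp add: norm_sum)
    also have "\<dots> \<le> (\<Sum>i\<le>degree F. real H * max 1 (cmod \<beta>) ^ N)"
    proof (rule sum_mono)
      fix i assume i: "i \<in> {..degree F}"
      have c: "\<bar>real_of_int (coeff F i)\<bar> \<le> real H" using F(2)[of i] by linarith
      have "cmod \<beta> ^ i \<le> max 1 (cmod \<beta>) ^ i" by (intro power_mono) auto
      also have "\<dots> \<le> max 1 (cmod \<beta>) ^ N" using i F(1) by (intro power_increasing) auto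
      finally show "cmod (of_int (coeff F i) * \<beta> ^ i) \<le> real H * max 1 (cmod \<beta>) ^ N"
        using c by (simp add: norm_mult norm_power mult_mono)
    qed
    also have "\<dots> = real (degree F + 1) * (real H * max 1 (cmod \<beta>) ^ N)" by simp
    also have "\<dots> \<le> real (N + 1) * (real H * max 1 (cmod \<beta>) ^ N)"
      using F(1) by (intro mult_right_mono) auto
    finally show ?thesis by (simp add: mult.assoc)
  qed
  define M where "M = real_of_int a * (\<Prod>\<beta>\<in>C. max 1 (cmod \<beta>))"
  have "cmod R = real_of_int a ^ N * (\<Prod>\<beta>\<in>C. cmod (poly (cpoly F) \<beta>))"
    unfolding R_def using a0 by (simp add: norm_mult norm_power prod_norm)
  also have "\<dots> \<le> real_of_int a ^ N * (\<Prod>\<beta>\<in>C. real (N + 1) * real H * max 1 (cmod \<beta>) ^ N)"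
    using a0 Fb by (intro mult_left_mono prod_mono) auto
  also have "\<dots> = (real (N + 1) * real H) ^ d * M ^ N"
    unfolding M_def by (simp add: prod.distrib cardC prod_power_distrib power_mult_distrib mult_ac)
  finally have upper: "cmod R \<le> (real (N + 1) * real H) ^ d * M ^ N" .
  have "(\<Prod>\<beta>\<in>C. max 1 (cmod \<beta>)) \<ge> 1" by (intro prod_ge_1) auto
  then have M1: "M > 0" unfolding M_def using a0 by simp
  have H0: "H > 0"
  proof (rule Nat.gr0I)
    assume "H = 0"
    then have "F = 0" using F(2) by (simp add: poly_eq_iff)
    then show False using F\<alpha> by simp
  qed
  have pp: "p > 0" if "p \<in> S" for p using S(2)[OF that] by (rule prime_gt_0_nat)
  have "ln (\<Prod>p\<in>S. real p ^ (m p * d)) \<le> ln ((real (N + 1) * real H) ^ d * M ^ N)"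
    using lower upper pp by (subst ln_le_cancel_iff) (auto intro!: prod_pos mult_pos_pos zero_less_power M1 simp: H0)
  also have "ln ((real (N + 1) * real H) ^ d * M ^ N) = real d * ln (real (N + 1) * real H) + real N * ln M"
    using H0 M1 by (subst ln_mult) (auto simp: ln_realpow)
  also have "ln M = real d * weil_height \<alpha>"
  proof -
    have "real_of_int \<bar>lead_coeff (min_poly_int \<alpha>)\<bar> = real_of_int a" using a0 by (simp add: a_def f_def)
    then show ?thesis
      using d0 unfolding weil_height_def M_def C_def d_def f_def by simp
  qed
  also have "ln (\<Prod>p\<in>S. real p ^ (m p * d)) = (\<Sum>p\<in>S. ln (real p ^ (m p * d)))"
    using pp by (intro ln_prod[OF S(1)]) auto
  also have "\<dots> = real d * (\<Sum>p\<in>S. real (m p) * ln p)"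
    using pp by (simp add: ln_realpow sum_distrib_left mult_ac)
  finally have "real d * (\<Sum>p\<in>S. real (m p) * ln p) \<le>
      real d * (ln (real (N + 1) * real H) + real N * weil_height \<alpha>)"
    by (simp add: algebra_simps)
  then show ?thesis using d0 by simp
qed

theorem northcott_number_lower:
  assumes S: "finite S" "\<And>p. p \<in> S \<Longrightarrow> prime p"
  shows "ereal (1/2 * (\<Sum>p\<in>S. ln (real p) / real (p + 1))) \<le> northcott_number (totally_padic S)"
  unfolding northcott_number_def
proof (rule Inf_greatest)
  define B where "B = 1/2 * (\<Sum>p\<in>S. ln (real p) / real (p + 1))"
  define L where "L = (\<Sum>p\<in>S. ln (real p))"
  fix x assume "x \<in> {ereal t |t. 0 \<le> t \<and> infinite {\<alpha> \<in> totally_padic S. weil_height \<alpha> < t}}"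
  then obtain t where t: "x = ereal t" "t \<ge> 0" "infinite {\<alpha> \<in> totally_padic S. weil_height \<alpha> < t}" by auto
  have pp: "p > 0" "ln (real p) \<ge> 0" if "p \<in> S" for p
    using prime_gt_1_nat[OF S(2)[OF that]] by auto
  have "B \<le> t"
  proof (rule ccontr)
    assume "\<not> B \<le> t"
    then have c: "B - t > 0" by simp
    \<comment> \<open>With ln H at most E = N B + L / 2 and a gain of at least 2 N B - L, the height
      inequality would give N (B - t) \<le> ln (N + 1) + 3 L / 2. The L / 2 stems from m + 1 in the
      class number, the L from rounding m down.\<close>
    have "filterlim (\<lambda>N. real N * (B - t) - ln (real N + 1)) at_top sequentially"
      using c by real_asymp
    then have "eventually (\<lambda>N. real N * (B - t) - ln (real N + 1) > 3/2 * L) sequentially"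
      unfolding filterlim_at_top_dense by blast
    then obtain N where N: "real N * (B - t) - ln (real N + 1) > 3/2 * L"
      by (auto simp: eventually_sequentially)
    define m where "m = (\<lambda>p. N div Suc p)"
    \<comment> \<open>N E bounds the logarithm of the number of joint classes, so coefficients up to
      exp E suffice for N + 1 places.\<close>
    define E where "E = 1/2 * (\<Sum>p\<in>S. (real N / real (p + 1) + 1) * ln (real p))"
    define H where "H = nat \<lfloor>exp E\<rfloor>"
    have E_eq: "E = real N * B + 1/2 * L"
    proof -
      have "E = (\<Sum>p\<in>S. real N * (1/2 * (ln (real p) / real (p + 1))) + 1/2 * ln (real p))"
        unfolding E_def sum_distrib_left by (intro sum.cong) (auto simp: algebra_simps add_divide_distrib)
      then show ?thesis unfolding B_def L_def by (simp only: sum.distrib sum_distrib_left)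
    qed
    have E0: "E \<ge> 0" unfolding E_def using pp by (intro mult_nonneg_nonneg sum_nonneg) auto
    have H: "real H \<le> exp E" "exp E < real H + 1" "H \<ge> 1"
      unfolding H_def using E0 by (auto simp: le_nat_floor)
    have mN: "m p * Suc p \<le> N" for p unfolding m_def by (rule div_times_less_eq_dividend)
    have "(\<Sum>p\<in>S. real (Suc p * (\<Sum>i\<le>m p. i)) * ln (real p)) \<le>
        (\<Sum>p\<in>S. real N * (1/2 * ((real N / real (p + 1) + 1) * ln (real p))))"
    proof (rule sum_mono)
      fix p assume p: "p \<in> S"
      have mp: "real (m p) * real (Suc p) \<le> real N" using mN[of p] by (simp only: of_nat_mult[symmetric] of_nat_le_iff)
      then have mp': "real (m p) \<le> real N / real (p + 1)" by (simp add: field_simps)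
      define s where "s = (\<Sum>i\<le>m p. i)"
      have "2 * s = m p * Suc (m p)" using gauss_sum_nat[of "m p"] by (simp add: s_def atMost_atLeast0)
      then have "real (2 * s) = real (m p * Suc (m p))" by (rule arg_cong)
      then have g: "2 * real s = real (m p) * (real (m p) + 1)" by (simp add: distrib_left)
      have "2 * real (Suc p * s) = real (Suc p) * (2 * real s)" by (simp only: of_nat_mult mult_ac)
      also have "\<dots> = real (m p) * real (Suc p) * (real (m p) + 1)" unfolding g by (simp only: mult_ac)
      also have "\<dots> \<le> real N * (real N / real (p + 1) + 1)" using mp mp' by (intro mult_mono) auto
      finally have "real (Suc p * s) \<le> real N * (1/2 * (real N / real (p + 1) + 1))" by simp
      from mult_right_mono[OF this pp(2)[OF p]]
      show "real (Suc p * (\<Sum>i\<le>m p. i)) * ln (real p) \<le> real N * (1/2 * ((real N / real (p + 1) + 1) * ln (real p)))"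
        unfolding s_def[symmetric] by (simp only: mult.assoc)
    qed
    also have "(\<Sum>p\<in>S. real N * (1/2 * ((real N / real (p + 1) + 1) * ln (real p)))) = real N * E"
      unfolding E_def by (simp only: sum_distrib_left)
    finally have le: "(\<Sum>p\<in>S. real (Suc p * (\<Sum>i\<le>m p. i)) * ln (real p)) \<le> real N * E" .
    have "(\<Prod>p\<in>S. real p ^ (Suc p * (\<Sum>i\<le>m p. i))) = exp (\<Sum>p\<in>S. real (Suc p * (\<Sum>i\<le>m p. i)) * ln (real p))"
      using pp by (simp add: exp_sum[OF S(1)] exp_of_nat_mult del: of_nat_mult of_nat_sum mult_Suc)
    also have "\<dots> \<le> exp (real N * E)" using le by (simp only: exp_le_cancel_iff)
    also have "exp (real N * E) = exp E ^ N" by (rule exp_of_nat_mult)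
    also have "exp E ^ N \<le> exp E ^ (N + 1)" using E0 by (intro power_increasing) auto
    also have "\<dots> < (real H + 1) ^ (N + 1)" using H(2) by (intro power_strict_mono) auto
    finally have "real (\<Prod>p\<in>S. p ^ (Suc p * (\<Sum>i\<le>m p. i))) < real ((H + 1) ^ (N + 1))"
      by (simp only: of_nat_prod of_nat_power of_nat_add of_nat_1)
    then have "(\<Prod>p\<in>S. p ^ (Suc p * (\<Sum>i\<le>m p. i))) < (H + 1) ^ (N + 1)" by (simp only: of_nat_less_iff)
    then obtain F where F: "F \<noteq> 0" "degree F \<le> N" "\<And>i. \<bar>coeff F i\<bar> \<le> int H"
      "\<And>p. p \<in> S \<Longrightarrow> p_divisible p (m p) N F"
      using auxiliary_polynomial[of S m N H] S mN by blast
    have "{\<alpha> \<in> totally_padic S. weil_height \<alpha> < t} \<subseteq> {\<alpha>. poly (cpoly F) \<alpha> = 0}"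
    proof (intro subsetI CollectI, rule ccontr)
      fix \<alpha> assume "\<alpha> \<in> {\<alpha> \<in> totally_padic S. weil_height \<alpha> < t}" and nz: "poly (cpoly F) \<alpha> \<noteq> 0"
      then have \<alpha>: "\<alpha> \<in> totally_padic S" "weil_height \<alpha> < t" by auto
      have "(\<Sum>p\<in>S. real (m p) * ln p) \<le> ln (real (N + 1) * real H) + real N * weil_height \<alpha>"
        by (rule height_inequality[OF S \<alpha>(1) F(2-4) nz])
      also have "\<dots> \<le> ln (real (N + 1)) + E + real N * t"
      proof -
        have "ln (real (N + 1) * real H) = ln (real (N + 1)) + ln (real H)"
          using H(3) by (subst ln_mult) auto
        moreover have "ln (real H) \<le> ln (exp E)" using H by (subst ln_le_cancel_iff) auto
        moreover have "real N * weil_height \<alpha> \<le> real N * t" using \<alpha>(2) by (intro mult_left_mono) auto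
        ultimately show ?thesis by simp
      qed
      finally have up: "(\<Sum>p\<in>S. real (m p) * ln p) \<le> ln (real N + 1) + E + real N * t" by (simp add: add.commute)
      have "(\<Sum>p\<in>S. (real N / real (p + 1) - 1) * ln p) \<le> (\<Sum>p\<in>S. real (m p) * ln p)"
      proof (intro sum_mono mult_right_mono)
        fix p assume p: "p \<in> S"
        have "N < Suc p + m p * Suc p" unfolding m_def by (rule dividend_less_div_times) simp
        then have "real N < real (Suc p + m p * Suc p)" by (simp only: of_nat_less_iff)
        then show "real N / real (p + 1) - 1 \<le> real (m p)" by (simp add: field_simps)
      qed (use pp in auto)
      also have "(\<Sum>p\<in>S. (real N / real (p + 1) - 1) * ln p) = real N * (2 * B) - L"
      proof -
        have "(\<Sum>p\<in>S. (real N / real (p + 1) - 1) * ln p) =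
            (\<Sum>p\<in>S. real N * (ln (real p) / real (p + 1)) - ln (real p))"
          by (intro sum.cong refl) (simp add: algebra_simps)
        moreover have "2 * B = (\<Sum>p\<in>S. ln (real p) / real (p + 1))" by (simp add: B_def)
        ultimately show ?thesis unfolding L_def by (simp only: sum_subtractf sum_distrib_left)
      qed
      finally show False using up N unfolding E_eq by (simp add: algebra_simps)
    qed
    moreover have "finite {\<alpha>. poly (cpoly F) \<alpha> = 0}" using F(1) by (intro poly_roots_finite) simp
    ultimately show False using t(3) finite_subset by blast
  qed
  then show "ereal (1/2 * (\<Sum>p\<in>S. ln (real p) / real (p + 1))) \<le> x" unfolding t(1) B_def by simp
qed

section \<open>Legendre's formula\<close>

section \<open>The prime factorization of factorials\<close>

lemma multiplicity_fact_Suc: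
  assumes "prime p"
  shows "multiplicity p (fact (Suc n)) = multiplicity p (fact n) + multiplicity p (Suc n)"
  using assms by (subst fact_Suc) (simp add: prime_elem_multiplicity_mult_distrib del: mult_Suc)

text \<open>The multiples of p up to n are p times the numbers up to \<open>n div p\<close>.\<close>

lemma multiplicity_fact_div:
  assumes p: "prime (p :: nat)"
  shows "multiplicity p (fact n :: nat) = n div p + multiplicity p (fact (n div p) :: nat)"
proof (induction n)
  case (Suc n)
  note mf = multiplicity_fact_Suc[OF p]
  show ?case
  proof (cases "p dvd Suc n")
    case False
    then have "Suc n div p = n div p" by (metis div_Suc dvd_eq_mod_eq_0)
    moreover have "multiplicity p (Suc n) = 0" using False by (rule not_dvd_imp_multiplicity_0)
    ultimately show ?thesis using Suc mf[of n] by simp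
  next
    case True
    have d: "Suc n div p = Suc (n div p)" using True by (simp add: div_Suc dvd_eq_mod_eq_0)
    have "Suc n = p * Suc (n div p)" using True d by (metis dvd_mult_div_cancel)
    then have "multiplicity p (Suc n) = Suc (multiplicity p (Suc (n div p)))"
      using p by (simp only: prime_elem_multiplicity_mult_distrib[OF prime_imp_prime_elem] multiplicity_prime)
        (simp add: prime_elem_multiplicity_mult_distrib del: mult_Suc_right mult_Suc)
    then show ?thesis using Suc mf[of n] mf[of "n div p"] d by simp
  qed
qed (simp add: multiplicity_one_nat)

lemma multiplicity_fact_le:
  assumes p: "prime (p :: nat)"
  shows "(p - 1) * multiplicity p (fact n :: nat) \<le> n"
proof (induction n rule: less_induct)
  case (less n)
  have p1: "p > 1" by (rule prime_gt_1_nat[OF p])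
  show ?case
  proof (cases "n = 0")
    case False
    then have IH: "(p - 1) * multiplicity p (fact (n div p) :: nat) \<le> n div p"
      using p1 by (intro less.IH) simp
    have "(p - 1) * multiplicity p (fact n :: nat) \<le> (p - 1) * (n div p) + n div p"
      using IH by (subst multiplicity_fact_div[OF p]) (simp add: distrib_left)
    also have "\<dots> = p * (n div p)" using p1 by (cases p) auto
    also have "\<dots> \<le> n" by simp
    finally show ?thesis .
  qed simp
qed

section \<open>Irreducible polynomials in a residue class\<close>

section \<open>Eisenstein polynomials\<close>

text \<open>The lowest coefficients of a and b prime to q, at i and j, make coefficient i + j of f
  prime to q. So i + j = n and both are the full degrees; if both degrees were positive, the square
  of q would divide the constant coefficient.\<close>

lemma eisenstein_irreducible:
  fixes f :: "int poly"
  assumes n: "degree f = n" "n > 0" "lead_coeff f = 1" and q: "prime q"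
    and low: "\<And>i. i < n \<Longrightarrow> q dvd coeff f i" and c0: "\<not> q\<^sup>2 dvd coeff f 0"
  shows "irreducible f"
proof (rule Factorial_Ring.irreducibleI)
  show "f \<noteq> 0" using n by auto
  show "\<not> is_unit f" using n by (auto simp: is_unit_poly_iff)
  fix a b assume ab: "f = a * b"
  have nz: "a \<noteq> 0" "b \<noteq> 0" using ab \<open>f \<noteq> 0\<close> by auto
  have deg: "degree a + degree b = n" using ab n nz by (simp add: degree_mult_eq)
  have "lead_coeff f = lead_coeff a * lead_coeff b" unfolding ab by (rule lead_coeff_mult)
  then have lc: "lead_coeff a * lead_coeff b = 1" using n(3) by metis
  then have la: "is_unit (lead_coeff a)" and lb: "is_unit (lead_coeff b)"
    by (metis dvd_triv_left, metis dvd_triv_right)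
  have unitq: "\<not> q dvd u" if "is_unit u" for u using q that by (meson dvd_trans not_prime_unit)
  define i where "i = (LEAST i. \<not> q dvd coeff a i)"
  define j where "j = (LEAST j. \<not> q dvd coeff b j)"
  have i: "\<not> q dvd coeff a i" "i \<le> degree a" "\<And>k. k < i \<Longrightarrow> q dvd coeff a k"
  proof -
    show "\<not> q dvd coeff a i" unfolding i_def by (rule LeastI) (rule unitq[OF la])
    show "i \<le> degree a" unfolding i_def by (rule Least_le) (rule unitq[OF la])
    show "q dvd coeff a k" if "k < i" for k using not_less_Least that unfolding i_def by blast
  qed
  have j: "\<not> q dvd coeff b j" "j \<le> degree b" "\<And>k. k < j \<Longrightarrow> q dvd coeff b k"
  proof -
    show "\<not> q dvd coeff b j" unfolding j_def by (rule LeastI) (rule unitq[OF lb])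
    show "j \<le> degree b" unfolding j_def by (rule Least_le) (rule unitq[OF lb])
    show "q dvd coeff b k" if "k < j" for k using not_less_Least that unfolding j_def by blast
  qed
  have "\<not> q dvd coeff f (i + j)"
  proof
    assume d: "q dvd coeff f (i + j)"
    have "coeff f (i + j) = (\<Sum>k\<le>i + j. coeff a k * coeff b (i + j - k))"
      unfolding ab coeff_mult ..
    also have "\<dots> = coeff a i * coeff b j + (\<Sum>k\<in>{..i + j} - {i}. coeff a k * coeff b (i + j - k))"
      by (subst sum.remove[of _ i]) auto
    finally have "coeff a i * coeff b j =
      coeff f (i + j) - (\<Sum>k\<in>{..i + j} - {i}. coeff a k * coeff b (i + j - k))" by simp
    moreover have "q dvd (\<Sum>k\<in>{..i + j} - {i}. coeff a k * coeff b (i + j - k))"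
    proof (rule dvd_sum)
      fix k assume k: "k \<in> {..i + j} - {i}"
      show "q dvd coeff a k * coeff b (i + j - k)"
      proof (cases "k < i")
        case False
        then have "i + j - k < j" using k by auto
        then show ?thesis using j(3) by simp
      qed (use i(3) in simp)
    qed
    ultimately have "q dvd coeff a i * coeff b j" using d by simp
    then show False using i(1) j(1) q by (simp add: prime_dvd_mult_iff)
  qed
  then have "i + j \<ge> n" using low by (meson not_le)
  then have ij: "i = degree a" "j = degree b" using i(2) j(2) deg by auto
  have "degree a = 0 \<or> degree b = 0"
  proof (rule ccontr)
    assume "\<not> ?thesis"
    then have "q dvd coeff a 0" "q dvd coeff b 0" using i(3) j(3) ij by auto
    then have "q * q dvd coeff a 0 * coeff b 0" by (rule mult_dvd_mono)
    then show False using c0 unfolding ab coeff_mult_0 by (simp add: power2_eq_square)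
  qed
  then show "is_unit a \<or> is_unit b"
  proof
    assume "degree a = 0"
    then obtain c where "a = [:c:]" by (auto elim: degree_eq_zeroE)
    then show ?thesis using la by (simp add: is_unit_const_poly_iff)
  next
    assume "degree b = 0"
    then obtain c where "b = [:c:]" by (auto elim: degree_eq_zeroE)
    then show ?thesis using lb by (simp add: is_unit_const_poly_iff)
  qed
qed

text \<open>Chinese remainders for each coefficient: that of g modulo M, and the pattern of an
  Eisenstein polynomial modulo q^2, where q alone would not control the constant coefficient. The
  bound M q^2 is what enters the height.\<close>

lemma eisenstein_lift:
  fixes g :: "int poly" and M q :: int
  assumes g: "degree g = n" "lead_coeff g = 1" "n > 0" and M: "M > 0" and q: "prime q" "coprime M q"
  obtains f where "irreducible f" "degree f = n" "lead_coeff f = 1"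
    "\<And>i. i < n \<Longrightarrow> 0 \<le> coeff f i \<and> coeff f i < M * q\<^sup>2" "\<And>i. M dvd coeff (f - g) i"
proof -
  have q0: "q > 1" using q(1) by (rule prime_gt_1_int)
  have cop: "coprime M (q\<^sup>2)" using q(2) by simp
  define u where "u = (\<lambda>i::nat. if i = 0 then q else 0)"
  have "\<exists>x. [x = coeff g i] (mod M) \<and> [x = u i] (mod q\<^sup>2)" for i
    by (rule binary_chinese_remainder_int[OF cop])
  then obtain x where x: "\<And>i. [x i = coeff g i] (mod M)" "\<And>i. [x i = u i] (mod q\<^sup>2)" by metis
  define c where "c = (\<lambda>i. x i mod (M * q\<^sup>2))"
  have c: "[c i = coeff g i] (mod M)" "[c i = u i] (mod q\<^sup>2)" "0 \<le> c i" "c i < M * q\<^sup>2" for i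
  proof -
    have "[c i = x i] (mod M * q\<^sup>2)" by (simp add: c_def)
    then have "[c i = x i] (mod M)" "[c i = x i] (mod q\<^sup>2)"
      by (auto intro: cong_dvd_modulus)
    then show "[c i = coeff g i] (mod M)" "[c i = u i] (mod q\<^sup>2)" using x cong_trans by blast+
    show "0 \<le> c i" "c i < M * q\<^sup>2" using M q0 by (auto simp: c_def)
  qed
  define f where "f = monom 1 n + (\<Sum>i<n. monom (c i) i)"
  have cf: "coeff f i = (if i < n then c i else if i = n then 1 else 0)" for i
    unfolding f_def by (auto simp: coeff_sum)
  have "degree f \<le> n" by (rule degree_le) (simp add: cf)
  moreover have "coeff f n = 1" by (simp add: cf)
  ultimately have df: "degree f = n" by (metis antisym le_degree zero_neq_one)
  have irr: "irreducible f"
  proof (rule eisenstein_irreducible[OF df g(3) _ q(1)])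
    show "lead_coeff f = 1" by (simp add: df cf)
    show "q dvd coeff f i" if "i < n" for i
    proof -
      have "[c i = u i] (mod q)" using c(2)[of i] by (rule cong_dvd_modulus) (simp add: power2_eq_square)
      then have "q dvd c i" using cong_dvd_iff by (metis dvd_0_right dvd_refl u_def)
      then show ?thesis using that by (simp add: cf)
    qed
    show "\<not> q\<^sup>2 dvd coeff f 0"
    proof
      assume "q\<^sup>2 dvd coeff f 0"
      then have "q\<^sup>2 dvd q" using c(2)[of 0] g(3) by (simp add: cf u_def cong_dvd_iff)
      then show False using q0 zdvd_imp_le[of "q\<^sup>2" q] by (simp add: power2_eq_square)
    qed
  qed
  have "M dvd coeff (f - g) i" for i
  proof (cases "i < n")
    case True
    then show ?thesis using c(1)[of i] by (simp add: cf cong_iff_dvd_diff)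
  next
    case False
    then show ?thesis using g by (cases "i = n") (auto simp: cf coeff_eq_0)
  qed
  then show ?thesis using that[OF irr df] c by (simp add: df cf)
qed

section \<open>Mahler measure and coefficients\<close>

section \<open>Landau's inequality\<close>

definition l2sq :: "complex poly \<Rightarrow> real" where
  "l2sq f = (\<Sum>i\<le>degree f. (cmod (coeff f i))\<^sup>2)"

lemma l2sq_altdef:
  assumes "degree f \<le> n"
  shows "l2sq f = (\<Sum>i\<le>n. (cmod (coeff f i))\<^sup>2)"
  unfolding l2sq_def using assms by (intro sum.mono_neutral_left) (auto simp: coeff_eq_0)

text \<open>X - a and 1 - cnj(a) X have the same modulus on the unit circle. On coefficients this is
  an identity whose cross terms agree; the remaining squares match after summation, since G is the
  coefficient sequence of g shifted by one.\<close>

lemma l2sq_reflect_factor: "l2sq ([:-a, 1:] * g) = l2sq ([:1, - cnj a:] * g)"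
proof -
  define n where "n = degree g"
  have d: "degree ([:x, y:] * g) \<le> Suc n" for x y
    by (rule order_trans[OF degree_mult_le]) (auto simp: n_def)
  define G where "G = (\<lambda>i. case i of 0 \<Rightarrow> 0 | Suc k \<Rightarrow> coeff g k)"
  have c: "coeff ([:x, y:] * g) i = x * coeff g i + y * G i" for x y i
    by (simp add: G_def coeff_pCons split: nat.splits)
  have "(cmod (b - a * w))\<^sup>2 + ((cmod w)\<^sup>2 + (cmod a)\<^sup>2 * (cmod b)\<^sup>2) =
      (cmod (w - cnj a * b))\<^sup>2 + ((cmod b)\<^sup>2 + (cmod a)\<^sup>2 * (cmod w)\<^sup>2)" for b w
    unfolding cmod_power2 by (simp add: power2_eq_square algebra_simps)
  then have pt: "(cmod (- a * coeff g i + 1 * G i))\<^sup>2 + ((cmod (coeff g i))\<^sup>2 + (cmod a)\<^sup>2 * (cmod (G i))\<^sup>2) =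
      (cmod (1 * coeff g i + - cnj a * G i))\<^sup>2 + ((cmod (G i))\<^sup>2 + (cmod a)\<^sup>2 * (cmod (coeff g i))\<^sup>2)" for i
    by (metis (no_types, opaque_lifting) add.commute diff_conv_add_uminus mult_1 mult_minus_left)
  have sG: "(\<Sum>i\<le>Suc n. (cmod (G i))\<^sup>2) = (\<Sum>i\<le>Suc n. (cmod (coeff g i))\<^sup>2)"
    by (subst (1) sum.atMost_Suc_shift) (simp add: G_def n_def coeff_eq_0)
  have "l2sq ([:-a, 1:] * g) + ((\<Sum>i\<le>Suc n. (cmod (coeff g i))\<^sup>2) + (cmod a)\<^sup>2 * (\<Sum>i\<le>Suc n. (cmod (G i))\<^sup>2)) =
     l2sq ([:1, - cnj a:] * g) + ((\<Sum>i\<le>Suc n. (cmod (G i))\<^sup>2) + (cmod a)\<^sup>2 * (\<Sum>i\<le>Suc n. (cmod (coeff g i))\<^sup>2))"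
    unfolding l2sq_altdef[OF d] c sum_distrib_left sum.distrib[symmetric] pt ..
  then show ?thesis unfolding sG by simp
qed

text \<open>Reflecting the roots outside the unit circle leaves the norm unchanged and moves their
  absolute values into the leading coefficient, which is bounded by the norm.\<close>

lemma Landau_inequality:
  assumes "finite C"
  shows "(\<Prod>\<beta>\<in>C. max 1 (cmod \<beta>))\<^sup>2 \<le> l2sq (\<Prod>\<beta>\<in>C. [:-\<beta>, 1:])"
proof -
  define h where "h = (\<lambda>\<beta>. if cmod \<beta> > 1 then [:1, - cnj \<beta>:] else [:-\<beta>, 1:])"
  have "l2sq (g * (\<Prod>\<beta>\<in>C. [:-\<beta>, 1:])) = l2sq (g * (\<Prod>\<beta>\<in>C. h \<beta>))" for g
    using assms
  proof (induction C arbitrary: g rule: finite_induct)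
    case (insert \<beta> C)
    have "l2sq (g * (\<Prod>\<beta>\<in>insert \<beta> C. [:-\<beta>, 1:])) = l2sq ((g * [:-\<beta>, 1:]) * (\<Prod>\<beta>\<in>C. [:-\<beta>, 1:]))"
      by (simp only: prod.insert[OF insert.hyps] mult.assoc)
    also have "\<dots> = l2sq ((g * [:-\<beta>, 1:]) * (\<Prod>\<beta>\<in>C. h \<beta>))" by (rule insert.IH)
    also have "\<dots> = l2sq ([:-\<beta>, 1:] * (g * (\<Prod>\<beta>\<in>C. h \<beta>)))" by (simp only: mult_ac)
    also have "\<dots> = l2sq (h \<beta> * (g * (\<Prod>\<beta>\<in>C. h \<beta>)))"
      unfolding h_def using l2sq_reflect_factor by auto
    also have "\<dots> = l2sq (g * (\<Prod>\<beta>\<in>insert \<beta> C. h \<beta>))"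
      by (simp only: prod.insert[OF insert.hyps] mult_ac)
    finally show ?case .
  qed simp
  from this[of 1] have eq: "l2sq (\<Prod>\<beta>\<in>C. [:-\<beta>, 1:]) = l2sq (\<Prod>\<beta>\<in>C. h \<beta>)" by simp
  have "cmod (lead_coeff (h \<beta>)) = max 1 (cmod \<beta>)" for \<beta>
    by (auto simp: h_def max_def)
  then have "(\<Prod>\<beta>\<in>C. max 1 (cmod \<beta>)) = cmod (lead_coeff (\<Prod>\<beta>\<in>C. h \<beta>))"
    by (simp add: lead_coeff_prod prod_norm[symmetric])
  moreover have "(cmod (lead_coeff f))\<^sup>2 \<le> l2sq f" for f
    unfolding l2sq_def by (rule member_le_sum) auto
  ultimately show ?thesis unfolding eq by metis
qed

text \<open>Landau's inequality with the trivial bound (n + 1) B^2 for the squared norm.\<close>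

lemma weil_height_le:
  assumes f: "irreducible f" "lead_coeff f = 1" "degree f = n" "n > 0"
    and B: "\<And>i. i \<le> n \<Longrightarrow> \<bar>real_of_int (coeff f i)\<bar> \<le> B" "B \<ge> 1" and \<alpha>: "poly (cpoly f) \<alpha> = 0"
  shows "weil_height \<alpha> \<le> (ln (real n + 1) / 2 + ln B) / real n"
proof -
  have "f \<noteq> 0" using f(4) f(3) by auto
  then have alg: "algebraic \<alpha>" using \<alpha> by (intro algebraicI[of "cpoly f"]) auto
  have mp: "min_poly_int \<alpha> = f" by (rule min_poly_int_eqI[OF alg f(1) _ \<alpha>]) (simp add: f(2))
  define C where "C = conjugates \<alpha>"
  have fac: "cpoly f = (\<Prod>\<beta>\<in>C. [:-\<beta>, 1:])"
    using min_poly_int_factorization[OF alg] unfolding mp C_def by (simp add: f(2))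
  define P where "P = (\<Prod>\<beta>\<in>C. max 1 (cmod \<beta>))"
  have P1: "P \<ge> 1" unfolding P_def by (intro prod_ge_1) auto
  have "P\<^sup>2 \<le> l2sq (cpoly f)"
    unfolding P_def fac C_def by (rule Landau_inequality[OF finite_conjugates[OF alg]])
  also have "\<dots> = (\<Sum>i\<le>n. (real_of_int (coeff f i))\<^sup>2)" by (simp add: l2sq_def f(3))
  also have "\<dots> \<le> (\<Sum>i\<le>n. B\<^sup>2)"
    using B by (intro sum_mono) (metis abs_le_square_iff abs_of_nonneg atMost_iff order_trans zero_le_one)
  also have "\<dots> = (real n + 1) * B\<^sup>2" by (simp add: add.commute)
  finally have "ln (P\<^sup>2) \<le> ln ((real n + 1) * B\<^sup>2)" using P1 by (intro ln_mono) auto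
  then have "2 * ln P \<le> ln (real n + 1) + 2 * ln B"
    using P1 B(2) by (simp add: ln_realpow ln_mult)
  moreover have "weil_height \<alpha> = ln P / real n"
    unfolding weil_height_def mp C_def[symmetric] P_def[symmetric] using f by simp
  ultimately show ?thesis using f(4) by (simp add: divide_right_mono)
qed

section \<open>Fixed points of p-adic contractions\<close>

section \<open>Polynomials with roots close to integers\<close>

context p_valuation
begin

text \<open>Lipschitz with constant 1, and rational at integral rational points. Only p times such a
  map contracts, and the iterates of that map from 0 are rational.\<close>

definition contracting :: "(complex \<Rightarrow> complex) \<Rightarrow> bool" where
  "contracting \<phi> \<longleftrightarrow> (\<forall>x\<in>V. \<phi> x \<in> V) \<and> (\<forall>x\<in>V \<inter> \<rat>. \<phi> x \<in> \<rat>) \<and>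
     (\<forall>x\<in>V. \<forall>z\<in>V. \<exists>r\<in>V. \<phi> x - \<phi> z = (x - z) * r)"

lemma contracting_const: "c \<in> V \<Longrightarrow> c \<in> \<rat> \<Longrightarrow> contracting (\<lambda>_. c)"
  unfolding contracting_def by (auto intro: bexI[of _ 0])

lemma contracting_id: "contracting (\<lambda>x. x)"
  unfolding contracting_def by (auto intro: bexI[of _ 1])

lemma contracting_add:
  assumes "contracting \<phi>" "contracting \<psi>"
  shows "contracting (\<lambda>x. \<phi> x + \<psi> x)"
proof -
  have "\<exists>r\<in>V. \<phi> x + \<psi> x - (\<phi> z + \<psi> z) = (x - z) * r" if xz: "x \<in> V" "z \<in> V" for x z
  proof -
    obtain r s where "r \<in> V" "\<phi> x - \<phi> z = (x - z) * r" "s \<in> V" "\<psi> x - \<psi> z = (x - z) * s"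
      using assms xz unfolding contracting_def by meson
    then show ?thesis by (intro bexI[of _ "r + s"]) (auto simp: algebra_simps add_mem)
  qed
  then show ?thesis using assms unfolding contracting_def by (auto intro: add_mem)
qed

lemma contracting_mult:
  assumes "contracting \<phi>" "contracting \<psi>"
  shows "contracting (\<lambda>x. \<phi> x * \<psi> x)"
proof -
  have "\<exists>r\<in>V. \<phi> x * \<psi> x - \<phi> z * \<psi> z = (x - z) * r" if xz: "x \<in> V" "z \<in> V" for x z
  proof -
    obtain r s where rs: "r \<in> V" "\<phi> x - \<phi> z = (x - z) * r" "s \<in> V" "\<psi> x - \<psi> z = (x - z) * s"
      using assms xz unfolding contracting_def by meson
    have "\<phi> x * \<psi> x - \<phi> z * \<psi> z = (\<phi> x - \<phi> z) * \<psi> x + \<phi> z * (\<psi> x - \<psi> z)" by (simp add: algebra_simps)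
    also have "\<dots> = (x - z) * (r * \<psi> x + \<phi> z * s)" unfolding rs(2,4) by (simp add: algebra_simps)
    finally show ?thesis
      using rs xz assms unfolding contracting_def
      by (intro bexI[of _ "r * \<psi> x + \<phi> z * s"]) (auto intro: add_mem mult_mem)
  qed
  then show ?thesis using assms unfolding contracting_def by (auto intro: mult_mem)
qed

lemma contracting_poly: "contracting \<phi> \<Longrightarrow> contracting (\<lambda>x. poly (cpoly f) (\<phi> x))"
proof (induction f)
  case 0
  then show ?case using contracting_const[of 0] by simp
next
  case (pCons a f)
  then show ?case
    using contracting_add[OF contracting_const[of "of_int a"] contracting_mult[OF pCons.prems pCons.IH[OF pCons.prems]]]
    by (simp add: map_poly_pCons)
qed

text \<open>In the expanded product all terms but 1 contain p, and \<tau> collects the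
  quotients.\<close>

lemma contracting_prod:
  assumes "finite J" "\<And>j. j \<in> J \<Longrightarrow> t j \<in> V \<and> t j \<in> \<rat>"
  shows "\<exists>\<tau>. contracting \<tau> \<and> (\<forall>x. (\<Prod>j\<in>J. 1 + \<pi> * t j * x) = 1 + \<pi> * \<tau> x)"
  using assms
proof (induction J rule: finite_induct)
  case empty
  show ?case by (rule exI[of _ "\<lambda>_. 0"]) (simp add: contracting_const)
next
  case (insert j J)
  then obtain \<tau> where \<tau>: "contracting \<tau>" "\<And>x. (\<Prod>j\<in>J. 1 + \<pi> * t j * x) = 1 + \<pi> * \<tau> x" by auto
  have t: "contracting (\<lambda>_. t j)" "contracting (\<lambda>_. \<pi>)" using insert.prems by (auto intro: contracting_const)
  let ?\<tau> = "\<lambda>x. \<tau> x + t j * x + \<pi> * (\<tau> x * (t j * x))"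
  have "contracting ?\<tau>"
    by (intro contracting_add contracting_mult \<tau> t contracting_id)
  moreover have "(\<Prod>j\<in>insert j J. 1 + \<pi> * t j * x) = 1 + \<pi> * ?\<tau> x" for x
    unfolding prod.insert[OF insert.hyps] \<tau>(2) by (simp add: algebra_simps)
  ultimately show ?case by (intro exI[of _ ?\<tau>]) blast
qed

text \<open>As the fixed point is given, only convergence is at stake: the iterates from 0 are
  rational and agree with y to one more power of p each time.\<close>

lemma contracting_fixpoint:
  assumes \<phi>: "contracting \<phi>" and y: "y \<in> V" "y = \<pi> * \<phi> y"
  shows "y \<in> padic"
  unfolding padic_def
proof (rule CollectI, rule allI)
  fix k
  have "\<exists>c\<in>\<rat> \<inter> V. (y - c) / \<pi> ^ k \<in> V"
  proof (induction k)
    case 0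
    then show ?case using y by (intro bexI[of _ 0]) auto
  next
    case (Suc k)
    then obtain c where c: "c \<in> \<rat>" "c \<in> V" "(y - c) / \<pi> ^ k \<in> V" by auto
    obtain r where r: "r \<in> V" "\<phi> y - \<phi> c = (y - c) * r" using \<phi> y(1) c(2) unfolding contracting_def by blast
    have "(y - \<pi> * \<phi> c) / \<pi> ^ Suc k = \<pi> * (\<phi> y - \<phi> c) / \<pi> ^ Suc k"
      by (subst y(2)) (simp add: right_diff_distrib)
    also have "\<dots> = (y - c) / \<pi> ^ k * r" unfolding r(2) by simp
    also have "\<dots> \<in> V" by (rule mult_mem[OF c(3) r(1)])
    finally show ?case using c \<phi> unfolding contracting_def
      by (intro bexI[of _ "\<pi> * \<phi> c"]) (auto intro: mult_mem)
  qed
  then show "\<exists>c\<in>\<rat>. (y - c) / \<pi> ^ k \<in> V" by blast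
qed

lemma exists_closest:
  assumes "finite J" "J \<noteq> {}" "\<And>j. j \<in> J \<Longrightarrow> a j \<noteq> 0"
  shows "\<exists>i\<in>J. \<forall>j\<in>J. a i / a j \<in> V"
  using assms
proof (induction J rule: finite_ne_induct)
  case (insert j J)
  then obtain i where i: "i \<in> J" "\<And>k. k \<in> J \<Longrightarrow> a i / a k \<in> V" by auto
  have nz: "a i \<noteq> 0" "a j \<noteq> 0" using insert.prems i(1) by auto
  show ?case
  proof (cases "a i / a j \<in> V")
    case True
    then show ?thesis using i by auto
  next
    case False
    then have ji: "a j / a i \<in> V" using total[of "a i / a j"] by simp
    have "a j / a k \<in> V" if "k \<in> J" for k
    proof -
      have "a j / a k = a j / a i * (a i / a k)" using nz by simp
      also have "\<dots> \<in> V" by (rule mult_mem[OF ji i(2)[OF that]])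
      finally show ?thesis .
    qed
    then show ?thesis using nz by auto
  qed
qed auto

text \<open>Let \<open>i\<close> be the integer below \<open>n\<close> closest to the root. After the substitution
  \<open>\<alpha> = i + p\<^sup>m y\<close> the equation becomes \<open>y = p \<phi>(y)\<close> with \<open>\<phi>\<close> contracting.\<close>

lemma root_padic:
  fixes f :: "int poly"
  assumes f: "poly (cpoly f) \<alpha> = 0" "\<alpha> \<in> V"
    and fg: "\<And>i. int p ^ (m + e + 1) dvd coeff (f - (\<Prod>j<n. [:- int j, 1:])) i"
    and n: "n > 0" "n \<le> p ^ (m - 1)" "m \<ge> 1" and e: "e = multiplicity p (fact (n - 1) :: nat)"
  shows "\<alpha> \<in> padic"
proof (cases "\<exists>j<n. \<alpha> = of_nat j")
  case True
  then show ?thesis by (auto intro: Rats_padic)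
next
  case False
  define a where "a = (\<lambda>j. \<alpha> - of_nat j)"
  have anz: "a j \<noteq> 0" if "j < n" for j using False that by (auto simp: a_def)
  obtain i where i: "i < n" "\<And>j. j < n \<Longrightarrow> a i / a j \<in> V"
    using exists_closest[of "{..<n}" a] n(1) anz by auto
  define J where "J = {..<n} - {i}"
  \<comment> \<open>The derivative of the product of the X - j at i, up to sign i! (n - 1 - i)!. It
    divides (n - 1)!, so its p-part is at most p^e. Of the exponent m + e + 1, e pays for c, m for
    the substitution, and 1 is the factor of the contraction.\<close>
  define c :: complex where "c = (\<Prod>j\<in>J. of_nat i - of_nat j)"
  have cnz: "c \<noteq> 0" unfolding c_def J_def by auto
  have "[:int p ^ (m + e + 1):] dvd f - (\<Prod>j<n. [:- int j, 1:])"
    using fg by (simp only: const_poly_dvd_iff) blast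
  then obtain w where "f - (\<Prod>j<n. [:- int j, 1:]) = [:int p ^ (m + e + 1):] * w" by (rule dvdE)
  then have w: "f = (\<Prod>j<n. [:- int j, 1:]) + smult (int p ^ (m + e + 1)) w"
    by (simp add: algebra_simps)
  have cp: "poly (cpoly (\<Prod>j\<in>I. [:- int j, 1:])) x = (\<Prod>j\<in>I. x - of_nat j)" for I x
    by (induction I rule: infinite_finite_induct) (auto simp: map_poly_pCons algebra_simps)
  have eq: "(\<Prod>j<n. a j) = - (\<pi> ^ (m + e + 1) * poly (cpoly w) \<alpha>)"
    using f(1) unfolding w by (simp add: cp a_def eq_neg_iff_add_eq_0)
  have wV: "poly (cpoly w) \<alpha> \<in> V" using f(2) by (auto intro: poly_mem)
  have split: "(\<Prod>j<n. a j) = a i * (\<Prod>j\<in>J. a j)" unfolding J_def using i(1) by (subst prod.remove[of _ i]) auto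
  \<comment> \<open>As i is closest to \<alpha>, every i - j is an integral multiple of
    \<open>a j\<close>; so c may replace the product of the \<open>a j\<close>.\<close>
  have ratio: "(of_nat i - of_nat j) / a j \<in> V" if "j \<in> J" for j
  proof -
    have j: "j < n" using that by (simp add: J_def)
    have "(of_nat i - of_nat j) / a j = 1 - a i / a j" using anz[OF j] by (simp add: a_def field_simps)
    then show ?thesis using i(2)[OF j] by (simp add: diff_mem)
  qed
  have "a i * c = (\<Prod>j<n. a j) * (\<Prod>j\<in>J. (of_nat i - of_nat j) / a j)"
  proof -
    have "(\<Prod>j\<in>J. a j) \<noteq> 0" using anz by (auto simp: J_def)
    then show ?thesis unfolding split c_def by (simp add: prod_dividef)
  qed
  then have "a i * c / \<pi> ^ (m + e + 1) = - poly (cpoly w) \<alpha> * (\<Prod>j\<in>J. (of_nat i - of_nat j) / a j)"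
    unfolding eq by simp
  also have "\<dots> \<in> V" using ratio wV by (intro mult_mem minus_mem prod_mem)
  finally have aic: "a i * c / \<pi> ^ (m + e + 1) \<in> V" .
  have "\<exists>k::int. c * of_int k = of_nat (fact (n - 1))"
  proof -
    have "c = (\<Prod>j<i. of_nat i - of_nat j) * (\<Prod>j\<in>{i<..<n}. of_nat i - of_nat j)"
      unfolding c_def by (subst prod.union_disjoint[symmetric]) (use i(1) in \<open>auto simp: J_def intro!: prod.cong\<close>)
    also have "(\<Prod>j<i. of_nat i - of_nat j :: complex) = (\<Prod>j\<in>{1..i}. of_nat j)"
      by (rule prod.reindex_bij_witness[of _ "\<lambda>j. i - j" "\<lambda>j. i - j"]) (auto simp: of_nat_diff)
    also have "\<dots> = of_nat (fact i)" by (simp add: fact_prod)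
    also have "(\<Prod>j\<in>{i<..<n}. of_nat i - of_nat j :: complex) = (\<Prod>j\<in>{1..n - 1 - i}. - of_nat j)"
      by (rule prod.reindex_bij_witness[of _ "\<lambda>j. j + i" "\<lambda>j. j - i"]) (auto simp: of_nat_diff)
    also have "\<dots> = (-1) ^ (n - 1 - i) * of_nat (fact (n - 1 - i))"
      by (simp add: prod_uminus fact_prod)
    finally have c: "c = (-1) ^ (n - 1 - i) * of_nat (fact i * fact (n - 1 - i))" by simp
    have "fact i * fact (n - 1 - i) dvd (fact (i + (n - 1 - i)) :: nat)" by (rule fact_fact_dvd_fact)
    then obtain l :: nat where "fact (n - 1) = fact i * fact (n - 1 - i) * l" using i(1) by (auto elim: dvdE)
    then have "(of_nat (fact (n - 1)) :: complex) = of_nat (fact i * fact (n - 1 - i)) * of_nat l"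
      by (metis of_nat_mult)
    then have "c * of_int ((-1) ^ (n - 1 - i) * int l) = of_nat (fact (n - 1))"
      unfolding c by (simp flip: power_mult_distrib add: mult_ac)
    then show ?thesis ..
  qed
  then obtain k :: int where k: "c * of_int k = of_nat (fact (n - 1))" by blast
  obtain u where u: "(fact (n - 1) :: nat) = p ^ e * u" "\<not> p dvd u"
    using multiplicity_decompose'[of "fact (n - 1) :: nat" p] prime_p e by (metis fact_nonzero not_prime_unit)
  have uu: "vunit (of_nat u)" by (rule vunit_of_nat[OF u(2)])
  have pec: "\<pi> ^ e / c \<in> V"
  proof -
    have "c * of_int k = \<pi> ^ e * of_nat u" unfolding k u(1) by simp
    then have "\<pi> ^ e / c = of_int k * inverse (of_nat u)" using cnz uu by (simp add: vunit_def field_simps)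
    then show ?thesis using uu by (simp add: vunit_def mult_mem)
  qed
  define y where "y = a i / \<pi> ^ m"
  have yV: "y \<in> V"
  proof -
    have "y = a i * c / \<pi> ^ (m + e + 1) * (\<pi> ^ e / c) * \<pi>" using cnz by (simp add: y_def power_add)
    also have "\<dots> \<in> V" by (rule mult_mem[OF mult_mem[OF aic pec] of_nat_mem])
    finally show ?thesis .
  qed
  have \<alpha>y: "\<alpha> = of_nat i + \<pi> ^ m * y" by (simp add: y_def a_def)
  \<comment> \<open>Since |i - j| < n \<le> p^(m - 1), the number \<open>t j\<close> is integral.
    The remaining p of p^m appears in \<open>a j\<close> = (i - j) (1 + p t j y).\<close>
  define t where "t = (\<lambda>j. \<pi> ^ (m - 1) / (of_nat i - of_nat j))"
  have t: "t j \<in> V \<and> t j \<in> \<rat>" if "j \<in> J" for j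
  proof
    have ij: "int i - int j \<noteq> 0" "j < n" using that by (auto simp: J_def)
    have "\<not> int p ^ (m - 1) dvd int i - int j"
    proof
      assume "int p ^ (m - 1) dvd int i - int j"
      then have "int p ^ (m - 1) \<le> \<bar>int i - int j\<bar>" using ij by (intro zdvd_imp_le) auto
      also have "\<dots> < int n" using ij i(1) by auto
      also have "\<dots> \<le> int (p ^ (m - 1))" using n(2) by (simp only: of_nat_le_iff)
      finally show False by simp
    qed
    then have "of_int (int i - int j) / \<pi> ^ (m - 1) \<notin> V" using of_int_div_p_power_iff by blast
    then show "t j \<in> V" using mem_inverse unfolding t_def by fastforce
    show "t j \<in> \<rat>" unfolding t_def by auto
  qed
  obtain \<tau> where \<tau>: "contracting \<tau>" "\<And>x. (\<Prod>j\<in>J. 1 + \<pi> * t j * x) = 1 + \<pi> * \<tau> x"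
    using contracting_prod[of J t] t by (auto simp: J_def)
  have "(\<Prod>j\<in>J. a j) = c * (1 + \<pi> * \<tau> y)"
  proof -
    have "a j = (of_nat i - of_nat j) * (1 + \<pi> * t j * y)" if "j \<in> J" for j
    proof -
      have nz: "(of_nat i - of_nat j :: complex) \<noteq> 0" using that by (auto simp: J_def)
      have "\<pi> * \<pi> ^ (m - 1) = \<pi> ^ m" using n(3) by (cases m) auto
      then have e0: "(of_nat i - of_nat j) * (\<pi> * t j * y) = \<pi> ^ m * y"
        unfolding t_def using nz by (simp add: field_simps)
      have "a j = of_nat i - of_nat j + \<pi> ^ m * y" by (simp add: a_def \<alpha>y)
      also have "\<dots> = (of_nat i - of_nat j) * (1 + \<pi> * t j * y)"
        unfolding e0[symmetric] by (simp only: distrib_left mult_1_right)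
      finally show ?thesis .
    qed
    then have "(\<Prod>j\<in>J. a j) = (\<Prod>j\<in>J. (of_nat i - of_nat j) * (1 + \<pi> * t j * y))" by (rule prod.cong[OF refl])
    then show ?thesis by (simp only: prod.distrib c_def \<tau>(2))
  qed
  then have main: "\<pi> ^ m * y * (c * (1 + \<pi> * \<tau> y)) = - (\<pi> ^ (m + e + 1) * poly (cpoly w) \<alpha>)"
    using eq unfolding split by (simp add: y_def)
  \<comment> \<open>The equation divided by p^m c and solved for its linear term y.\<close>
  define \<phi> where "\<phi> = (\<lambda>x. - (\<pi> ^ e / c) * poly (cpoly w) (of_nat i + \<pi> ^ m * x) + -1 * (x * \<tau> x))"
  have "contracting \<phi>"
    unfolding \<phi>_def
  proof (intro contracting_add contracting_mult contracting_poly contracting_id \<tau>(1) contracting_const)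
    show "- (\<pi> ^ e / c) \<in> V" by (rule minus_mem[OF pec])
    have "c \<in> \<rat>" unfolding c_def by (auto intro!: Rats_prod)
    then show "- (\<pi> ^ e / c) \<in> \<rat>" by auto
  qed (auto intro: power_mem minus_mem)
  moreover have "y = \<pi> * \<phi> y"
  proof -
    have "\<pi> ^ m * c * (y * (1 + \<pi> * \<tau> y)) = \<pi> ^ m * c * (- \<pi> * (\<pi> ^ e / c) * poly (cpoly w) \<alpha>)"
      using main cnz by (simp add: power_add mult_ac)
    moreover have "\<pi> ^ m * c \<noteq> 0" using cnz by simp
    ultimately have K: "y * (1 + \<pi> * \<tau> y) = - \<pi> * (\<pi> ^ e / c) * poly (cpoly w) \<alpha>"
      using mult_left_cancel by blast
    have "y = y * (1 + \<pi> * \<tau> y) + \<pi> * (-1 * (y * \<tau> y))" by (simp add: algebra_simps)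
    also have "\<dots> = \<pi> * \<phi> y"
      unfolding K \<phi>_def \<alpha>y[symmetric] by (simp only: distrib_left mult_minus_left mult_minus_right mult.assoc)
    finally show ?thesis .
  qed
  ultimately have y: "y \<in> padic" using contracting_fixpoint yV by blast
  have R: "\<pi> ^ m \<in> padic" "of_nat i \<in> padic" "0 \<in> padic" by (auto intro: Rats_padic)
  have "of_nat i - (0 - \<pi> ^ m * y) \<in> padic"
    by (rule padic_diff[OF R(2) padic_diff[OF R(3) padic_mult[OF R(1) y]]])
  then show ?thesis by (simp add: \<alpha>y)
qed

end

section \<open>Totally p-adic numbers of small height\<close>

section \<open>The upper bound\<close>

text \<open>The exponent \<open>k p\<close> is that of \<open>root_padic\<close> with m = l + 1: the
  degree 2^l is at most p^l for every prime p. The part \<open>e p\<close>, at most n / (p - 1),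
  yields the main term of ln M / n. The other l + 2 factors p, the q^2 and Landau's n + 1 yield
  terms that vanish as l grows.\<close>

lemma exists_totally_padic_of_small_height:
  assumes S: "finite S" "\<And>p. p \<in> S \<Longrightarrow> prime p" and q: "prime q" "q \<notin> S"
  shows "\<exists>\<alpha>\<in>totally_padic S. degree (min_poly_int \<alpha>) = 2 ^ l \<and>
    weil_height \<alpha> \<le> (\<Sum>p\<in>S. ln (real p) / real (p - 1)) +
      (ln (2 ^ l + 1) / 2 + 2 * ln (real q) + (real l + 2) * (\<Sum>p\<in>S. ln (real p))) / 2 ^ l"
proof -
  define n :: nat where "n = 2 ^ l"
  have n0: "n > 0" by (simp add: n_def)
  define g where "g = (\<Prod>j<n. [:- int j, 1:])"
  have g: "degree g = n" "lead_coeff g = 1"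
    unfolding g_def lead_coeff_prod by (simp_all add: degree_prod_sum_eq)
  define e where "e = (\<lambda>p. multiplicity p (fact (n - 1) :: nat))"
  define k where "k = (\<lambda>p. l + 1 + e p + 1)"
  define M where "M = (\<Prod>p\<in>S. int p ^ k p)"
  have p1: "p > 1" if "p \<in> S" for p by (rule prime_gt_1_nat[OF S(2)[OF that]])
  have M0: "M > 0" unfolding M_def by (intro prod_pos) (use p1 in fastforce)
  have q1: "q > 1" by (rule prime_gt_1_nat[OF q(1)])
  have cop: "coprime M (int q)"
    unfolding M_def
  proof (rule prod_coprime_left)
    fix p assume "p \<in> S"
    then have "coprime (int p) (int q)" using S(2) q by (intro primes_coprime) auto
    then show "coprime (int p ^ k p) (int q)" by simp
  qed
  have "prime (int q)" using q(1) by simp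
  then obtain f where f: "irreducible f" "degree f = n" "lead_coeff f = 1"
    "\<And>i. i < n \<Longrightarrow> 0 \<le> coeff f i \<and> coeff f i < M * (int q)\<^sup>2" "\<And>i. M dvd coeff (f - g) i"
    using eisenstein_lift[OF g n0 M0 _ cop] by blast
  have "\<exists>\<alpha>. poly (cpoly f) \<alpha> = 0"
    by (rule alg_closed_imp_poly_has_root) (simp add: f(2) n0)
  then obtain \<alpha> where \<alpha>: "poly (cpoly f) \<alpha> = 0" by blast
  have int: "algebraic_int \<alpha>" unfolding algebraic_int_altdef_ipoly using \<alpha> f(3) by blast
  then have alg: "algebraic \<alpha>" by blast
  have mp: "min_poly_int \<alpha> = f" by (rule min_poly_int_eqI[OF alg f(1) _ \<alpha>]) (simp add: f(3))
  have "\<alpha> \<in> totally_padic S"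
    unfolding totally_padic_def
  proof (intro CollectI conjI alg ballI allI impI)
    fix p V assume p: "p \<in> S" and V: "p_valuation V p"
    interpret p_valuation V p by (rule V)
    have "int p ^ k p dvd M" unfolding M_def using p S(1) by (intro dvd_prodI)
    then have dvd: "int p ^ (l + 1 + e p + 1) dvd coeff (f - (\<Prod>j<n. [:- int j, 1:])) i" for i
      using f(5) dvd_trans unfolding k_def g_def by blast
    have "n \<le> p ^ (l + 1 - 1)" unfolding n_def using p1[OF p] by (simp add: power_mono)
    then show "\<alpha> \<in> padic"
      using root_padic[OF \<alpha> algebraic_int_mem[OF int] dvd n0 _ _ e_def[THEN fun_cong]] by simp
  qed
  moreover have "degree (min_poly_int \<alpha>) = 2 ^ l" by (simp add: mp f(2) n_def)
  moreover have "weil_height \<alpha> \<le> (\<Sum>p\<in>S. ln (real p) / real (p - 1)) +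
      (ln (2 ^ l + 1) / 2 + 2 * ln (real q) + (real l + 2) * (\<Sum>p\<in>S. ln (real p))) / 2 ^ l"
  proof -
    define B where "B = real_of_int (M * (int q)\<^sup>2)"
    have "M * (int q)\<^sup>2 > 0" using M0 q1 by simp
    then have B1: "B \<ge> 1" unfolding B_def by linarith
    have cB: "\<bar>real_of_int (coeff f i)\<bar> \<le> B" if "i \<le> n" for i
    proof (cases "i = n")
      case True
      then show ?thesis using f(2,3) B1 by simp
    next
      case False
      then have "i < n" using that by simp
      then show ?thesis using f(4)[of i] unfolding B_def by linarith
    qed
    have "weil_height \<alpha> \<le> (ln (real n + 1) / 2 + ln B) / real n"
      by (rule weil_height_le[OF f(1,3,2) n0 cB B1 \<alpha>])
    also have "ln B \<le> real n * (\<Sum>p\<in>S. ln (real p) / real (p - 1)) + 2 * ln (real q) + (real l + 2) * (\<Sum>p\<in>S. ln (real p))"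
    proof -
      have p0: "p > 0" if "p \<in> S" for p using p1[OF that] by simp
      have prpos: "(\<Prod>p\<in>S. real p ^ k p) > 0" by (intro prod_pos) (simp add: p0)
      have "B = (\<Prod>p\<in>S. real p ^ k p) * real q ^ 2" by (simp add: B_def M_def)
      then have "ln B = ln (\<Prod>p\<in>S. real p ^ k p) + ln (real q ^ 2)"
        using prpos q1 by (simp add: ln_mult)
      also have "ln (\<Prod>p\<in>S. real p ^ k p) = (\<Sum>p\<in>S. real (k p) * ln (real p))"
        using S(1) by (subst ln_prod) (auto simp: p0 ln_realpow intro!: sum.cong)
      also have "\<dots> \<le> (\<Sum>p\<in>S. real n * (ln (real p) / real (p - 1)) + (real l + 2) * ln (real p))"
      proof (rule sum_mono)
        fix p assume p: "p \<in> S"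
        have "(p - 1) * e p \<le> n" using multiplicity_fact_le[OF S(2)[OF p], of "n - 1"] unfolding e_def by simp
        then have "real (p - 1) * real (e p) \<le> real n" by (simp only: of_nat_mult[symmetric] of_nat_le_iff)
        then have "real (e p) \<le> real n / real (p - 1)" using p1[OF p] by (simp add: field_simps)
        then have "real (k p) \<le> real n / real (p - 1) + (real l + 2)" by (simp add: k_def)
        then have "real (k p) * ln (real p) \<le> (real n / real (p - 1) + (real l + 2)) * ln (real p)"
          using p1[OF p] by (intro mult_right_mono) auto
        then show "real (k p) * ln (real p) \<le> real n * (ln (real p) / real (p - 1)) + (real l + 2) * ln (real p)"
          by (simp add: distrib_right)
      qed
      also have "\<dots> = real n * (\<Sum>p\<in>S. ln (real p) / real (p - 1)) + (real l + 2) * (\<Sum>p\<in>S. ln (real p))"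
        by (simp only: sum.distrib sum_distrib_left)
      finally show ?thesis using q1 by (simp add: ln_realpow)
    qed
    finally have "weil_height \<alpha> \<le> (ln (real n + 1) / 2 + (real n * (\<Sum>p\<in>S. ln (real p) / real (p - 1)) +
        2 * ln (real q) + (real l + 2) * (\<Sum>p\<in>S. ln (real p)))) / real n"
      using n0 by (simp add: divide_right_mono)
    also have "\<dots> = (\<Sum>p\<in>S. ln (real p) / real (p - 1)) +
        (ln (real n + 1) / 2 + 2 * ln (real q) + (real l + 2) * (\<Sum>p\<in>S. ln (real p))) / real n"
      using n0 by (simp add: field_simps)
    finally show ?thesis by (simp add: n_def)
  qed
  ultimately show ?thesis by blast
qed

theorem northcott_number_upper:
  assumes S: "finite S" "\<And>p. p \<in> S \<Longrightarrow> prime p"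
  shows "northcott_number (totally_padic S) \<le> ereal (\<Sum>p\<in>S. ln (real p) / real (p - 1))"
proof (rule ccontr)
  define \<Sigma> where "\<Sigma> = (\<Sum>p\<in>S. ln (real p) / real (p - 1))"
  define L where "L = (\<Sum>p\<in>S. ln (real p))"
  assume "\<not> northcott_number (totally_padic S) \<le> ereal (\<Sum>p\<in>S. ln (real p) / real (p - 1))"
  then have "ereal \<Sigma> < northcott_number (totally_padic S)" by (simp add: \<Sigma>_def)
  then obtain t where t: "ereal \<Sigma> < ereal t" "ereal t < northcott_number (totally_padic S)"
    using ereal_dense2 by blast
  have \<Sigma>0: "\<Sigma> \<ge> 0"
    unfolding \<Sigma>_def using prime_gt_1_nat[OF S(2)] by (intro sum_nonneg divide_nonneg_nonneg ln_ge_zero) force+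
  obtain q where q: "prime q" "q \<notin> S"
    using primes_infinite S(1) by (metis finite_subset mem_Collect_eq subsetI)
  have "\<forall>l. \<exists>\<alpha>. \<alpha> \<in> totally_padic S \<and> degree (min_poly_int \<alpha>) = 2 ^ l \<and>
      weil_height \<alpha> \<le> \<Sigma> + (ln (2 ^ l + 1) / 2 + 2 * ln (real q) + (real l + 2) * L) / 2 ^ l"
    using exists_totally_padic_of_small_height[OF S q] unfolding \<Sigma>_def L_def by blast
  from choice[OF this] obtain a where a: "\<And>l. a l \<in> totally_padic S" "\<And>l. degree (min_poly_int (a l)) = 2 ^ l"
    "\<And>l. weil_height (a l) \<le> \<Sigma> + (ln (2 ^ l + 1) / 2 + 2 * ln (real q) + (real l + 2) * L) / 2 ^ l"
    by blast
  have "((\<lambda>l. (ln (2 ^ l + 1) / 2 + c + (real l + 2) * L) / 2 ^ l) \<longlongrightarrow> 0) sequentially" for c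
    by real_asymp
  from this[of "2 * ln (real q)"]
  have "((\<lambda>l. (ln (2 ^ l + 1) / 2 + 2 * ln (real q) + (real l + 2) * L) / 2 ^ l) \<longlongrightarrow> 0) sequentially" .
  then have "eventually (\<lambda>l. (ln (2 ^ l + 1) / 2 + 2 * ln (real q) + (real l + 2) * L) / 2 ^ l < t - \<Sigma>) sequentially"
    by (rule order_tendstoD) (use t(1) in simp)
  then obtain l0 where l0: "\<And>l. l \<ge> l0 \<Longrightarrow>
      (ln (2 ^ l + 1) / 2 + 2 * ln (real q) + (real l + 2) * L) / 2 ^ l < t - \<Sigma>"
    unfolding eventually_sequentially by blast
  \<comment> \<open>The degrees 2^l differ, so these are infinitely many numbers.\<close>
  have "inj_on a {l0..}"
  proof (rule inj_onI)
    fix i j assume "a i = a j"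
    then have "(2::nat) ^ i = 2 ^ j" using a(2) by metis
    then show "i = j" by simp
  qed
  then have "infinite (a ` {l0..})" by (simp add: finite_image_iff infinite_Ici)
  moreover have "a ` {l0..} \<subseteq> {\<alpha> \<in> totally_padic S. weil_height \<alpha> < t}"
  proof (rule image_subsetI)
    fix l assume "l \<in> {l0..}"
    then have "weil_height (a l) < t" using a(3)[of l] l0[of l] by simp
    then show "a l \<in> {\<alpha> \<in> totally_padic S. weil_height \<alpha> < t}" using a(1) by simp
  qed
  ultimately have "infinite {\<alpha> \<in> totally_padic S. weil_height \<alpha> < t}" using finite_subset by blast
  then have "northcott_number (totally_padic S) \<le> ereal t"
    unfolding northcott_number_def using t(1) \<Sigma>0 by (intro Inf_lower) auto
  then show False using t(2) by simp
qed

section \<open>A Mertens-type divergence and the choice of S\<close>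

section \<open>The choice of the primes\<close>

text \<open>The bound n / (p - 1) for the exponent of p in n! turns the growth of n! into a lower
  bound for a sum over primes.\<close>

lemma ln_fact_le:
  "ln (fact n) \<le> real n * (\<Sum>p | prime p \<and> p \<le> n. ln (real p) / real (p - 1))"
proof -
  define A where "A = {p. prime p \<and> p \<le> n}"
  have fin: "finite A" unfolding A_def by simp
  have p1: "p > 1" if "p \<in> A" for p using that prime_gt_1_nat[of p] by (simp add: A_def)
  then have p0: "p > 0" if "p \<in> A" for p using that by fastforce
  have pf: "prime_factors (fact n :: nat) \<subseteq> A"
    by (auto simp: A_def in_prime_factors_iff prime_dvd_fact_iff)
  have "(fact n :: nat) = (\<Prod>p\<in>prime_factors (fact n). p ^ multiplicity p (fact n))"
    by (rule prime_factorization_nat) simp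
  also have "\<dots> = (\<Prod>p\<in>A. p ^ multiplicity p (fact n))"
    using pf fin by (intro prod.mono_neutral_left) (auto simp: prime_factors_multiplicity A_def)
  finally have "real (fact n) = real (\<Prod>p\<in>A. p ^ multiplicity p (fact n))" by (rule arg_cong)
  then have "ln (fact n) = ln (\<Prod>p\<in>A. real p ^ multiplicity p (fact n :: nat))" by simp
  also have "\<dots> = (\<Sum>p\<in>A. real (multiplicity p (fact n :: nat)) * ln (real p))"
    using fin by (subst ln_prod) (auto simp: p0 ln_realpow intro!: sum.cong)
  also have "\<dots> \<le> (\<Sum>p\<in>A. real n * (ln (real p) / real (p - 1)))"
  proof (rule sum_mono)
    fix p assume p: "p \<in> A"
    then have "(p - 1) * multiplicity p (fact n :: nat) \<le> n" by (intro multiplicity_fact_le) (simp add: A_def)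
    then have "real (p - 1) * real (multiplicity p (fact n :: nat)) \<le> real n"
      by (simp only: of_nat_mult[symmetric] of_nat_le_iff)
    then have "real (multiplicity p (fact n :: nat)) \<le> real n / real (p - 1)"
      using p1[OF p] by (simp add: field_simps)
    then have "real (multiplicity p (fact n :: nat)) * ln (real p) \<le> real n / real (p - 1) * ln (real p)"
      using p1[OF p] by (intro mult_right_mono) auto
    then show "real (multiplicity p (fact n :: nat)) * ln (real p) \<le> real n * (ln (real p) / real (p - 1))" by simp
  qed
  also have "\<dots> = real n * (\<Sum>p\<in>A. ln (real p) / real (p - 1))" by (simp only: sum_distrib_left)
  finally show ?thesis unfolding A_def .
qed

text \<open>By convergence of the exponential series n! outgrows every geometric sequence, so with
  \<open>ln_fact_le\<close> the sum over all primes is unbounded. The constant C' includes the share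
  of the discarded primes up to P.\<close>

lemma prime_sum_unbounded:
  "\<exists>T. finite T \<and> (\<forall>p\<in>T. prime p \<and> p > P) \<and> (\<Sum>p\<in>T. ln (real p) / real (p - 1)) > C"
proof -
  define w where "w = (\<lambda>p::nat. ln (real p) / real (p - 1))"
  define C' where "C' = C + 1 + (\<Sum>p | prime p \<and> p \<le> P. w p)"
  have "(\<lambda>n. inverse (fact n) * exp C' ^ n) \<longlonglongrightarrow> 0"
    by (rule summable_LIMSEQ_zero[OF summable_exp])
  then have "eventually (\<lambda>n. inverse (fact n) * exp C' ^ n < 1) sequentially"
    by (rule order_tendstoD) simp
  then obtain n0 where n0: "\<And>n. n \<ge> n0 \<Longrightarrow> inverse (fact n) * exp C' ^ n < 1"
    unfolding eventually_sequentially by blast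
  define n where "n = n0 + P + 1"
  have "inverse (fact n) * exp C' ^ n < 1" by (rule n0) (simp add: n_def)
  then have "exp C' ^ n < fact n" by (simp add: field_simps)
  then have "ln (exp C' ^ n) < ln (fact n)" by (subst ln_less_cancel_iff) auto
  then have "real n * C' < ln (fact n)" by (simp add: ln_realpow)
  also have "\<dots> \<le> real n * (\<Sum>p | prime p \<and> p \<le> n. w p)" unfolding w_def by (rule ln_fact_le)
  finally have "C' < (\<Sum>p | prime p \<and> p \<le> n. w p)" by (simp add: n_def)
  also have "{p. prime p \<and> p \<le> n} = {p. prime p \<and> p \<le> P} \<union> {p. prime p \<and> P < p \<and> p \<le> n}"
    by (auto simp: n_def)
  also have "(\<Sum>p\<in>{p. prime p \<and> p \<le> P} \<union> {p. prime p \<and> P < p \<and> p \<le> n}. w p) =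
      (\<Sum>p | prime p \<and> p \<le> P. w p) + (\<Sum>p | prime p \<and> P < p \<and> p \<le> n. w p)"
    by (rule sum.union_disjoint) auto
  finally have "(\<Sum>p | prime p \<and> P < p \<and> p \<le> n. w p) > C" unfolding C'_def by simp
  then show ?thesis unfolding w_def by (intro exI[of _ "{p. prime p \<and> P < p \<and> p \<le> n}"]) auto
qed

text \<open>An element is added whenever at least \<delta> is still missing to R, so none of them
  overshoots.\<close>

lemma greedy_subset:
  fixes w :: "'a \<Rightarrow> real"
  assumes "finite T0" "\<And>p. p \<in> T0 \<Longrightarrow> w p \<le> \<delta>" "R \<ge> 0"
  shows "\<exists>T\<subseteq>T0. sum w T \<le> R \<and> (R - \<delta> < sum w T \<or> T = T0)"
  using assms
proof (induction T0 rule: finite_induct)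
  case (insert p T0)
  then obtain T where T: "T \<subseteq> T0" "sum w T \<le> R" "R - \<delta> < sum w T \<or> T = T0" by auto
  show ?case
  proof (cases "R - \<delta> < sum w T")
    case False
    have "T = T0" "sum w T0 \<le> R - \<delta>" using T False by auto
    moreover have "w p \<le> \<delta>" using insert.prems(1) by simp
    ultimately have "sum w (insert p T0) \<le> R" using insert.hyps by simp
    then show ?thesis by blast
  qed (use T in blast)
qed auto

theorem proposition8p6:
  fixes r :: real
  assumes "r > 0"
  shows "\<forall>\<epsilon>::real. \<epsilon> > 0 \<longrightarrow>
           (\<exists>S :: nat set. finite S \<and> (\<forall>p\<in>S. prime p) \<and>
              ereal (r - \<epsilon>) < northcott_number (max_totally_split_field S) \<and>
              northcott_number (max_totally_split_field S) \<le> ereal (2 * r))"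
proof (intro allI impI)
  fix \<epsilon> :: real assume \<epsilon>: "\<epsilon> > 0"
  \<comment> \<open>With \<delta> \<le> \<epsilon> and \<eta> r \<le> \<epsilon> / 4, half of (1 -
    \<eta>) (2 r - \<delta>) exceeds r - 3 \<epsilon> / 4.\<close>
  define \<delta> where "\<delta> = min \<epsilon> r"
  define \<eta> where "\<eta> = min (\<epsilon> / (4 * r)) 1"
  have pos: "\<delta> > 0" "\<eta> > 0" "\<delta> \<le> \<epsilon>" "\<delta> \<le> r" "\<eta> \<le> 1" "\<eta> * r \<le> \<epsilon> / 4"
    using assms \<epsilon> by (auto simp: \<delta>_def \<eta>_def min_def field_simps)
  have "((\<lambda>p. ln (real p) / (real p - 1)) \<longlongrightarrow> 0) sequentially" by real_asymp
  then have e1: "eventually (\<lambda>p. ln (real p) / (real p - 1) < \<delta>) sequentially"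
    by (rule order_tendstoD) (rule pos)
  have "((\<lambda>p. 2 / (real p + 1)) \<longlongrightarrow> 0) sequentially" by real_asymp
  then have e2: "eventually (\<lambda>p. 2 / (real p + 1) < \<eta>) sequentially"
    by (rule order_tendstoD) (rule pos)
  \<comment> \<open>Beyond P each prime contributes less than \<delta> to the upper sum, and the
    ratio (p - 1) / (p + 1) between the terms of the two sums exceeds 1 - \<eta>.\<close>
  obtain P where P: "\<And>p. p \<ge> P \<Longrightarrow> ln (real p) / (real p - 1) < \<delta> \<and> 2 / (real p + 1) < \<eta>"
    using eventually_conj[OF e1 e2] unfolding eventually_sequentially by blast
  define w where "w = (\<lambda>p::nat. ln (real p) / real (p - 1))"
  obtain T where T: "finite T" "\<And>p. p \<in> T \<Longrightarrow> prime p \<and> p > P" "sum w T > 2 * r"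
    using prime_sum_unbounded[of P "2 * r"] unfolding w_def by blast
  have wd: "w p \<le> \<delta>" if "p \<in> T" for p
    using P[of p] T(2)[OF that] prime_gt_1_nat[of p] by (simp add: w_def of_nat_diff)
  obtain S where S: "S \<subseteq> T" "sum w S \<le> 2 * r" "2 * r - \<delta> < sum w S \<or> S = T"
    using greedy_subset[of T w \<delta> "2 * r"] T(1) wd assms by auto
  have lowS: "2 * r - \<delta> < sum w S" using S(3) T(3) pos(1) by auto
  have prS: "finite S" "\<And>p. p \<in> S \<Longrightarrow> prime p" using S(1) T finite_subset by auto
  have "r - \<epsilon> < 1/2 * (\<Sum>p\<in>S. ln (real p) / real (p + 1))"
  proof -
    have "(1 - \<eta>) * sum w S \<le> (\<Sum>p\<in>S. ln (real p) / real (p + 1))"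
      unfolding sum_distrib_left
    proof (rule sum_mono)
      fix p assume p: "p \<in> S"
      then have p1: "p > 1" by (intro prime_gt_1_nat prS(2))
      have "P \<le> p" using p S(1) T(2) by (auto intro: less_imp_le)
      then have "2 / (real p + 1) < \<eta>" using P by blast
      then have "1 - \<eta> \<le> 1 - 2 / (real p + 1)" by simp
      also have "\<dots> = (real p - 1) / (real p + 1)" by (simp add: field_simps)
      finally have "(1 - \<eta>) * w p \<le> (real p - 1) / (real p + 1) * w p"
        using p1 by (intro mult_right_mono) (auto simp: w_def)
      also have "\<dots> = ln (real p) / real (p + 1)" using p1 by (simp add: w_def of_nat_diff add.commute)
      finally show "(1 - \<eta>) * w p \<le> ln (real p) / real (p + 1)" .
    qed
    moreover have "(1 - \<eta>) * (2 * r - \<delta>) \<le> (1 - \<eta>) * sum w S"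
      using lowS pos(5) by (intro mult_left_mono) auto
    moreover have "(1 - \<eta>) * (2 * r - \<delta>) = 2 * r - \<delta> - 2 * (\<eta> * r) + \<eta> * \<delta>" by (simp add: algebra_simps)
    moreover have "\<eta> * \<delta> > 0" using pos by simp
    ultimately show ?thesis using pos(3,6) \<epsilon> by linarith
  qed
  then have "ereal (r - \<epsilon>) < ereal (1/2 * (\<Sum>p\<in>S. ln (real p) / real (p + 1)))" by simp
  also have "\<dots> \<le> northcott_number (totally_padic S)" by (rule northcott_number_lower[OF prS])
  finally have lower: "ereal (r - \<epsilon>) < northcott_number (totally_padic S)" .
  have "northcott_number (totally_padic S) \<le> ereal (sum w S)"
    unfolding w_def by (rule northcott_number_upper[OF prS])
  also have "\<dots> \<le> ereal (2 * r)" using S(2) by simp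
  finally have upper: "northcott_number (totally_padic S) \<le> ereal (2 * r)" .
  show "\<exists>S :: nat set. finite S \<and> (\<forall>p\<in>S. prime p) \<and>
      ereal (r - \<epsilon>) < northcott_number (max_totally_split_field S) \<and>
      northcott_number (max_totally_split_field S) \<le> ereal (2 * r)"
    by (rule exI[of _ S]) (use prS lower upper max_totally_split_field_eq[of S] in auto)
qed

end
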